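(* Let $M$ be a von Neumann algebra (with separable predual) equipped with a faithful normal tracial state $\tau$, let $a\in M$ be self-adjoint, and let $A$ be the von Neumann subalgebra of $M$ generated by $a$. Let $t_0,t_1\in\mathbb{R}$ be such that $t_0<t_1$ and $\delta:=F_a(t_1)-F_a(t_0)>0$. Suppose that either (1) we are in the continuous case, i.e. for each $B\in\{M,A\}$ and each $p\in\mathcal{P}(B)$ one has $\{\tau(r): r\in\mathcal{P}(B),\ r\le p\}=[0,\tau(p)]$; or (2) ("finite case") $M$ is a type $I_n$ factor for some $n\in\mathbb{N}$ and $a$ has spectrum $\{\lambda_1<\lambda_2<\cdots<\lambda_n\}$ (i.e. $n$ distinct eigenvalues). Then $$\int_{F_a(t_0)}^{F_a(t_1)}X_a(s)\,ds=\sup_{\substack{r\in\mathcal{P}(M)\\ \tau(r)\ge 1-F_a(t_0)}}\ \inf_{\substack{q\in\mathcal{P}(M)\\ q\le r\\ \tau(q)=\delta}}\tau(aq).$$ Moreover, there exists $r_0\in\mathcal{P}(A)\subset\mathcal{P}(M)$ with $\tau(r_0)\ge 1-F_a(t_0)$ such that $$\int_{F_a(t_0)}^{F_a(t_1)}X_a(s)\,ds=\min_{\substack{q\in\mathcal{P}(M)\\ q\le r_0\\ \tau(q)=\delta}}\tau(aq),$$ so that the supremum is actually a maximum.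
   Context: All von Neumann algebras are assumed to have separable predual. $\mathcal{P}(B)$ denotes the set of (orthogonal) projections in a von Neumann algebra $B$. For a self-adjoint $a\in M$, the distribution of $a$ is the compactly supported Borel probability measure $\mu_a$ on $\mathbb{R}$ given by $\mu_a(E)=\tau(1_E(a))$. Its (left-continuous) distribution function is $F_a(t)=\mu_a((-\infty,t))$, $t\in\mathbb{R}$, and its quantile function is $X_a:[0,1)\to\mathbb{R}$, $X_a(s)=\inf\{t\in\mathbb{R}: F_a(t)>s\}$, which is nondecreasing, right-continuous and bounded. *)

theory Defs
  imports "HOL-Analysis.Analysis"
begin

text \<open>Complex Hilbert spaces. The inner product is linear in its first argument; positivity and
  definiteness of the inner product are contained in the axiom \<open>cinner_self\<close>.\<close>

class complex_hilbert = banach +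
  fixes scaleC :: "complex \<Rightarrow> 'a \<Rightarrow> 'a"  (infixr \<open>*\<^sub>C\<close> 75)
    and cinner :: "'a \<Rightarrow> 'a \<Rightarrow> complex"
  assumes scaleC_add_right: "c *\<^sub>C (x + y) = c *\<^sub>C x + c *\<^sub>C y"
    and scaleC_add_left: "(c + d) *\<^sub>C x = c *\<^sub>C x + d *\<^sub>C x"
    and scaleC_scaleC: "c *\<^sub>C (d *\<^sub>C x) = (c * d) *\<^sub>C x"
    and scaleR_scaleC: "r *\<^sub>R x = complex_of_real r *\<^sub>C x"
    and cinner_add_left: "cinner (x + y) z = cinner x z + cinner y z"
    and cinner_scaleC_left: "cinner (c *\<^sub>C x) y = c * cinner x y"
    and cinner_commute: "cinner x y = cnj (cinner y x)"
    and cinner_self: "cinner x x = complex_of_real ((norm x)\<^sup>2)"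

text \<open>Bounded operators on the Hilbert space are taken from the library type of bounded real-linear
  maps (which supplies the operator norm, sums and composition); \<open>cblinops\<close> is the subset of
  complex-linear ones, i.e. \<open>B(H)\<close>.\<close>

type_synonym 'h op = "'h \<Rightarrow>\<^sub>L 'h"

definition cblinops :: "'h::complex_hilbert op set" where
  "cblinops = {T. \<forall>c x. blinfun_apply T (c *\<^sub>C x) = c *\<^sub>C blinfun_apply T x}"

definition scalar_op :: "complex \<Rightarrow> 'h::complex_hilbert op" where
  "scalar_op c = Blinfun (\<lambda>x. c *\<^sub>C x)"

text \<open>\<open>is_adjoint S T\<close> says that \<open>S = T\<^sup>*\<close>; such an \<open>S\<close> is unique.\<close>

definition is_adjoint :: "'h::complex_hilbert op \<Rightarrow> 'h op \<Rightarrow> bool" where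
  "is_adjoint S T \<longleftrightarrow>
     (\<forall>x y. cinner (blinfun_apply T x) y = cinner x (blinfun_apply S y))"

definition selfadjoint :: "'h::complex_hilbert op \<Rightarrow> bool" where
  "selfadjoint T \<longleftrightarrow> is_adjoint T T"

text \<open>The usual order on self-adjoint operators (only used for self-adjoint arguments, where the
  inner products below are real).\<close>

definition op_le :: "'h::complex_hilbert op \<Rightarrow> 'h op \<Rightarrow> bool" where
  "op_le S T \<longleftrightarrow>
     (\<forall>x. Re (cinner (blinfun_apply S x) x) \<le> Re (cinner (blinfun_apply T x) x))"

definition commutant :: "'h::complex_hilbert op set \<Rightarrow> 'h op set" where
  "commutant X = {T \<in> cblinops. \<forall>S\<in>X. T o\<^sub>L S = S o\<^sub>L T}"

definition von_neumann_algebra :: "'h::complex_hilbert op set \<Rightarrow> bool" where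
  "von_neumann_algebra M \<longleftrightarrow>
     (\<forall>T\<in>M. \<exists>S\<in>M. is_adjoint S T) \<and> commutant (commutant M) = M"

definition generated_vna :: "'h::complex_hilbert op set \<Rightarrow> 'h op \<Rightarrow> 'h op set" where
  "generated_vna M a = \<Inter>{N. von_neumann_algebra N \<and> N \<subseteq> M \<and> a \<in> N}"

definition projections :: "'h::complex_hilbert op set \<Rightarrow> 'h op set" where
  "projections B = {p \<in> B. p o\<^sub>L p = p \<and> selfadjoint p}"

text \<open>The ultraweak (\<open>\<sigma>\<close>-weak) topology on \<open>B(H)\<close>: the initial topology for the functionals
  \<open>T \<mapsto> \<Sum>n. \<langle>T \<xi>\<^sub>n, \<eta>\<^sub>n\<rangle>\<close> with square-summable \<open>\<xi>\<close>, \<open>\<eta>\<close>.\<close>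

definition ultraweak_topology :: "'h::complex_hilbert op topology" where
  "ultraweak_topology = topology_generated_by
     {{T \<in> cblinops. (\<Sum>n. cinner (blinfun_apply T (\<xi> n)) (\<eta> n)) \<in> U} | \<xi> \<eta> U.
        summable (\<lambda>n. (norm (\<xi> n))\<^sup>2) \<and> summable (\<lambda>n. (norm (\<eta> n))\<^sup>2) \<and> open U}"

text \<open>The predual of \<open>M\<close>: its normal (ultraweakly continuous) linear functionals. Functionals on
  \<open>M\<close> are represented by functions on all operators, of which only the values on \<open>M\<close> matter.\<close>

definition predual :: "'h::complex_hilbert op set \<Rightarrow> ('h op \<Rightarrow> complex) set" where
  "predual M = {\<phi>.
     (\<forall>x\<in>M. \<forall>y\<in>M. \<phi> (x + y) = \<phi> x + \<phi> y) \<and>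
     (\<forall>c. \<forall>x\<in>M. \<phi> (scalar_op c o\<^sub>L x) = c * \<phi> x) \<and>
     continuous_map (subtopology ultraweak_topology M) euclidean \<phi>}"

text \<open>Separability for the norm \<open>\<parallel>\<phi>\<parallel> = sup {\<bar>\<phi> x\<bar> | x \<in> M, \<parallel>x\<parallel> \<le> 1}\<close>.\<close>

definition separable_predual :: "'h::complex_hilbert op set \<Rightarrow> bool" where
  "separable_predual M \<longleftrightarrow>
     (\<exists>D\<subseteq>predual M. countable D \<and>
        (\<forall>\<phi>\<in>predual M. \<forall>\<epsilon>>0. \<exists>\<psi>\<in>D. \<forall>x\<in>M. cmod (\<phi> x - \<psi> x) \<le> \<epsilon> * norm x))"

definition faithful_normal_tracial_state ::
    "'h::complex_hilbert op set \<Rightarrow> ('h op \<Rightarrow> complex) \<Rightarrow> bool" where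
  "faithful_normal_tracial_state M \<tau> \<longleftrightarrow>
     \<tau> \<in> predual M \<and>
     \<tau> id_blinfun = 1 \<and>
     (\<forall>x\<in>M. \<forall>y\<in>M. is_adjoint y x \<longrightarrow> \<tau> (y o\<^sub>L x) \<in> \<real> \<and> 0 \<le> Re (\<tau> (y o\<^sub>L x))) \<and>
     (\<forall>x\<in>M. \<forall>y\<in>M. is_adjoint y x \<longrightarrow> \<tau> (y o\<^sub>L x) = 0 \<longrightarrow> x = 0) \<and>
     (\<forall>x\<in>M. \<forall>y\<in>M. \<tau> (x o\<^sub>L y) = \<tau> (y o\<^sub>L x))"

text \<open>A (compactly supported, projection-valued) spectral measure \<open>P\<close> with \<open>a = \<integral> t dP(t)\<close>. The
  integral is understood weakly; by polarization it suffices to test it on the diagonal, where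
  \<open>E \<mapsto> \<langle>P(E)x, x\<rangle> = \<parallel>P(E)x\<parallel>\<^sup>2\<close> is a positive measure.\<close>

definition is_spectral_measure ::
    "'h::complex_hilbert op \<Rightarrow> (real set \<Rightarrow> 'h op) \<Rightarrow> bool" where
  "is_spectral_measure a P \<longleftrightarrow>
     (\<forall>E\<in>sets borel. P E \<in> projections cblinops) \<and>
     P UNIV = id_blinfun \<and>
     (\<forall>E\<in>sets borel. \<forall>F\<in>sets borel. P (E \<inter> F) = P E o\<^sub>L P F) \<and>
     (\<forall>E. range E \<subseteq> sets borel \<longrightarrow> disjoint_family E \<longrightarrow>
        (\<forall>x. (\<lambda>n::nat. blinfun_apply (P (E n)) x) sums blinfun_apply (P (\<Union>n. E n)) x)) \<and>
     (\<exists>K. compact K \<and> P K = id_blinfun) \<and>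
     (\<forall>x. cinner (blinfun_apply a x) x = complex_of_real
        (\<integral>t. t \<partial>measure_of UNIV (sets borel)
                   (\<lambda>E. ennreal ((norm (blinfun_apply (P E) x))\<^sup>2))))"

text \<open>\<open>spectral_projection a E\<close> is \<open>1\<^sub>E(a)\<close> (for self-adjoint \<open>a\<close> and Borel \<open>E\<close>). By the spectral
  theorem a spectral measure of \<open>a\<close> exists and is uniquely determined on Borel sets.\<close>

definition spectral_projection :: "'h::complex_hilbert op \<Rightarrow> real set \<Rightarrow> 'h op" where
  "spectral_projection a = (SOME P. is_spectral_measure a P)"

definition distribution :: "('h::complex_hilbert op \<Rightarrow> complex) \<Rightarrow> 'h op \<Rightarrow> real measure" where
  "distribution \<tau> a =
     measure_of UNIV (sets borel) (\<lambda>E. ennreal (Re (\<tau> (spectral_projection a E))))"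

definition dist_fun :: "('h::complex_hilbert op \<Rightarrow> complex) \<Rightarrow> 'h op \<Rightarrow> real \<Rightarrow> real" where
  "dist_fun \<tau> a t = measure (distribution \<tau> a) {..<t}"

definition quantile_fun :: "('h::complex_hilbert op \<Rightarrow> complex) \<Rightarrow> 'h op \<Rightarrow> real \<Rightarrow> real" where
  "quantile_fun \<tau> a s = Inf {t. dist_fun \<tau> a t > s}"

text \<open>Traces of projections, and of \<open>aq\<close> for self-adjoint \<open>a\<close> and a projection \<open>q\<close>, are real; they are
  extracted with \<open>Re\<close> here and in what follows.\<close>

definition continuous_traces ::
    "('h::complex_hilbert op \<Rightarrow> complex) \<Rightarrow> 'h op set \<Rightarrow> bool" where
  "continuous_traces \<tau> B \<longleftrightarrow>
     (\<forall>p\<in>projections B. {Re (\<tau> r) | r. r \<in> projections B \<and> op_le r p} = {0..Re (\<tau> p)})"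

definition factor :: "'h::complex_hilbert op set \<Rightarrow> bool" where
  "factor M \<longleftrightarrow> von_neumann_algebra M \<and> M \<inter> commutant M = range scalar_op"

definition abelian_projection :: "'h::complex_hilbert op set \<Rightarrow> 'h op \<Rightarrow> bool" where
  "abelian_projection M p \<longleftrightarrow> p \<in> projections M \<and>
     (\<forall>x\<in>M. \<forall>y\<in>M. (p o\<^sub>L x o\<^sub>L p) o\<^sub>L (p o\<^sub>L y o\<^sub>L p) = (p o\<^sub>L y o\<^sub>L p) o\<^sub>L (p o\<^sub>L x o\<^sub>L p))"

definition murray_von_neumann_equiv ::
    "'h::complex_hilbert op set \<Rightarrow> 'h op \<Rightarrow> 'h op \<Rightarrow> bool" where
  "murray_von_neumann_equiv M p q \<longleftrightarrow>
     (\<exists>v\<in>M. \<exists>w\<in>M. is_adjoint w v \<and> w o\<^sub>L v = p \<and> v o\<^sub>L w = q)"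

text \<open>Type \<open>I\<^sub>n\<close>: the unit is a sum of \<open>n\<close> orthogonal equivalent nonzero abelian projections.\<close>

definition type_I_factor :: "nat \<Rightarrow> 'h::complex_hilbert op set \<Rightarrow> bool" where
  "type_I_factor n M \<longleftrightarrow> factor M \<and>
     (\<exists>e. (\<forall>i<n. abelian_projection M (e i) \<and> e i \<noteq> 0) \<and>
          (\<forall>i<n. \<forall>j<n. i \<noteq> j \<longrightarrow> e i o\<^sub>L e j = 0) \<and>
          (\<forall>i<n. \<forall>j<n. murray_von_neumann_equiv M (e i) (e j)) \<and>
          (\<Sum>i<n. e i) = id_blinfun)"

definition spectrum :: "'h::complex_hilbert op set \<Rightarrow> 'h op \<Rightarrow> complex set" where
  "spectrum M a = {z. \<not> (\<exists>b\<in>M. b o\<^sub>L (scalar_op z - a) = id_blinfun \<and>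
                                 (scalar_op z - a) o\<^sub>L b = id_blinfun)}"

end

theory Submission
  imports Defs "HOL-Probability.Probability" "HOL-Computational_Algebra.Polynomial"
begin

text \<open>
  Let \<open>P\<close> be the spectral measure of \<open>a\<close>, so that \<open>F(t) = \<tau>(P(-\<infinity>,t))\<close>, and put \<open>q\<^sub>0 = P[t\<^sub>0,t\<^sub>1)\<close> and \<open>r\<^sub>0 = P[t\<^sub>0,\<infinity>)\<close>. The
  quantile function carries Lebesgue measure to the distribution of \<open>a\<close> and takes values in \<open>[t\<^sub>0,t\<^sub>1)\<close> exactly on
  \<open>[F(t\<^sub>0),F(t\<^sub>1))\<close>; hence the integral in question is \<open>\<tau>(a q\<^sub>0)\<close> (\<open>quantile_integral\<close>, \<open>trace_slice\<close>), and the theorem compares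
  \<open>\<tau>(aq)\<close> with \<open>\<tau>(a q\<^sub>0)\<close> for other projections \<open>q\<close> of trace \<open>\<delta>\<close>.

  If \<open>q \<le> r\<^sub>0\<close>, then \<open>q\<close> differs from \<open>q\<^sub>0\<close> by exchanging mass from the part of the spectrum below \<open>t\<^sub>1\<close> for mass above \<open>t\<^sub>1\<close>, so
  \<open>\<tau>(aq) \<ge> \<tau>(a q\<^sub>0)\<close> (\<open>slice_minimal\<close>); thus \<open>r\<^sub>0\<close> attains the value. Conversely, if \<open>\<tau>(r) \<ge> 1 - F(t\<^sub>0)\<close>, then \<open>r\<close> and
  \<open>P(-\<infinity>,t\<^sub>1)\<close> have a common subprojection of trace at least \<open>\<delta>\<close> (\<open>meet_trace\<close>). It contains a projection \<open>q\<close> of trace exactly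
  \<open>\<delta>\<close>: in the continuous case by hypothesis, and in a type \<open>I\<^sub>n\<close> factor because each nonzero projection dominates one of trace
  \<open>1/n\<close> (\<open>type_I_subprojection\<close>). Among the projections below \<open>P(-\<infinity>,t\<^sub>1)\<close> of trace \<open>\<delta>\<close>, \<open>q\<^sub>0\<close> sits over the top of the
  spectrum, so \<open>\<tau>(aq) \<le> \<tau>(a q\<^sub>0)\<close> (\<open>slice_maximal\<close>).

  Most of the text provides the spectral theorem. For an operator between \<open>0\<close> and \<open>1\<close> the forms \<open>\<langle>T\<^sup>k (1-T)\<^sup>m x, x\<rangle>\<close> are
  nonnegative, so the solution of the Hausdorff moment problem gives a measure for each vector \<open>x\<close>; strong limits of polynomials
  in \<open>T\<close> give the projections for half-lines, and a Dynkin argument those for Borel sets (\<open>spectral_measure_exists\<close>). Spectral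
  projections of \<open>a\<close> commute with everything commuting with \<open>a\<close> (\<open>P_bicommutant\<close>) and so lie in every von Neumann algebra
  containing \<open>a\<close>. Normality of the trace enters as continuity along bounded strongly convergent sequences (\<open>trace_limit\<close>): it
  makes \<open>E \<mapsto> \<tau>(P(E)q)\<close> a measure and yields the trace inequality for common subprojections.
\<close>

section \<open>Complex Hilbert spaces and bounded operators\<close>

lemma cinner_add_right: "cinner x (y + z) = cinner x y + cinner x z"
  by (subst (1 2 3) cinner_commute) (simp add: cinner_add_left)

lemma cinner_scaleC_right: "cinner x (c *\<^sub>C y) = cnj c * cinner x y"
  by (subst (1 2) cinner_commute) (simp add: cinner_scaleC_left)

lemma cinner_scaleR_left: "cinner (r *\<^sub>R x) y = of_real r * cinner x y"
  by (simp add: scaleR_scaleC cinner_scaleC_left)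

lemma cinner_scaleR_right: "cinner x (r *\<^sub>R y) = of_real r * cinner x y"
  by (simp add: scaleR_scaleC cinner_scaleC_right)

lemma Re_cinner_self: "Re (cinner x x) = (norm x)\<^sup>2"
  by (simp add: cinner_self)

lemma Re_cinner_commute: "Re (cinner x y) = Re (cinner y x)"
  by (subst cinner_commute) simp

lemma norm_add_square: "(norm (x + y))\<^sup>2 = (norm x)\<^sup>2 + 2 * Re (cinner x y) + (norm (y::'h::complex_hilbert))\<^sup>2"
  using Re_cinner_self[of "x+y"] Re_cinner_commute[of x y]
  by (simp add: cinner_add_left cinner_add_right Re_cinner_self)

lemma norm_scaleC: "norm (c *\<^sub>C (x::'h::complex_hilbert)) = cmod c * norm x"
proof -
  have "complex_of_real ((norm (c *\<^sub>C x))\<^sup>2) = c * cnj c * of_real ((norm x)\<^sup>2)"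
    using cinner_self[of "c *\<^sub>C x"] cinner_self[of x]
    by (simp add: cinner_scaleC_left cinner_scaleC_right ac_simps)
  also have "\<dots> = of_real ((cmod c * norm x)\<^sup>2)"
    by (simp add: complex_norm_square[symmetric] power_mult_distrib)
  finally have "(norm (c *\<^sub>C x))\<^sup>2 = (cmod c * norm x)\<^sup>2"
    using of_real_eq_iff by blast
  then show ?thesis by simp
qed

lemma Re_cinner_le: "Re (cinner x y) \<le> norm x * norm (y::'h::complex_hilbert)"
proof -
  have "(norm (x + y))\<^sup>2 \<le> (norm x + norm y)\<^sup>2"
    by (simp add: norm_triangle_ineq power_mono)
  then show ?thesis unfolding norm_add_square by (simp add: power2_eq_square algebra_simps)
qed

lemma cinner_cauchy_schwarz: "cmod (cinner x y) \<le> norm x * norm (y::'h::complex_hilbert)"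
proof -
  define c where "c = cinner x y"
  have "cinner (cnj c *\<^sub>C x) y = of_real ((cmod c)\<^sup>2)"
    unfolding complex_norm_square by (simp add: cinner_scaleC_left c_def mult.commute)
  then have *: "cmod c * cmod c \<le> cmod c * (norm x * norm y)"
    using Re_cinner_le[of "cnj c *\<^sub>C x" y] by (simp add: norm_scaleC power2_eq_square mult.assoc)
  show ?thesis
    by (cases "c = 0") (use * in \<open>auto simp: c_def[symmetric]\<close>)
qed

interpretation cinner: bounded_bilinear "cinner :: 'h::complex_hilbert \<Rightarrow> 'h \<Rightarrow> complex"
  by unfold_locales
    (auto simp: cinner_add_left cinner_add_right cinner_scaleR_left cinner_scaleR_right
      scaleR_conv_of_real intro!: exI[of _ 1] cinner_cauchy_schwarz)

interpretation blinfun_compose: bounded_bilinear blinfun_compose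
  by (rule bounded_bilinear_blinfun_compose)

lemma scaleC_diff_right: "c *\<^sub>C (x - y) = c *\<^sub>C x - c *\<^sub>C (y::'h::complex_hilbert)"
  by (metis add_diff_cancel diff_add_cancel scaleC_add_right)

lemma scaleC_scaleR: "c *\<^sub>C (r *\<^sub>R x) = r *\<^sub>R (c *\<^sub>C (x::'h::complex_hilbert))"
  by (simp add: scaleR_scaleC scaleC_scaleC mult.commute)

lemma scaleC_zero_right: "c *\<^sub>C 0 = (0::'h::complex_hilbert)"
  by (metis diff_self scaleC_diff_right)

lemma bounded_linear_scaleC: "bounded_linear (\<lambda>x::'h::complex_hilbert. c *\<^sub>C x)"
  by (rule bounded_linear_intro[of _ "cmod c"])
    (auto simp: scaleC_add_right scaleC_scaleR norm_scaleC mult.commute)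

lemma scalar_op_apply: "blinfun_apply (scalar_op c) x = c *\<^sub>C x"
  unfolding scalar_op_def by (simp add: bounded_linear_Blinfun_apply bounded_linear_scaleC)

lemma scalar_op_compose_of_real: "scalar_op (of_real r) o\<^sub>L x = r *\<^sub>R x"
  by (rule blinfun_eqI) (simp add: scalar_op_apply blinfun.scaleR_left scaleR_scaleC)

lemma cblinops_scaleC: "T \<in> cblinops \<Longrightarrow> blinfun_apply T (c *\<^sub>C x) = c *\<^sub>C blinfun_apply T x"
  by (simp add: cblinops_def)

lemma cblinops_add: "S \<in> cblinops \<Longrightarrow> T \<in> cblinops \<Longrightarrow> S + T \<in> cblinops"
  by (simp add: cblinops_def blinfun.add_left scaleC_add_right)

lemma cblinops_diff: "S \<in> cblinops \<Longrightarrow> T \<in> cblinops \<Longrightarrow> S - T \<in> cblinops"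
  by (simp add: cblinops_def blinfun.diff_left scaleC_diff_right)

lemma cblinops_scaleR: "T \<in> cblinops \<Longrightarrow> r *\<^sub>R T \<in> cblinops"
  by (simp add: cblinops_def blinfun.scaleR_left scaleC_scaleR)

lemma cblinops_compose: "S \<in> cblinops \<Longrightarrow> T \<in> cblinops \<Longrightarrow> S o\<^sub>L T \<in> cblinops"
  by (simp add: cblinops_def)

lemma cblinops_id: "id_blinfun \<in> cblinops"
  by (simp add: cblinops_def)

lemma cblinops_zero: "0 \<in> cblinops"
  by (simp add: cblinops_def scaleC_zero_right)

text \<open>Polarization with \<open>y = Tx\<close>: the form vanishes at \<open>x + y\<close> and at \<open>x + iy\<close>, which forces \<open>\<langle>Tx, y\<rangle> = 0\<close>.\<close>

lemma zero_form_imp_zero: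
  assumes T: "T \<in> cblinops" and z: "\<And>x. cinner (blinfun_apply T x) x = 0"
  shows "T = (0 :: 'h::complex_hilbert op)"
proof (rule blinfun_eqI)
  fix x :: 'h
  define y where "y = blinfun_apply T x"
  have 1: "cinner (T x) y + cinner (T y) x = 0"
    using z[of "x + y"] z[of x] z[of y]
    by (simp add: blinfun.add_right cinner_add_left cinner_add_right add.commute)
  have 2: "cnj \<i> * cinner (T x) y + \<i> * cinner (T y) x = 0"
    using z[of "x + \<i> *\<^sub>C y"] z[of x] z[of y]
    by (simp add: blinfun.add_right cinner_add_left cinner_add_right cblinops_scaleC[OF T]
        cinner_scaleC_left cinner_scaleC_right)
  have "cinner (T x) y = 0" using 1 2 by (simp add: add_eq_0_iff)
  then show "blinfun_apply T x = blinfun_apply 0 x" by (simp add: y_def cinner_self)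
qed

lemma form_eqI:
  assumes "S \<in> cblinops" "T \<in> cblinops" "\<And>x. cinner (blinfun_apply S x) x = cinner (blinfun_apply T x) x"
  shows "S = (T :: 'h::complex_hilbert op)"
  using zero_form_imp_zero[OF cblinops_diff[OF assms(1,2)]] assms(3)
  by (simp add: blinfun.diff_left cinner.diff_left)

lemma selfadjointD: "selfadjoint T \<Longrightarrow> cinner (blinfun_apply T x) y = cinner x (blinfun_apply T y)"
  by (simp add: selfadjoint_def is_adjoint_def)

lemma selfadjoint_form_real:
  assumes "selfadjoint T"
  shows "cinner (blinfun_apply T x) x = of_real (Re (cinner (blinfun_apply T x) x))"
  using cinner_commute[of "T x" x] selfadjointD[OF assms, of x x] by (simp add: complex_eq_iff)

lemma selfadjoint_add: "selfadjoint S \<Longrightarrow> selfadjoint T \<Longrightarrow> selfadjoint (S + T)"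
  by (simp add: selfadjoint_def is_adjoint_def blinfun.add_left cinner_add_left cinner_add_right)

lemma selfadjoint_diff: "selfadjoint S \<Longrightarrow> selfadjoint T \<Longrightarrow> selfadjoint (S - T)"
  by (simp add: selfadjoint_def is_adjoint_def blinfun.diff_left cinner.diff_left cinner.diff_right)

lemma selfadjoint_scaleR: "selfadjoint T \<Longrightarrow> selfadjoint (r *\<^sub>R T)"
  by (simp add: selfadjoint_def is_adjoint_def blinfun.scaleR_left cinner_scaleR_left cinner_scaleR_right)

lemma selfadjoint_id: "selfadjoint id_blinfun"
  by (simp add: selfadjoint_def is_adjoint_def)

lemma selfadjoint_eqI:
  assumes "S \<in> cblinops" "T \<in> cblinops" "selfadjoint S" "selfadjoint T"
    "\<And>x. Re (cinner (blinfun_apply S x) x) = Re (cinner (blinfun_apply T x) x)"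
  shows "S = (T :: 'h::complex_hilbert op)"
  using assms(5) selfadjoint_form_real[OF assms(3)] selfadjoint_form_real[OF assms(4)]
  by (intro form_eqI assms(1,2)) metis

lemma is_adjoint_unique:
  assumes "is_adjoint S T" "is_adjoint S' T" shows "S = (S' :: 'h::complex_hilbert op)"
proof (rule blinfun_eqI)
  fix x
  have "cinner y (S x - S' x) = 0" for y
    using assms unfolding is_adjoint_def by (metis cinner.diff_right right_minus_eq)
  then have "cinner (S x - S' x) (S x - S' x) = 0" .
  then show "S x = S' x" by (simp add: cinner_self)
qed

lemma is_adjoint_compose: "is_adjoint S S' \<Longrightarrow> is_adjoint T T' \<Longrightarrow> is_adjoint (T o\<^sub>L S) (S' o\<^sub>L T')"
  by (simp add: is_adjoint_def)

text \<open>On the invariant set \<open>V\<close> both \<open>b\<close> and \<open>m - b\<close> are positive, hence so is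
  \<open>m\<^sup>2 b - m b\<^sup>2 = (m - b) b (m - b) + b (m - b) b\<close>. Allowing a set \<open>V\<close> instead of the whole space makes the
  bound available on spectral subspaces.\<close>

lemma norm_apply_square_le:
  fixes b :: "'h::complex_hilbert op"
  assumes sa: "selfadjoint b" and inv: "\<And>y. y \<in> V \<Longrightarrow> b y \<in> V \<and> m *\<^sub>R y - b y \<in> V"
    and pos: "\<And>y. y \<in> V \<Longrightarrow> 0 \<le> Re (cinner (b y) y) \<and> Re (cinner (b y) y) \<le> m * (norm y)\<^sup>2"
    and y: "y \<in> V" and m: "0 < m"
  shows "(norm (b y))\<^sup>2 \<le> m * Re (cinner (b y) y)"
proof -
  define u where "u = b y"
  define v where "v = m *\<^sub>R y - u"
  have V: "u \<in> V" "v \<in> V" using inv[OF y] by (auto simp: u_def v_def)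
  have by_u: "b y = u" by (simp add: u_def)
  have byu: "Re (cinner (b u) y) = (norm u)\<^sup>2"
    using selfadjointD[OF sa, of u y] by (simp add: u_def Re_cinner_self)
  have "0 \<le> Re (cinner (b v) v) + (m * (norm u)\<^sup>2 - Re (cinner (b u) u))"
    using pos[OF V(1)] pos[OF V(2)] by auto
  also have "\<dots> = m * m * Re (cinner u y) - m * (norm u)\<^sup>2"
    using byu
    by (simp add: v_def blinfun.diff_right blinfun.scaleR_right cinner.diff_left cinner.diff_right
        cinner_scaleR_left cinner_scaleR_right by_u Re_cinner_self right_diff_distrib left_diff_distrib)
  finally have "m * (norm u)\<^sup>2 \<le> m * (m * Re (cinner u y))" by simp
  then show ?thesis using m by (simp add: u_def)
qed

lemma norm_apply_le:
  fixes b :: "'h::complex_hilbert op"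
  assumes sa: "selfadjoint b" and inv: "\<And>y. y \<in> V \<Longrightarrow> b y \<in> V \<and> m *\<^sub>R y - b y \<in> V"
    and pos: "\<And>y. y \<in> V \<Longrightarrow> 0 \<le> Re (cinner (b y) y) \<and> Re (cinner (b y) y) \<le> m * (norm y)\<^sup>2"
    and y: "y \<in> V" and m: "0 < m"
  shows "norm (b y) \<le> m * norm y"
proof -
  have "(norm (b y))\<^sup>2 \<le> m * Re (cinner (b y) y)"
    by (rule norm_apply_square_le[OF sa inv pos y m])
  also have "\<dots> \<le> m * (m * (norm y)\<^sup>2)" by (rule mult_left_mono) (use pos[OF y] m in auto)
  also have "\<dots> = (m * norm y)\<^sup>2" by (simp add: power2_eq_square)
  finally show ?thesis by (rule power2_le_imp_le) (use m in simp)
qed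

lemma strong_limit_exists:
  fixes T :: "nat \<Rightarrow> 'h::complex_hilbert op"
  assumes conv: "\<And>x. convergent (\<lambda>n. T n x)" and bd: "\<And>n x. norm (T n x) \<le> C * norm x"
    and cb: "\<And>n. T n \<in> cblinops"
  obtains Q where "Q \<in> cblinops" "\<And>x. (\<lambda>n. T n x) \<longlonglongrightarrow> blinfun_apply Q x"
proof -
  define f where "f x = lim (\<lambda>n. T n x)" for x
  have f: "(\<lambda>n. T n x) \<longlonglongrightarrow> f x" for x
    using conv[of x] by (simp add: f_def convergent_LIMSEQ_iff)
  have lin: "bounded_linear f"
  proof (rule bounded_linear_intro)
    show "f (x + y) = f x + f y" for x y
      using tendsto_add[OF f[of x] f[of y]] f[of "x+y"] by (simp add: blinfun.add_right LIMSEQ_unique)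
    show "f (r *\<^sub>R x) = r *\<^sub>R f x" for r x
      using tendsto_scaleR[OF tendsto_const f[of x]] f[of "r *\<^sub>R x"] by (simp add: blinfun.scaleR_right LIMSEQ_unique)
    show "norm (f x) \<le> norm x * C" for x
      using tendsto_upperbound[OF tendsto_norm[OF f[of x]]] bd[of _ x] by (simp add: mult.commute)
  qed
  have ap: "blinfun_apply (Blinfun f) = f" using lin by (rule bounded_linear_Blinfun_apply)
  have "f (c *\<^sub>C x) = c *\<^sub>C f x" for c x
  proof -
    have "(\<lambda>n. c *\<^sub>C T n x) \<longlonglongrightarrow> c *\<^sub>C f x"
      by (rule bounded_linear.tendsto[OF bounded_linear_scaleC f])
    then show ?thesis using f[of "c *\<^sub>C x"] by (simp add: cblinops_scaleC[OF cb] LIMSEQ_unique)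
  qed
  then show ?thesis using that[of "Blinfun f"] f by (simp add: ap cblinops_def)
qed

lemma selfadjoint_limit:
  fixes T :: "nat \<Rightarrow> 'h::complex_hilbert op"
  assumes "\<And>n. selfadjoint (T n)" "\<And>x. (\<lambda>n. T n x) \<longlonglongrightarrow> blinfun_apply Q x"
  shows "selfadjoint Q"
  unfolding selfadjoint_def is_adjoint_def
proof (intro allI)
  fix x y
  have "(\<lambda>n. cinner (T n x) y) \<longlonglongrightarrow> cinner (Q x) y" by (intro cinner.tendsto assms tendsto_const)
  moreover have "(\<lambda>n. cinner (T n x) y) \<longlonglongrightarrow> cinner x (Q y)"
    unfolding selfadjointD[OF assms(1)] by (intro cinner.tendsto assms tendsto_const)
  ultimately show "cinner (Q x) y = cinner x (Q y)" by (rule LIMSEQ_unique)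
qed

lemma compose_eq_apply: "S o\<^sub>L T = R \<Longrightarrow> blinfun_apply S (blinfun_apply T x) = blinfun_apply R x"
  using blinfun_apply_blinfun_compose[of S T x] by simp

lemma projection_form:
  assumes "p o\<^sub>L p = p" "selfadjoint p"
  shows "cinner (blinfun_apply p x) x = of_real ((norm (p x))\<^sup>2)"
proof -
  have "p (p x) = p x" by (rule compose_eq_apply[OF assms(1)])
  then show ?thesis using selfadjointD[OF assms(2), of "p x" x] by (simp add: cinner_self)
qed

lemma projectionI_form:
  assumes cb: "p \<in> cblinops" and sa: "selfadjoint p" and e: "\<And>x. (norm (p x))\<^sup>2 = Re (cinner (blinfun_apply p x) x)"
  shows "p o\<^sub>L p = (p :: 'h::complex_hilbert op)"
proof (rule selfadjoint_eqI)
  show "selfadjoint (p o\<^sub>L p)" using sa by (simp add: selfadjoint_def is_adjoint_def)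
  show "Re (cinner ((p o\<^sub>L p) x) x) = Re (cinner (p x) x)" for x
    using e[of x] selfadjointD[OF sa, of "p x" x] by (simp add: Re_cinner_self)
qed (use cb sa cblinops_compose in auto)

lemma projections_cblinops: "p \<in> projections cblinops \<longleftrightarrow> p \<in> cblinops \<and> p o\<^sub>L p = p \<and> selfadjoint p"
  by (simp add: projections_def)

lemma projection_norm_le: assumes "p o\<^sub>L p = p" "selfadjoint p" shows "norm (blinfun_apply p x) \<le> norm x"
proof -
  have "(norm (p x))\<^sup>2 = Re (cinner (p x) x)" using projection_form[OF assms, of x] by simp
  also have "\<dots> \<le> norm (p x) * norm x" by (rule Re_cinner_le)
  finally show ?thesis by (cases "norm (p x) = 0") (auto simp: power2_eq_square)
qed

lemma projection_complement_square:
  assumes "p o\<^sub>L p = p" "selfadjoint p"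
  shows "(norm (x - blinfun_apply p x))\<^sup>2 = (norm x)\<^sup>2 - (norm (p x))\<^sup>2"
  using norm_add_square[of x "- p x"] projection_form[OF assms, of x] Re_cinner_commute[of x "p x"]
  by (simp add: cinner.minus_right)

lemma projection_compose_commute:
  assumes "selfadjoint p" "selfadjoint q" "p o\<^sub>L q = q" shows "q o\<^sub>L p = (q::'h::complex_hilbert op)"
proof -
  have "is_adjoint (q o\<^sub>L p) (p o\<^sub>L q)" using is_adjoint_compose[of p p q q] assms by (simp add: selfadjoint_def)
  then show ?thesis using is_adjoint_unique[of "q o\<^sub>L p" q q] assms by (simp add: selfadjoint_def)
qed

text \<open>Left to right: \<open>\<parallel>qx\<parallel> \<le> \<parallel>pqx\<parallel>\<close> leaves no room for the component of \<open>qx\<close> orthogonal to the range of \<open>p\<close>.\<close>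

lemma op_le_projections:
  assumes p: "p o\<^sub>L p = p" "selfadjoint p" and q: "q o\<^sub>L q = q" "selfadjoint q"
  shows "op_le q p \<longleftrightarrow> p o\<^sub>L q = (q::'h::complex_hilbert op)"
proof
  assume le: "op_le q p"
  show "p o\<^sub>L q = q"
  proof (rule blinfun_eqI)
    fix x
    have "q (q x) = q x" by (rule compose_eq_apply[OF q(1)])
    then have "(norm (q x))\<^sup>2 \<le> (norm (p (q x)))\<^sup>2"
      using le[unfolded op_le_def, rule_format, of "q x"] projection_form[OF p, of "q x"]
        projection_form[OF q, of "q x"] by simp
    then have "(norm (q x - p (q x)))\<^sup>2 \<le> 0"
      using projection_complement_square[OF p, of "q x"] by linarith
    then show "(p o\<^sub>L q) x = q x" by simp
  qed
next
  assume a: "p o\<^sub>L q = q"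
  show "op_le q p"
    unfolding op_le_def
  proof
    fix x
    have "q o\<^sub>L p = q" by (rule projection_compose_commute[OF p(2) q(2) a])
    then have "norm (q x) \<le> norm (p x)"
      using projection_norm_le[OF q, of "p x"] compose_eq_apply[of q p q x] by metis
    then show "Re (cinner (q x) x) \<le> Re (cinner (p x) x)"
      using projection_form[OF p, of x] projection_form[OF q, of x] by (simp add: power_mono)
  qed
qed

section \<open>The Hausdorff moment problem\<close>

text \<open>The left ratio is the product of the \<open>(k - i)/(n - i)\<close> for \<open>i < m\<close>, and each factor is within \<open>m/(n - m)\<close> of \<open>k/n\<close>.
  It is the ratio that Bernstein weights average exactly, whereas moments involve the power \<open>(k/n)\<^sup>m\<close>.\<close>

lemma falling_ratio_bound:
  assumes nm: "2 * m \<le> n" "0 < n" "k \<le> n"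
  shows "\<bar>real (k choose m) / real (n choose m) - (real k / real n) ^ m\<bar> \<le> real m * (real m / real (n - m))"
proof -
  have ch: "real (j choose m) = (\<Prod>i=0..<m. real j - real i) / fact m" for j
    by (simp add: binomial_gbinomial gbinomial_prod_rev)
  define z where "z i = (real k - real i) / (real n - real i)" for i
  have "real (k choose m) / real (n choose m) = (\<Prod>i=0..<m. z i)"
    unfolding ch z_def by (simp add: prod_dividef)
  moreover have "(real k / real n) ^ m = (\<Prod>i=0..<m. real k / real n)" by simp
  moreover have "norm ((\<Prod>i=0..<m. z i) - (\<Prod>i=0..<m. real k / real n)) \<le> (\<Sum>i=0..<m. norm (z i - real k / real n))"
  proof (rule norm_prod_diff)
    show "norm (z i) \<le> 1" if "i \<in> {0..<m}" for i
    proof -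
      have "\<bar>real k - real i\<bar> \<le> real n - real i" "0 < real n - real i" using that nm by auto
      then show ?thesis by (simp add: z_def divide_le_eq)
    qed
  qed (use nm in \<open>auto simp: divide_le_eq\<close>)
  moreover have "(\<Sum>i=0..<m. norm (z i - real k / real n)) \<le> (\<Sum>i=0..<m. real m / real (n - m))"
  proof (rule sum_mono)
    fix i assume "i \<in> {0..<m}"
    then have i: "i < m" by simp
    have p: "0 < real n" "0 < real n - real i" "0 < real n - real m" using nm i by auto
    have "z i - real k / real n = - (real i * (real n - real k)) / (real n * (real n - real i))"
      using p by (simp add: z_def field_simps)
    then have "norm (z i - real k / real n) = (real i * (real n - real k)) / (real n * (real n - real i))"
      using p nm by (simp add: abs_mult)
    also have "\<dots> \<le> (real m * real n) / (real n * (real n - real m))"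
      using p nm i by (intro frac_le mult_mono) auto
    also have "\<dots> = real m / real (n - m)" using p nm by (simp add: of_nat_diff)
    finally show "norm (z i - real k / real n) \<le> real m / real (n - m)" .
  qed
  ultimately show ?thesis by simp
qed

abbreviation XX :: "real poly" where "XX \<equiv> [:0, 1:]"
abbreviation X' :: "real poly" where "X' \<equiv> [:1, -1:]"

text \<open>Since \<open>(n choose k)(k choose m) = (n choose m)(n-m choose k-m)\<close>, this is \<open>X\<^sup>m\<close> times the binomial
  expansion of \<open>(X + (1 - X))\<close> to the power \<open>n - m\<close>.\<close>

lemma bernstein_factorial_moment:
  assumes "m \<le> n"
  shows "(\<Sum>k\<le>n. smult (real (n choose k) * (real (k choose m) / real (n choose m))) (XX ^ k * X' ^ (n - k))) = XX ^ m"
proof -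
  have "poly (\<Sum>k\<le>n. smult (real (n choose k) * (real (k choose m) / real (n choose m))) (XX ^ k * X' ^ (n - k))) t
     = poly (XX ^ m) t" for t
  proof -
    have pos: "real (n choose m) \<noteq> 0" using assms by simp
    have eq: "real (n choose k) * (real (k choose m) / real (n choose m)) = real ((n - m) choose (k - m))"
      if "m \<le> k" "k \<le> n" for k
    proof -
      have "real (n choose k) * real (k choose m) = real (n choose m) * real ((n - m) choose (k - m))"
        using choose_mult[OF that] by (metis of_nat_mult)
      then show ?thesis using pos by (simp add: field_simps)
    qed
    have "poly (\<Sum>k\<le>n. smult (real (n choose k) * (real (k choose m) / real (n choose m))) (XX ^ k * X' ^ (n - k))) t
      = (\<Sum>k\<le>n. real (n choose k) * (real (k choose m) / real (n choose m)) * (t ^ k * (1 - t) ^ (n - k)))"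
      by (simp add: poly_sum)
    also have "\<dots> = (\<Sum>k\<in>{m..n}. real (n choose k) * (real (k choose m) / real (n choose m)) * (t ^ k * (1 - t) ^ (n - k)))"
      by (rule sum.mono_neutral_right) (auto simp: binomial_eq_0)
    also have "\<dots> = (\<Sum>k\<in>{m..n}. real ((n - m) choose (k - m)) * (t ^ k * (1 - t) ^ (n - k)))"
    proof (rule sum.cong)
      fix k assume "k \<in> {m..n}"
      then show "real (n choose k) * (real (k choose m) / real (n choose m)) * (t ^ k * (1 - t) ^ (n - k)) =
          real ((n - m) choose (k - m)) * (t ^ k * (1 - t) ^ (n - k))"
        by (subst eq) auto
    qed simp
    also have "\<dots> = (\<Sum>j\<le>n - m. real ((n - m) choose j) * (t ^ (j + m) * (1 - t) ^ (n - m - j)))"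
      by (rule sum.reindex_bij_witness[of _ "\<lambda>j. j + m" "\<lambda>k. k - m"]) (use assms in auto)
    also have "\<dots> = t ^ m * (\<Sum>j\<le>n - m. real ((n - m) choose j) * t ^ j * (1 - t) ^ (n - m - j))"
      by (simp add: sum_distrib_left power_add mult_ac)
    also have "(\<Sum>j\<le>n - m. real ((n - m) choose j) * t ^ j * (1 - t) ^ (n - m - j)) = (t + (1 - t)) ^ (n - m)"
      by (rule binomial_ring[symmetric])
    finally show ?thesis by simp
  qed
  then show ?thesis using poly_eq_poly_eq_iff by blast
qed

text \<open>The numbers \<open>(n choose k) L(X\<^sup>k (1-X)\<^bsup>n-k\<^esup>)\<close> are the weights of a probability distribution on the nodes \<open>k/n\<close>.
  All these distributions live on the unit interval, so Helly selection yields a weak limit; its moments are the values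
  \<open>L(X\<^sup>m)\<close> because the moments of the \<open>n\<close>-th distribution differ from them by at most \<open>m\<^sup>2/(n-m)\<close>.\<close>

theorem hausdorff_moment:
  fixes L :: "real poly \<Rightarrow> real"
  assumes add: "\<And>p q. L (p + q) = L p + L q" and smult: "\<And>c p. L (smult c p) = c * L p"
    and one: "L 1 = 1" and pos: "\<And>k m. 0 \<le> L (XX ^ k * X' ^ m)"
  shows "\<exists>N. real_distribution N \<and> (AE t in N. 0 \<le> t \<and> t \<le> 1) \<and> (\<forall>m. (\<integral>t. t ^ m \<partial>N) = L (XX ^ m))"
proof -
  define w where "w n k = (if k \<le> n then real (n choose k) * L (XX ^ k * X' ^ (n - k)) else 0)" for n k :: nat
  have w0: "0 \<le> w n k" for n k by (simp add: w_def pos)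
  have Lsum: "L (sum f A) = (\<Sum>a\<in>A. L (f a))" if "finite A" for f :: "nat \<Rightarrow> real poly" and A
    using that by (induction A rule: finite_induct) (use add smult[of 0 0] in \<open>auto\<close>)
  have fm: "(\<Sum>k\<le>n. w n k * (real (k choose m) / real (n choose m))) = L (XX ^ m)" if "m \<le> n" for n m
    unfolding bernstein_factorial_moment[OF that, symmetric] Lsum[OF finite_atMost] smult
    by (rule sum.cong) (auto simp: w_def)
  have w1: "(\<Sum>k\<le>n. w n k) = 1" for n using fm[of 0 n] one by simp
  have wint: "(\<integral>\<^sup>+ k. ennreal (w n k) \<partial>count_space UNIV) = 1" for n
  proof -
    have "(\<integral>\<^sup>+ k. ennreal (w n k) \<partial>count_space UNIV) = (\<Sum>k\<le>n. ennreal (w n k))"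
      by (rule nn_integral_count_space') (auto simp: w_def)
    then show ?thesis using w1[of n] by (simp add: sum_ennreal w0)
  qed
  have pw: "pmf (embed_pmf (w n)) k = w n k" for n k by (rule pmf_embed_pmf[OF w0 wint])
  define \<nu> where "\<nu> n = distr (measure_pmf (embed_pmf (w n))) borel (\<lambda>k. real k / real n)" for n
  have int\<nu>: "(\<integral>t. f t \<partial>\<nu> n) = (\<Sum>k\<le>n. w n k * f (real k / real n))" if "f \<in> borel_measurable borel"
    for f :: "real \<Rightarrow> real" and n
  proof -
    have "(\<integral>t. f t \<partial>\<nu> n) = (\<integral>k. f (real k / real n) \<partial>measure_pmf (embed_pmf (w n)))"
      unfolding \<nu>_def by (rule integral_distr) (use that in auto)
    also have "\<dots> = (\<Sum>k\<le>n. pmf (embed_pmf (w n)) k *\<^sub>R f (real k / real n))"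
      by (rule integral_measure_pmf) (auto simp: set_embed_pmf[OF w0 wint] w_def split: if_splits)
    finally show ?thesis by (simp add: pw)
  qed
  have rd: "real_distribution (\<nu> n)" for n
    unfolding \<nu>_def real_distribution_def real_distribution_axioms_def
    by (auto intro!: measure_pmf.prob_space_distr)
  have supp: "measure (\<nu> n) {-1<..2} = 1" for n
  proof -
    interpret real_distribution "\<nu> n" by (rule rd)
    have "measure (\<nu> n) {-1<..2} = (\<integral>t. indicator {-1<..2} t \<partial>\<nu> n)" by simp
    also have "\<dots> = (\<Sum>k\<le>n. w n k * indicator {-1<..2} (real k / real n))" by (rule int\<nu>) simp
    also have "\<dots> = (\<Sum>k\<le>n. w n k)"
    proof (rule sum.cong)
      fix k assume "k \<in> {..n}"
      then have "0 \<le> real k / real n" "real k / real n \<le> 1" by (auto simp: divide_le_eq)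
      then have "real k / real n \<in> {-1<..2}" unfolding greaterThanAtMost_iff by linarith
      then show "w n k * indicator {-1<..2} (real k / real n) = w n k" by simp
    qed simp
    finally show ?thesis by (simp add: w1)
  qed
  have "tight \<nu>" unfolding tight_def
  proof (intro conjI allI impI)
    fix e :: real assume "0 < e"
    then show "\<exists>a b. a < b \<and> (\<forall>n. 1 - e < measure (\<nu> n) {a<..b})"
      by (intro exI[of _ "-1"] exI[of _ 2]) (simp add: supp)
  qed (rule rd)
  from tight_imp_convergent_subsubsequence[OF this, of id]
  obtain r N where r: "strict_mono (r :: nat \<Rightarrow> nat)" and N: "real_distribution N"
    and wc: "weak_conv_m (\<lambda>n. \<nu> (r n)) N" by (auto simp: strict_mono_def o_def)
  interpret N: real_distribution N by (rule N)
  have conv: "(\<lambda>n. \<integral>t. f t \<partial>\<nu> (r n)) \<longlonglongrightarrow> (\<integral>t. f t \<partial>N)"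
    if "\<And>x. isCont f x" "\<And>x. norm (f x) \<le> B" for f :: "real \<Rightarrow> real" and B
    by (rule weak_conv_imp_integral_bdd_continuous_conv[OF rd N wc that])
  \<comment> \<open>clamping to the unit interval makes the power functions bounded and continuous, as weak convergence requires\<close>
  define cl where "cl t = max 0 (min 1 t)" for t :: real
  have clc: "isCont cl x" for x unfolding cl_def by (intro continuous_intros)
  have clb: "0 \<le> cl t" "cl t \<le> 1" for t by (auto simp: cl_def)
  have clid: "cl (real k / real n) = real k / real n" if "k \<le> n" for k n
  proof -
    have "0 \<le> real k / real n" "real k / real n \<le> 1" using that by (auto simp: divide_le_eq)
    then show ?thesis by (simp add: cl_def)
  qed
  have AE: "AE t in N. 0 \<le> t \<and> t \<le> 1"
  proof -
    define f where "f t = min 1 \<bar>t - cl t\<bar>" for t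
    have fc: "isCont f x" for x unfolding f_def by (intro continuous_intros clc)
    have fm: "f \<in> borel_measurable borel"
      by (intro borel_measurable_continuous_onI continuous_at_imp_continuous_on) (use fc in auto)
    have f0: "(\<integral>t. f t \<partial>\<nu> (r n)) = 0" for n
      unfolding int\<nu>[OF fm] by (rule sum.neutral) (auto simp: f_def clid)
    have "(\<lambda>n. \<integral>t. f t \<partial>\<nu> (r n)) \<longlonglongrightarrow> (\<integral>t. f t \<partial>N)"
      by (rule conv[of _ 1]) (auto simp: fc, simp add: f_def)
    then have z: "(\<integral>t. f t \<partial>N) = 0" unfolding f0 using LIMSEQ_unique by blast
    have "integrable N f"
      by (rule N.integrable_const_bound[of _ 1]) (use fm in \<open>auto simp: f_def\<close>)
    moreover have "AE t in N. 0 \<le> f t" by (simp add: f_def)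
    ultimately have "AE t in N. f t = 0"
      using z integral_nonneg_eq_0_iff_AE[of N f] by blast
    then show ?thesis by eventually_elim (auto simp: f_def cl_def min_def max_def split: if_splits)
  qed
  have mom: "(\<integral>t. t ^ m \<partial>N) = L (XX ^ m)" for m
  proof -
    have "(\<integral>t. t ^ m \<partial>N) = (\<integral>t. cl t ^ m \<partial>N)"
      by (rule integral_cong_AE) (use AE in \<open>auto simp: cl_def intro!: borel_measurable_power\<close>)
    moreover have c1: "(\<lambda>n. \<integral>t. cl t ^ m \<partial>\<nu> (r n)) \<longlonglongrightarrow> (\<integral>t. cl t ^ m \<partial>N)"
      by (rule conv[of _ 1]) (auto intro!: continuous_intros clc simp: power_le_one clb)
    moreover have "(\<lambda>n. \<integral>t. cl t ^ m \<partial>\<nu> (r n)) \<longlonglongrightarrow> L (XX ^ m)"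
    proof -
      have bd: "\<bar>(\<integral>t. cl t ^ m \<partial>\<nu> n) - L (XX ^ m)\<bar> \<le> real m * (real m / real (n - m))" if "2 * m + 1 \<le> n" for n
      proof -
        have "(\<integral>t. cl t ^ m \<partial>\<nu> n) = (\<Sum>k\<le>n. w n k * cl (real k / real n) ^ m)"
          by (rule int\<nu>) (auto simp: cl_def)
        also have "\<dots> = (\<Sum>k\<le>n. w n k * (real k / real n) ^ m)"
          by (rule sum.cong) (auto simp: clid)
        finally have "(\<integral>t. cl t ^ m \<partial>\<nu> n) - L (XX ^ m) =
           (\<Sum>k\<le>n. w n k * ((real k / real n) ^ m - real (k choose m) / real (n choose m)))"
          using fm[of m n] that by (simp add: right_diff_distrib sum_subtractf)
        also have "\<bar>\<dots>\<bar> \<le> (\<Sum>k\<le>n. w n k * (real m * (real m / real (n - m))))"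
        proof (rule order_trans[OF sum_abs sum_mono])
          fix k assume "k \<in> {..n}"
          then show "\<bar>w n k * ((real k / real n) ^ m - real (k choose m) / real (n choose m))\<bar>
             \<le> w n k * (real m * (real m / real (n - m)))"
            unfolding abs_mult using falling_ratio_bound[of m n k] that w0[of n k]
            by (intro mult_mono) (auto simp: abs_minus_commute)
        qed
        also have "\<dots> = real m * (real m / real (n - m))"
          unfolding sum_distrib_right[symmetric] w1 by simp
        finally show ?thesis .
      qed
      have "(\<lambda>n. \<integral>t. cl t ^ m \<partial>\<nu> n) \<longlonglongrightarrow> L (XX ^ m)"
      proof (rule LIM_zero_cancel, rule Lim_null_comparison)
        show "\<forall>\<^sub>F n in sequentially. norm ((\<integral>t. cl t ^ m \<partial>\<nu> n) - L (XX ^ m)) \<le> real m * (real m / real (n - m))"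
          using eventually_ge_at_top[of "2*m+1"] by eventually_elim (use bd in auto)
        have "(\<lambda>n. real m / real (n - m)) \<longlonglongrightarrow> 0"
          by (rule LIMSEQ_offset[of _ m]) (simp add: lim_const_over_n)
        then show "(\<lambda>n. real m * (real m / real (n - m))) \<longlonglongrightarrow> 0"
          by (rule tendsto_mult_right_zero)
      qed
      then show ?thesis using LIMSEQ_subseq_LIMSEQ[OF _ r] by (auto simp: o_def)
    qed
    ultimately show ?thesis using LIMSEQ_unique by metis
  qed
  show ?thesis using N AE mom by blast
qed

section \<open>Polynomials of a self-adjoint operator\<close>

definition poly_op :: "real poly \<Rightarrow> 'h::complex_hilbert op \<Rightarrow> 'h op" where
  "poly_op p T = fold_coeffs (\<lambda>c S. c *\<^sub>R id_blinfun + (T o\<^sub>L S)) p 0"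

lemma poly_op_0 [simp]: "poly_op 0 T = 0"
  by (simp add: poly_op_def)

lemma poly_op_pCons [simp]: "poly_op (pCons c p) T = c *\<^sub>R id_blinfun + (T o\<^sub>L poly_op p T)"
  by (cases "p = 0 \<and> c = 0") (auto simp: poly_op_def)

lemma poly_op_add: "poly_op (p + q) T = poly_op p T + poly_op q T"
  by (induction p q rule: poly_induct2)
    (auto intro!: blinfun_eqI simp: blinfun.bilinear_simps scaleR_add_left)

lemma poly_op_smult: "poly_op (smult c p) T = c *\<^sub>R poly_op p T"
  by (induction p) (auto intro!: blinfun_eqI simp: blinfun.bilinear_simps scaleR_add_right)

lemma poly_op_diff: "poly_op (p - q) T = poly_op p T - poly_op q T"
  using poly_op_add[of p "smult (-1) q" T] poly_op_smult[of "-1" q T] by simp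

lemma poly_op_mult: "poly_op (p * q) T = poly_op p T o\<^sub>L poly_op q T"
  by (induction p) (auto intro!: blinfun_eqI simp: poly_op_add poly_op_smult blinfun.bilinear_simps)

lemma poly_op_1: "poly_op 1 T = id_blinfun"
  by (simp add: one_pCons)

lemma poly_op_X: "poly_op [:0, 1:] T = T"
  by (auto intro!: blinfun_eqI simp: blinfun.bilinear_simps)

lemma poly_op_cblinops: "T \<in> cblinops \<Longrightarrow> poly_op p T \<in> cblinops"
  by (induction p) (auto intro!: cblinops_add cblinops_scaleR cblinops_compose cblinops_zero cblinops_id)

lemma poly_op_commute: "T o\<^sub>L poly_op p T = poly_op p T o\<^sub>L T"
  using poly_op_mult[of XX p T] poly_op_mult[of p XX T] by (simp only: poly_op_X mult.commute[of XX p])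

lemma poly_op_selfadjoint:
  assumes "selfadjoint T" shows "selfadjoint (poly_op p T)"
proof (induction p)
  case 0 then show ?case by (simp add: selfadjoint_def is_adjoint_def cinner.zero_left cinner.zero_right)
next
  case (pCons c p)
  have "is_adjoint (poly_op p T o\<^sub>L T) (T o\<^sub>L poly_op p T)"
    using pCons assms by (simp add: selfadjoint_def is_adjoint_compose)
  then have "selfadjoint (T o\<^sub>L poly_op p T)" by (simp add: selfadjoint_def poly_op_commute)
  then show ?case using selfadjoint_add selfadjoint_scaleR selfadjoint_id by (metis poly_op_pCons)
qed

lemma poly_op_form:
  assumes "selfadjoint T"
  shows "Re (cinner (poly_op (p * p * q) T x) x) = Re (cinner (poly_op q T (poly_op p T x)) (poly_op p T x))"
  using selfadjointD[OF poly_op_selfadjoint[OF assms, of p]]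
  by (simp add: poly_op_mult mult.assoc mult.commute[of p q])

text \<open>Splitting off a square \<open>p\<^sup>2\<close> from the polynomial amounts to replacing \<open>x\<close> by \<open>p(T)x\<close>. That leaves the exponents \<open>0\<close>
  and \<open>1\<close>, the only case needing an argument being \<open>X(1-X) = X(1-X)\<^sup>2 + X\<^sup>2(1-X)\<close>.\<close>

lemma poly_op_form_bernstein_nonneg:
  fixes T :: "'h::complex_hilbert op"
  assumes sa: "selfadjoint T" and T0: "\<And>x. 0 \<le> Re (cinner (T x) x)" and T1: "\<And>x. Re (cinner (T x) x) \<le> (norm x)\<^sup>2"
  shows "0 \<le> Re (cinner (poly_op (XX ^ k * X' ^ m) T x) x)"
proof -
  let ?pos = "\<lambda>q. \<forall>x. 0 \<le> Re (cinner (poly_op q T x) x)"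
  have X: "?pos XX" using T0 by (simp only: poly_op_X) blast
  have X': "?pos X'" using T1
    by (auto simp: blinfun.bilinear_simps cinner.diff_left Re_cinner_self cinner.minus_left)
  have one: "?pos 1" by (simp add: poly_op_1 Re_cinner_self)
  have sq: "?pos (p * p * q)" if "?pos q" for p q using that by (simp add: poly_op_form[OF sa])
  have sum: "?pos (p + q)" if "?pos p" "?pos q" for p q
    using that by (simp add: poly_op_add blinfun.add_left cinner_add_left)
  have "XX * X' = X' * X' * XX + XX * XX * X'" by simp
  then have XX': "?pos (XX * X')" using sum[OF sq[OF X, of X'] sq[OF X', of XX]] by metis
  obtain i e where k: "k = 2 * i + e" "e = 0 \<or> e = 1" by (metis add.right_neutral even_two_times_div_two odd_two_times_div_two_succ)
  obtain j f where m: "m = 2 * j + f" "f = 0 \<or> f = 1" by (metis add.right_neutral even_two_times_div_two odd_two_times_div_two_succ)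
  have "?pos (XX ^ e * X' ^ f)" using X X' XX' one k(2) m(2) by auto
  from sq[OF this, of "XX ^ i * X' ^ j"]
  have "?pos ((XX ^ i * X' ^ j) * (XX ^ i * X' ^ j) * (XX ^ e * X' ^ f))" .
  also have "(XX ^ i * X' ^ j) * (XX ^ i * X' ^ j) * (XX ^ e * X' ^ f) = XX ^ k * X' ^ m"
    by (simp only: k(1) m(1) power_add mult_2) (simp only: ac_simps)
  finally show ?thesis by blast
qed

lemma borel_measurable_poly [measurable]: "poly p \<in> borel_measurable (borel :: real measure)"
  by (intro borel_measurable_continuous_onI continuous_intros)

text \<open>The functional \<open>p \<mapsto> \<langle>p(T)y, y\<rangle>\<close> of the unit vector \<open>y = x/\<parallel>x\<parallel>\<close> satisfies the positivity condition of the Hausdorff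
  moment problem; the resulting distribution is then rescaled by \<open>\<parallel>x\<parallel>\<^sup>2\<close>.\<close>

lemma scalar_spectral_measure:
  fixes T :: "'h::complex_hilbert op"
  assumes sa: "selfadjoint T" and T0: "\<And>x. 0 \<le> Re (cinner (T x) x)" and T1: "\<And>x. Re (cinner (T x) x) \<le> (norm x)\<^sup>2"
  shows "\<exists>N. finite_measure N \<and> sets N = sets borel \<and> (AE t in N. 0 \<le> t \<and> t \<le> 1) \<and>
     (\<forall>p. (\<integral>t. poly p t \<partial>N) = Re (cinner (poly_op p T x) x))"
proof (cases "x = 0")
  case True
  then show ?thesis
    by (intro exI[of _ "null_measure borel"]) (auto simp: cinner.zero_left AE_iff_null null_sets_def intro!: finite_measureI)
next
  case False
  define y where "y = (1 / norm x) *\<^sub>R x"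
  have ny: "norm y = 1" and xy: "x = norm x *\<^sub>R y" using False by (auto simp: y_def)
  define L where "L p = Re (cinner (poly_op p T y) y)" for p
  have "\<exists>N. real_distribution N \<and> (AE t in N. 0 \<le> t \<and> t \<le> 1) \<and> (\<forall>m. (\<integral>t. t ^ m \<partial>N) = L (XX ^ m))"
    by (rule hausdorff_moment)
      (use ny in \<open>auto simp: L_def poly_op_add poly_op_smult blinfun.bilinear_simps cinner_add_left
        cinner_scaleR_left poly_op_1 Re_cinner_self intro!: poly_op_form_bernstein_nonneg[OF sa T0 T1]\<close>)
  then obtain N where N: "real_distribution N" and AE: "AE t in N. 0 \<le> t \<and> t \<le> 1"
    and mom: "\<And>m. (\<integral>t. t ^ m \<partial>N) = L (XX ^ m)" by blast
  interpret N: real_distribution N by (rule N)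
  have int: "integrable N (poly p)" for p
  proof -
    have "compact (poly p ` {0..1})" by (intro compact_continuous_image continuous_intros) auto
    then obtain B where "\<And>t. t \<in> {0..1} \<Longrightarrow> norm (poly p t) \<le> B"
      using compact_imp_bounded bounded_iff by (metis imageI)
    then have B: "norm (poly p t) \<le> B" if "0 \<le> t \<and> t \<le> 1" for t using that by simp
    have "AE t in N. norm (poly p t) \<le> B" using AE by eventually_elim (rule B)
    then show ?thesis by (rule N.integrable_const_bound) simp
  qed
  have shift: "(\<integral>t. t ^ m * poly p t \<partial>N) = L (XX ^ m * p)" for m p
  proof (induction p arbitrary: m)
    case 0 then show ?case by (simp add: L_def blinfun.bilinear_simps)
  next
    case (pCons c p)
    have "XX ^ m * pCons c p = smult c (XX ^ m) + XX ^ Suc m * p" by (simp add: mult_ac)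
    then have "L (XX ^ m * pCons c p) = c * L (XX ^ m) + L (XX ^ Suc m * p)"
      by (simp only: L_def poly_op_add poly_op_smult blinfun.bilinear_simps cinner_add_left
        cinner_scaleR_left) simp
    also have "\<dots> = (\<integral>t. c * t ^ m \<partial>N) + (\<integral>t. t ^ Suc m * poly p t \<partial>N)"
      by (simp only: mom[symmetric] pCons(2) integral_mult_right_zero)
    also have "\<dots> = (\<integral>t. c * t ^ m + t ^ Suc m * poly p t \<partial>N)"
    proof (rule Bochner_Integration.integral_add[symmetric])
      have "poly (smult c (XX ^ m)) = (\<lambda>t. c * t ^ m)" by (simp add: fun_eq_iff)
      then show "integrable N (\<lambda>t. c * t ^ m)" using int by metis
      have "poly (XX ^ Suc m * p) = (\<lambda>t. t ^ Suc m * poly p t)" by (simp add: fun_eq_iff)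
      then show "integrable N (\<lambda>t. t ^ Suc m * poly p t)" using int by metis
    qed
    finally show ?case by (simp add: algebra_simps)
  qed
  define M where "M = density N (\<lambda>_. ennreal ((norm x)\<^sup>2))"
  have "emeasure M (space M) \<noteq> \<infinity>"
    by (simp add: M_def emeasure_density nn_integral_cmult_indicator N.emeasure_space_1 ennreal_mult_eq_top_iff)
  then have "finite_measure M" by (rule finite_measureI)
  moreover have "AE t in M. 0 \<le> t \<and> t \<le> 1"
    unfolding M_def using AE by (subst AE_density) auto
  moreover have "(\<integral>t. poly p t \<partial>M) = Re (cinner (poly_op p T x) x)" for p
  proof -
    have "(\<integral>t. poly p t \<partial>M) = (norm x)\<^sup>2 * (\<integral>t. poly p t \<partial>N)"
      unfolding M_def by (subst integral_density) auto
    also have "\<dots> = (norm x)\<^sup>2 * L p" using shift[of 0 p] by simp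
    also have "\<dots> = Re (cinner (poly_op p T (norm x *\<^sub>R y)) (norm x *\<^sub>R y))"
      by (simp add: L_def blinfun.scaleR_right cinner_scaleR_left cinner_scaleR_right power2_eq_square)
    finally show ?thesis using xy by simp
  qed
  moreover have "sets M = sets borel" by (simp add: M_def)
  ultimately show ?thesis by blast
qed

section \<open>The spectral theorem\<close>

lemma blinfun_compose_id [simp]: "S o\<^sub>L id_blinfun = S" "id_blinfun o\<^sub>L S = S"
  by (auto intro: blinfun_eqI)

lemma polynomial_approx_unit_interval:
  fixes g :: "real \<Rightarrow> real"
  assumes "continuous_on {0..1} g" "0 < e"
  shows "\<exists>p. \<forall>t\<in>{0..1}. \<bar>poly p t - g t\<bar> < e"
proof -
  obtain f where f: "real_polynomial_function f" "\<And>t. t \<in> {0..1} \<Longrightarrow> \<bar>g t - f t\<bar> < e"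
    using Stone_Weierstrass_real_polynomial_function[of "{0..1::real}" g e] assms by auto
  obtain c n where c: "f = (\<lambda>x. \<Sum>i\<le>n::nat. c i * x ^ i)" using real_polynomial_function_imp_sum[OF f(1)] by auto
  have "poly (\<Sum>i\<le>n. monom (c i) i) t = f t" for t by (simp add: c poly_sum poly_monom)
  then show ?thesis using f(2) by (metis abs_minus_commute)
qed

text \<open>Ramps of slope \<open>-j\<close> starting at \<open>l\<close> converge to the indicator function, and the Weierstrass theorem replaces them by polynomials.\<close>

lemma step_approx:
  fixes l :: real
  obtains p :: "nat \<Rightarrow> real poly" where "\<And>j t. t \<in> {0..1} \<Longrightarrow> \<bar>poly (p j) t\<bar> \<le> 2"
    "\<And>t. t \<in> {0..1} \<Longrightarrow> (\<lambda>j. poly (p j) t) \<longlonglongrightarrow> indicator {..l} t"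
proof -
  define g where "g j t = max 0 (min 1 (1 - real j * (t - l)))" for j t
  have "\<exists>p. \<forall>t\<in>{0..1}. \<bar>poly p t - g j t\<bar> < 1 / real (Suc j)" for j
    by (rule polynomial_approx_unit_interval) (auto simp: g_def intro!: continuous_intros)
  then obtain p where p: "\<And>j t. t \<in> {0..1} \<Longrightarrow> \<bar>poly (p j) t - g j t\<bar> < 1 / real (Suc j)"
    by metis
  have g01: "0 \<le> g j t" "g j t \<le> 1" for j t by (auto simp: g_def)
  have "\<bar>poly (p j) t\<bar> \<le> 2" if "t \<in> {0..1}" for j t
  proof -
    have "1 / real (Suc j) \<le> 1" by simp
    then show ?thesis using p[OF that, of j] g01[of j t] by linarith
  qed
  moreover have "(\<lambda>j. poly (p j) t) \<longlonglongrightarrow> indicator {..l} t" if t: "t \<in> {0..1}" for t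
  proof -
    have "(\<lambda>j. g j t) \<longlonglongrightarrow> indicator {..l} t"
    proof (rule tendsto_eventually)
      show "\<forall>\<^sub>F j in sequentially. g j t = indicator {..l} t"
      proof (cases "t \<le> l")
        case True
        then have "real j * (t - l) \<le> 0" for j by (simp add: mult_nonneg_nonpos)
        then have "min 1 (1 - real j * (t - l)) = 1" for j using min_absorb1[of 1 "1 - real j * (t - l)"] by simp
        then show ?thesis using True by (simp add: g_def)
      next
        case False
        obtain m where m: "1 / (t - l) < real m" using reals_Archimedean2 by blast
        have "g j t = 0" if "m \<le> j" for j
        proof -
          have "1 / (t - l) < real j" using m that by (meson less_le_trans of_nat_le_iff)
          then have "1 < real j * (t - l)" using False by (simp add: divide_less_eq)
          then show ?thesis by (simp add: g_def)
        qed
        then show ?thesis using False by (auto simp: eventually_sequentially)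
      qed
    qed
    moreover have "(\<lambda>j. poly (p j) t - g j t) \<longlonglongrightarrow> 0"
    proof (rule Lim_null_comparison)
      show "\<forall>\<^sub>F j in sequentially. norm (poly (p j) t - g j t) \<le> 1 / real (Suc j)"
        using p[OF t] by (intro always_eventually) (auto simp: less_imp_le)
      show "(\<lambda>j. 1 / real (Suc j)) \<longlonglongrightarrow> 0" by (rule LIMSEQ_Suc[OF lim_1_over_n])
    qed
    ultimately show ?thesis using tendsto_add[of "\<lambda>j. poly (p j) t - g j t" 0 sequentially "\<lambda>j. g j t"] by simp
  qed
  ultimately show ?thesis using that by blast
qed

text \<open>For \<open>y = qx\<close> the hypothesis reads \<open>\<parallel>py\<parallel>\<^sup>2 + \<parallel>y\<parallel>\<^sup>2 \<le> \<parallel>y\<parallel>\<^sup>2\<close>.\<close>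

lemma projections_orthogonal:
  assumes p: "p o\<^sub>L p = p" "selfadjoint p" and q: "q o\<^sub>L q = q" "selfadjoint q"
    and le: "\<And>x. (norm (p x))\<^sup>2 + (norm (q x))\<^sup>2 \<le> (norm x)\<^sup>2"
  shows "p o\<^sub>L q = (0 :: 'h::complex_hilbert op)"
proof (rule blinfun_eqI)
  fix x
  have "(norm (p (q x)))\<^sup>2 \<le> 0" using le[of "q x"] compose_eq_apply[OF q(1), of x] by simp
  then show "(p o\<^sub>L q) x = blinfun_apply 0 x" by simp
qed

lemma projections_add:
  fixes p q :: "'h::complex_hilbert op"
  assumes p: "p \<in> projections cblinops" and q: "q \<in> projections cblinops"
    and le: "\<And>x. (norm (p x))\<^sup>2 + (norm (q x))\<^sup>2 \<le> (norm x)\<^sup>2"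
  shows "p + q \<in> projections cblinops" "(norm ((p + q) x))\<^sup>2 = (norm (p x))\<^sup>2 + (norm (q x))\<^sup>2"
proof -
  have p': "p \<in> cblinops" "p o\<^sub>L p = p" "selfadjoint p" and q': "q \<in> cblinops" "q o\<^sub>L q = q" "selfadjoint q"
    using p q by (auto simp: projections_cblinops)
  have 1: "p o\<^sub>L q = 0" by (rule projections_orthogonal[OF p'(2,3) q'(2,3) le])
  have 2: "q o\<^sub>L p = 0" by (rule projections_orthogonal[OF q'(2,3) p'(2,3)]) (use le in \<open>simp add: add.commute\<close>)
  have i: "(p + q) o\<^sub>L (p + q) = p + q"
    using 1 2 p'(2) q'(2)
    by (simp add: blinfun_compose.add_left blinfun_compose.add_right)
  have s: "selfadjoint (p + q)" by (rule selfadjoint_add[OF p'(3) q'(3)])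
  show "p + q \<in> projections cblinops" using i s cblinops_add[OF p'(1) q'(1)] by (simp add: projections_cblinops)
  show "(norm ((p + q) x))\<^sup>2 = (norm (p x))\<^sup>2 + (norm (q x))\<^sup>2"
    using projection_form[OF i s, of x] projection_form[OF p'(2,3), of x] projection_form[OF q'(2,3), of x]
    by (simp add: blinfun.add_left cinner_add_left flip: of_real_add of_real_power)
qed

lemma projection_difference_norm:
  fixes p q :: "'h::complex_hilbert op"
  assumes p: "p o\<^sub>L p = p" "selfadjoint p" and q: "q o\<^sub>L q = q" "selfadjoint q"
    and le: "\<And>x. norm (q x) \<le> norm (p x)"
  shows "(norm (p x - q x))\<^sup>2 = (norm (p x))\<^sup>2 - (norm (q x))\<^sup>2"
proof -
  have "op_le q p" unfolding op_le_def projection_form[OF p] projection_form[OF q]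
    by (simp add: le power_mono)
  then have "q o\<^sub>L p = q" using op_le_projections[OF p q] projection_compose_commute p q by blast
  then show ?thesis
    using projection_complement_square[OF q, of "p x"] compose_eq_apply[of q p q x] by simp
qed

text \<open>For \<open>m \<le> n\<close> one has \<open>\<parallel>R\<^sub>n x - R\<^sub>m x\<parallel>\<^sup>2 = \<parallel>R\<^sub>n x\<parallel>\<^sup>2 - \<parallel>R\<^sub>m x\<parallel>\<^sup>2\<close>, so convergence of the norms makes \<open>R\<^sub>n x\<close> a Cauchy
  sequence.\<close>

lemma projection_increasing_limit:
  fixes R :: "nat \<Rightarrow> 'h::complex_hilbert op"
  assumes R: "\<And>n. R n \<in> projections cblinops" and conv: "\<And>x. (\<lambda>n. (norm (R n x))\<^sup>2) \<longlonglongrightarrow> f x"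
    and mono: "\<And>n x. norm (R n x) \<le> norm (R (Suc n) x)"
  obtains Q where "Q \<in> projections cblinops" "\<And>x. (norm (Q x))\<^sup>2 = f x"
proof -
  have R': "R n \<in> cblinops" "R n o\<^sub>L R n = R n" "selfadjoint (R n)" for n
    using R by (auto simp: projections_cblinops)
  have mon: "norm (R m x) \<le> norm (R n x)" if "m \<le> n" for m n x
    using lift_Suc_mono_le[of "\<lambda>n. norm (R n x)", OF mono that] .
  have cau: "Cauchy (\<lambda>n. R n x)" for x
  proof (rule metric_CauchyI)
    fix e :: real assume "0 < e"
    then have "0 < e\<^sup>2" by simp
    then obtain M where M: "\<And>m n. m \<ge> M \<Longrightarrow> n \<ge> M \<Longrightarrow> \<bar>(norm (R m x))\<^sup>2 - (norm (R n x))\<^sup>2\<bar> < e\<^sup>2"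
      using convergent_Cauchy[OF convergentI[OF conv[of x]]] unfolding Cauchy_def dist_real_def by metis
    have *: "norm (R n x - R m x) < e" if "m \<ge> M" "m \<le> n" for m n
    proof -
      have "(norm (R n x - R m x))\<^sup>2 = (norm (R n x))\<^sup>2 - (norm (R m x))\<^sup>2"
        by (rule projection_difference_norm[OF R'(2,3) R'(2,3) mon[OF that(2)]])
      also have "\<dots> < e\<^sup>2" using M[of n m] that by auto
      finally show ?thesis using \<open>0 < e\<close> by (simp add: power2_less_imp_less)
    qed
    show "\<exists>M. \<forall>m\<ge>M. \<forall>n\<ge>M. dist (R m x) (R n x) < e"
    proof (intro exI allI impI)
      fix m n assume mn: "M \<le> m" "M \<le> n"
      show "dist (R m x) (R n x) < e"
      proof (cases "m \<le> n")
        case True then show ?thesis using *[OF mn(1) True] by (metis dist_norm dist_commute)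
      next
        case False then show ?thesis using *[OF mn(2), of m] by (simp add: dist_norm)
      qed
    qed
  qed
  obtain Q where Q: "Q \<in> cblinops" "\<And>x. (\<lambda>n. R n x) \<longlonglongrightarrow> blinfun_apply Q x"
    by (rule strong_limit_exists[of R 1])
      (use cau Cauchy_convergent projection_norm_le[OF R'(2,3)] R' in auto)
  have n: "(norm (Q x))\<^sup>2 = f x" for x
    using LIMSEQ_unique[OF tendsto_power[OF tendsto_norm[OF Q(2)[of x]], of 2] conv[of x]] .
  have s: "selfadjoint Q" by (rule selfadjoint_limit[OF R'(3) Q(2)])
  have form: "Re (cinner (Q x) x) = f x" for x
  proof (rule LIMSEQ_unique)
    show "(\<lambda>n. Re (cinner (R n x) x)) \<longlonglongrightarrow> Re (cinner (Q x) x)"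
      by (intro tendsto_Re cinner.tendsto Q tendsto_const)
    show "(\<lambda>n. Re (cinner (R n x) x)) \<longlonglongrightarrow> f x"
      unfolding projection_form[OF R'(2,3)] Re_complex_of_real by (rule conv)
  qed
  have "Q o\<^sub>L Q = Q" by (rule projectionI_form[OF Q(1) s]) (simp add: n form)
  then show ?thesis using that[of Q] Q(1) s n by (simp add: projections_cblinops)
qed

lemma disjoint_family_UN_lessThan: "disjoint_family A \<Longrightarrow> (\<Union>i<n. A i) \<inter> A n = {}" for n :: nat
  by (auto simp: disjoint_family_on_def) (metis IntI empty_iff less_irrefl)

lemma finite_additive_UN_lessThan:
  fixes f :: "'a set \<Rightarrow> 'b::comm_monoid_add" and n :: nat
  assumes "f {} = 0" "disjoint_family A" "range A \<subseteq> sets N"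
    and add: "\<And>E F. E \<in> sets N \<Longrightarrow> F \<in> sets N \<Longrightarrow> E \<inter> F = {} \<Longrightarrow> f (E \<union> F) = f E + f F"
  shows "f (\<Union>i<n. A i) = (\<Sum>i<n. f (A i))"
proof (induction n)
  case (Suc n)
  have "f ((\<Union>i<n. A i) \<union> A n) = f (\<Union>i<n. A i) + f (A n)"
    by (rule add) (use assms(3) disjoint_family_UN_lessThan[OF assms(2)] in auto)
  then show ?case using Suc by (simp add: lessThan_Suc Un_commute add.commute)
qed (simp add: assms)

lemma (in finite_measure) measure_UN_lessThan_tendsto:
  assumes "range A \<subseteq> sets M"
  shows "(\<lambda>n::nat. measure M (\<Union>i<n. A i)) \<longlonglongrightarrow> measure M (\<Union>i. A i)"
proof -
  have "(\<lambda>n. measure M (\<Union>i<n. A i)) \<longlonglongrightarrow> measure M (\<Union>n. \<Union>i<n. A i)"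
  proof (rule finite_Lim_measure_incseq)
    show "incseq (\<lambda>n. \<Union>i<n. A i)" unfolding incseq_def by (intro allI impI UN_mono) auto
  qed (use assms in auto)
  moreover have "(\<Union>n. \<Union>i<n. A i) = (\<Union>i. A i)" by auto
  ultimately show ?thesis by simp
qed

lemma borel_real_induct_disjoint [consumes 1, case_names atMost empty compl union]:
  fixes E :: "real set"
  assumes E: "E \<in> sets borel" and "\<And>l. Q {..l}" "Q {}"
    and "\<And>A. A \<in> sets borel \<Longrightarrow> Q A \<Longrightarrow> Q (- A)"
    and "\<And>A. disjoint_family A \<Longrightarrow> range A \<subseteq> sets borel \<Longrightarrow> (\<And>i. Q (A i)) \<Longrightarrow> Q (\<Union>i::nat. A i)"
  shows "Q E"
proof -
  have "Int_stable (range (\<lambda>l::real. {..l}))" by (auto simp: Int_stable_def)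
  moreover have "range (\<lambda>l::real. {..l}) \<subseteq> Pow UNIV" by simp
  moreover have "E \<in> sigma_sets UNIV (range (\<lambda>l::real. {..l}))" using E by (simp add: borel_eq_atMost)
  ultimately show ?thesis
    by (induction rule: sigma_sets_induct_disjoint)
      (use assms in \<open>auto simp: borel_eq_atMost Compl_eq_Diff_UNIV\<close>)
qed

text \<open>In this context \<open>N x\<close> is the scalar spectral measure of \<open>x\<close>. The aim is a projection \<open>Q\<close> with \<open>\<parallel>Qx\<parallel>\<^sup>2 = N\<^sub>x(E)\<close> for every
  Borel set \<open>E\<close>: for half-lines it comes from polynomials in \<open>T\<close>, and the sets admitting such a projection form a
  Dynkin system.\<close>

context
  fixes T :: "'h::complex_hilbert op" and N :: "'h \<Rightarrow> real measure"
  assumes T: "T \<in> cblinops" "selfadjoint T"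
    and fin: "\<And>x. finite_measure (N x)" and sN: "\<And>x. sets (N x) = sets borel"
    and AEN: "\<And>x. AE t in N x. 0 \<le> t \<and> t \<le> 1"
    and mom: "\<And>x p. (\<integral>t. poly p t \<partial>(N x)) = Re (cinner (poly_op p T x) x)"
begin

lemma space_N: "space (N x) = UNIV"
  using sets_eq_imp_space_eq[OF sN[of x]] by simp

lemma N_mass: "measure (N x) UNIV = (norm x)\<^sup>2"
  using mom[of x 1] by (simp add: poly_op_1 Re_cinner_self space_N)

lemma N_le: "measure (N x) E \<le> (norm x)\<^sup>2"
  using finite_measure.bounded_measure[OF fin, of x E] N_mass space_N by simp

lemma poly_op_norm: "(norm (poly_op p T x))\<^sup>2 = (\<integral>t. (poly p t)\<^sup>2 \<partial>(N x))"
  using mom[of x "p * p"] poly_op_form[OF T(2), of p 1 x]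
  by (simp add: poly_op_1 Re_cinner_self power2_eq_square)

text \<open>Let \<open>p\<^sub>j\<close> converge boundedly to the indicator function of the half-line. As \<open>p \<mapsto> p(T)x\<close> is isometric for the norm of
  \<open>L\<^sup>2(N\<^sub>x)\<close>, the vectors \<open>p\<^sub>j(T)x\<close> converge, say to \<open>Qx\<close>. Both \<open>\<parallel>Qx\<parallel>\<^sup>2\<close> and \<open>\<langle>Qx,x\<rangle>\<close> are then the mass of the
  half-line, so \<open>Q\<close> is a projection.\<close>

lemma halfline_projection: "\<exists>Q\<in>projections cblinops. \<forall>x. (norm (Q x))\<^sup>2 = measure (N x) {..l}"
proof -
  obtain p where p2: "\<And>j t. t \<in> {0..1} \<Longrightarrow> \<bar>poly (p j) t\<bar> \<le> 2"
    and pl: "\<And>t. t \<in> {0..1} \<Longrightarrow> (\<lambda>j. poly (p j) t) \<longlonglongrightarrow> indicator {..l} t"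
    by (rule step_approx[of l]) blast
  have AE': "AE t in N x. t \<in> {0..1}" for x using AEN[of x] by simp
  note [measurable_cong] = sN
  have [measurable]: "indicator {..l} \<in> borel_measurable (borel :: real measure)" by simp
  have intg: "integrable (N x) g" if "g \<in> borel_measurable borel" "\<And>t. t \<in> {0..1} \<Longrightarrow> \<bar>g t\<bar> \<le> B"
    for g :: "real \<Rightarrow> real" and x B
  proof -
    interpret finite_measure "N x" by (rule fin)
    have "AE t in N x. norm (g t) \<le> B" using AE'[of x] by eventually_elim (use that in auto)
    then show ?thesis by (rule integrable_const_bound) (use that in simp)
  qed
  have dom: "(\<lambda>j. \<integral>t. g j t \<partial>N x) \<longlonglongrightarrow> (\<integral>t. h t \<partial>N x)"
    if "\<And>j. g j \<in> borel_measurable borel" "h \<in> borel_measurable borel" "\<And>j t. t \<in> {0..1} \<Longrightarrow> \<bar>g j t\<bar> \<le> B"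
      "\<And>t. t \<in> {0..1} \<Longrightarrow> (\<lambda>j. g j t) \<longlonglongrightarrow> h t" for g :: "nat \<Rightarrow> real \<Rightarrow> real" and h x B
  proof (rule integral_dominated_convergence[where w = "\<lambda>_. B"])
    interpret finite_measure "N x" by (rule fin)
    show "integrable (N x) (\<lambda>_. B)" by simp
    show "AE t in N x. (\<lambda>j. g j t) \<longlonglongrightarrow> h t" "AE t in N x. norm (g j t) \<le> B" for j
      using AE'[of x] by (eventually_elim, use that in auto)+
  qed (use that in simp_all)
  have sq_le: "\<bar>u\<^sup>2\<bar> \<le> B\<^sup>2" if "\<bar>u\<bar> \<le> B" for u B :: real
    using power_mono[OF that, of 2] by simp
  have b3: "\<bar>poly (p j) t - indicator {..l} t\<bar> \<le> 3" if "t \<in> {0..1}" for j t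
    using p2[OF that, of j] by (auto simp: indicator_def)
  have ind: "(\<integral>t. indicator {..l} t \<partial>N x) = measure (N x) {..l}" for x
    using sN[of x] space_N[of x] by simp
  have conv1: "(\<lambda>j. \<integral>t. poly (p j) t \<partial>N x) \<longlonglongrightarrow> measure (N x) {..l}" for x
    unfolding ind[symmetric] by (rule dom[OF _ _ p2 pl]) simp_all
  have conv2: "(\<lambda>j. \<integral>t. (poly (p j) t)\<^sup>2 \<partial>N x) \<longlonglongrightarrow> measure (N x) {..l}" for x
  proof -
    have "(\<lambda>j. \<integral>t. (poly (p j) t)\<^sup>2 \<partial>N x) \<longlonglongrightarrow> (\<integral>t. (indicator {..l} t)\<^sup>2 \<partial>N x)"
      by (rule dom[OF _ _ sq_le[OF p2] tendsto_power[OF pl]]) simp_all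
    also have "(\<lambda>t. (indicator {..l} t)\<^sup>2) = (indicator {..l} :: real \<Rightarrow> real)" by (auto simp: indicator_def)
    finally show ?thesis by (simp add: ind)
  qed
  have conv3: "(\<lambda>j. \<integral>t. (poly (p j) t - indicator {..l} t)\<^sup>2 \<partial>N x) \<longlonglongrightarrow> 0" for x
  proof -
    have "(\<lambda>j. \<integral>t. (poly (p j) t - indicator {..l} t)\<^sup>2 \<partial>N x)
        \<longlonglongrightarrow> (\<integral>t. (indicator {..l} t - indicator {..l} t)\<^sup>2 \<partial>N x)"
      by (rule dom[OF _ _ sq_le[OF b3] tendsto_power[OF tendsto_diff[OF pl tendsto_const]]]) simp_all
    then show ?thesis by simp
  qed
  have cau: "Cauchy (\<lambda>j. poly_op (p j) T x)" for x
  proof (rule metric_CauchyI)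
    fix e :: real assume e: "0 < e"
    define d where "d j = (\<integral>t. (poly (p j) t - indicator {..l} t)\<^sup>2 \<partial>N x)" for j
    have "\<forall>\<^sub>F j in sequentially. d j < e\<^sup>2 / 4"
      using order_tendstoD(2)[OF conv3[of x], of "e\<^sup>2 / 4"] e by (simp add: d_def)
    then obtain M where M: "\<And>j. j \<ge> M \<Longrightarrow> d j < e\<^sup>2 / 4" unfolding eventually_sequentially by blast
    have "norm (poly_op (p i) T x - poly_op (p j) T x) < e" if "i \<ge> M" "j \<ge> M" for i j
    proof -
      have i1: "integrable (N x) (\<lambda>t. (poly (p k) t - indicator {..l} t)\<^sup>2)" for k
        by (rule intg[OF _ sq_le[OF b3]]) simp_all
      have "\<bar>poly (p i - p j) t\<bar> \<le> 4" if "t \<in> {0..1}" for t using p2[OF that, of i] p2[OF that, of j] by simp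
      then have i2: "integrable (N x) (\<lambda>t. (poly (p i - p j) t)\<^sup>2)" by (intro intg[OF _ sq_le]) simp_all
      have "(norm (poly_op (p i) T x - poly_op (p j) T x))\<^sup>2 = (\<integral>t. (poly (p i - p j) t)\<^sup>2 \<partial>N x)"
        unfolding poly_op_norm[symmetric] by (simp add: poly_op_diff blinfun.diff_left)
      also have "\<dots> \<le> (\<integral>t. 2 * (poly (p i) t - indicator {..l} t)\<^sup>2 + 2 * (poly (p j) t - indicator {..l} t)\<^sup>2 \<partial>N x)"
      proof (rule integral_mono[OF i2])
        have "(u - v)\<^sup>2 \<le> 2 * (u - w)\<^sup>2 + 2 * (v - w)\<^sup>2" for u v w :: real
          using zero_le_power2[of "(u - w) + (v - w)"] by (simp add: power2_eq_square algebra_simps)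
        then show "(poly (p i - p j) t)\<^sup>2 \<le> 2 * (poly (p i) t - indicator {..l} t)\<^sup>2 + 2 * (poly (p j) t - indicator {..l} t)\<^sup>2" for t
          by simp
      qed (use i1 in simp)
      also have "\<dots> = 2 * d i + 2 * d j" using i1 by (simp add: d_def)
      also have "\<dots> < e\<^sup>2" using M[OF that(1)] M[OF that(2)] by simp
      finally show ?thesis using e by (simp add: power2_less_imp_less)
    qed
    then show "\<exists>M. \<forall>i\<ge>M. \<forall>j\<ge>M. dist (poly_op (p i) T x) (poly_op (p j) T x) < e"
      by (auto simp: dist_norm)
  qed
  have bd: "norm (poly_op (p j) T x) \<le> 2 * norm x" for j x
  proof -
    interpret finite_measure "N x" by (rule fin)
    have "(norm (poly_op (p j) T x))\<^sup>2 \<le> (\<integral>t. 2\<^sup>2 \<partial>N x)"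
      unfolding poly_op_norm
    proof (rule integral_mono_AE)
      show "integrable (N x) (\<lambda>t. (poly (p j) t)\<^sup>2)" by (rule intg[OF _ sq_le[OF p2]]) simp_all
      show "AE t in N x. (poly (p j) t)\<^sup>2 \<le> 2\<^sup>2" using AE'[of x] by eventually_elim (use sq_le[OF p2] in auto)
    qed simp
    also have "\<dots> = (2 * norm x)\<^sup>2" using N_mass[of x] by (simp add: space_N power_mult_distrib)
    finally show ?thesis by (rule power2_le_imp_le) simp
  qed
  obtain Q where Q: "Q \<in> cblinops" "\<And>x. (\<lambda>j. poly_op (p j) T x) \<longlonglongrightarrow> blinfun_apply Q x"
    by (rule strong_limit_exists[of "\<lambda>j. poly_op (p j) T" 2])
      (use cau Cauchy_convergent bd poly_op_cblinops[OF T(1)] in auto)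
  have s: "selfadjoint Q" by (rule selfadjoint_limit[OF poly_op_selfadjoint[OF T(2)] Q(2)])
  have n: "(norm (Q x))\<^sup>2 = measure (N x) {..l}" for x
    by (rule LIMSEQ_unique[OF tendsto_power[OF tendsto_norm[OF Q(2)]]]) (simp add: poly_op_norm conv2)
  have f: "Re (cinner (Q x) x) = measure (N x) {..l}" for x
  proof (rule LIMSEQ_unique)
    show "(\<lambda>j. Re (cinner (poly_op (p j) T x) x)) \<longlonglongrightarrow> Re (cinner (Q x) x)"
      by (intro tendsto_Re cinner.tendsto Q tendsto_const)
    show "(\<lambda>j. Re (cinner (poly_op (p j) T x) x)) \<longlonglongrightarrow> measure (N x) {..l}"
      unfolding mom[symmetric] by (rule conv1)
  qed
  have "Q o\<^sub>L Q = Q" by (rule projectionI_form[OF Q(1) s]) (simp add: n f)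
  then show ?thesis using Q(1) s n by (intro bexI[of _ Q]) (auto simp: projections_cblinops)
qed

text \<open>In the step for disjoint unions, the masses of disjoint sets add up to at most \<open>\<parallel>x\<parallel>\<^sup>2\<close>; this forces the projections to be
  orthogonal, so their partial sums are projections again.\<close>

lemma borel_projection:
  assumes "E \<in> sets borel"
  shows "\<exists>Q\<in>projections cblinops. \<forall>x. (norm (Q x))\<^sup>2 = measure (N x) E"
  using assms
proof (induction rule: borel_real_induct_disjoint)
  case (atMost l) then show ?case by (rule halfline_projection)
next
  case empty
  show ?case by (rule bexI[of _ 0])
    (auto simp: projections_cblinops cblinops_zero selfadjoint_def is_adjoint_def cinner.zero_left cinner.zero_right)
next
  case (compl A)
  then obtain Q where Q: "Q \<in> projections cblinops" "\<And>x. (norm (Q x))\<^sup>2 = measure (N x) A" by blast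
  have A: "A \<in> sets (N x)" for x using compl(1) sN[of x] by simp
  have Q': "Q \<in> cblinops" "Q o\<^sub>L Q = Q" "selfadjoint Q" using Q(1) by (auto simp: projections_cblinops)
  have "(id_blinfun - Q) o\<^sub>L (id_blinfun - Q) = id_blinfun - Q"
    by (rule blinfun_eqI) (simp add: blinfun.bilinear_simps compose_eq_apply[OF Q'(2)])
  then have "id_blinfun - Q \<in> projections cblinops"
    using Q' by (simp add: projections_cblinops cblinops_diff cblinops_id selfadjoint_diff selfadjoint_id)
  moreover have "(norm ((id_blinfun - Q) x))\<^sup>2 = measure (N x) (- A)" for x
  proof -
    interpret finite_measure "N x" by (rule fin)
    show ?thesis using finite_measure_compl[OF A] N_mass[of x] projection_complement_square[OF Q'(2,3), of x]
      by (simp add: blinfun.diff_left Q(2) space_N Compl_eq_Diff_UNIV)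
  qed
  ultimately show ?case by blast
next
  case (union A)
  then obtain Q where Q: "\<And>i. Q i \<in> projections cblinops" "\<And>i x. (norm (Q i x))\<^sup>2 = measure (N x) (A i)"
    by metis
  have A: "A i \<in> sets (N x)" for i x using union(2) sN[of x] by auto
  define R where "R n = (\<Sum>i<n. Q i)" for n :: nat
  have step: "measure (N x) (\<Union>i<n. A i) + measure (N x) (A n) = measure (N x) (\<Union>i<Suc n. A i)" for n x
  proof -
    interpret finite_measure "N x" by (rule fin)
    have "measure (N x) ((\<Union>i<n. A i) \<union> A n) = measure (N x) (\<Union>i<n. A i) + measure (N x) (A n)"
      by (rule finite_measure_Union[OF _ _ disjoint_family_UN_lessThan[OF union(1)]]) (use A in auto)
    then show ?thesis by (simp add: lessThan_Suc Un_commute)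
  qed
  have R: "R n \<in> projections cblinops \<and> (\<forall>x. (norm (R n x))\<^sup>2 = measure (N x) (\<Union>i<n. A i))" for n
  proof (induction n)
    case 0
    show ?case
      by (auto simp: R_def projections_cblinops cblinops_zero selfadjoint_def is_adjoint_def cinner.zero_left cinner.zero_right)
  next
    case (Suc n)
    have e: "R (Suc n) = R n + Q n" by (simp add: R_def)
    have le: "(norm (R n x))\<^sup>2 + (norm (Q n x))\<^sup>2 \<le> (norm x)\<^sup>2" for x
      using Suc Q(2)[of n x] step[of x n] N_le by simp
    show ?case
      unfolding e using projections_add[OF _ Q(1) le] Suc Q(2) step by auto
  qed
  obtain P where "P \<in> projections cblinops" "\<And>x. (norm (P x))\<^sup>2 = measure (N x) (\<Union>i. A i)"
  proof (rule projection_increasing_limit[of R "\<lambda>x. measure (N x) (\<Union>i. A i)"])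
    show "R n \<in> projections cblinops" for n using R by blast
    show "(\<lambda>n. (norm (R n x))\<^sup>2) \<longlonglongrightarrow> measure (N x) (\<Union>i. A i)" for x
    proof -
      interpret finite_measure "N x" by (rule fin)
      show ?thesis using measure_UN_lessThan_tendsto[of A] A R by auto
    qed
    show "norm (R n x) \<le> norm (R (Suc n) x)" for n x
    proof (rule power2_le_imp_le)
      show "(norm (R n x))\<^sup>2 \<le> (norm (R (Suc n) x))\<^sup>2"
        using R[of n, THEN conjunct2, rule_format, of x] R[of "Suc n", THEN conjunct2, rule_format, of x]
          step[of x n] measure_nonneg[of "N x" "A n"] by linarith
    qed simp
  qed blast
  then show ?case by blast
qed

end

text \<open>The measure against which a spectral measure integrates the identity function to obtain \<open>\<langle>ax,x\<rangle>\<close>.\<close>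

definition vector_measure :: "(real set \<Rightarrow> 'h::complex_hilbert op) \<Rightarrow> 'h \<Rightarrow> real measure" where
  "vector_measure P x = measure_of UNIV (sets borel) (\<lambda>E. ennreal ((norm (blinfun_apply (P E) x))\<^sup>2))"

lemma measure_of_borel_eq:
  fixes N :: "real measure"
  assumes "sets N = sets borel" and e: "\<And>E. E \<in> sets borel \<Longrightarrow> f E = emeasure N E"
  shows "measure_of UNIV (sets borel) f = N"
proof -
  have sp: "space N = UNIV" using sets_eq_imp_space_eq[OF assms(1)] by simp
  have "measure_of UNIV (sets borel) f = measure_of UNIV (sets borel) (emeasure N)"
  proof (rule measure_of_eq)
    show "f E = emeasure N E" if "E \<in> sigma_sets UNIV (sets borel)" for E
      using that e sets.sigma_sets_eq[of "borel :: real measure"] by simp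
  qed simp
  also have "\<dots> = N" using measure_of_of_measure[of N] by (simp add: sp assms(1))
  finally show ?thesis .
qed

lemma emeasure_borel_measure_of:
  fixes f :: "real set \<Rightarrow> real"
  assumes "f {} = 0" "\<And>E. E \<in> sets borel \<Longrightarrow> 0 \<le> f E" and E: "E \<in> sets borel"
    and sums: "\<And>A :: nat \<Rightarrow> real set. range A \<subseteq> sets borel \<Longrightarrow> disjoint_family A \<Longrightarrow> (\<lambda>n. f (A n)) sums f (\<Union>n. A n)"
  shows "emeasure (measure_of UNIV (sets borel) (\<lambda>E. ennreal (f E))) E = ennreal (f E)"
proof (rule emeasure_measure_of_sigma)
  show "sigma_algebra UNIV (sets (borel :: real measure))"
    using sets.sigma_algebra_axioms[of "borel :: real measure"] by simp
  show "countably_additive (sets borel) (\<lambda>E. ennreal (f E))"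
  proof (rule countably_additiveI)
    fix A :: "nat \<Rightarrow> real set" assume A: "range A \<subseteq> sets borel" "disjoint_family A"
    show "(\<Sum>n. ennreal (f (A n))) = ennreal (f (\<Union>n. A n))"
      by (rule suminf_ennreal_eq[OF _ sums[OF A]]) (use assms(2) A in auto)
  qed
qed (use assms in \<open>simp_all add: positive_def\<close>)

locale projection_valued_measure =
  fixes P :: "real set \<Rightarrow> 'h::complex_hilbert op"
  assumes P_projection: "E \<in> sets borel \<Longrightarrow> P E \<in> projections cblinops"
    and P_UNIV: "P UNIV = id_blinfun"
    and P_Int: "E \<in> sets borel \<Longrightarrow> F \<in> sets borel \<Longrightarrow> P (E \<inter> F) = P E o\<^sub>L P F"
    and P_sums: "range A \<subseteq> sets borel \<Longrightarrow> disjoint_family A \<Longrightarrow>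
      (\<lambda>n::nat. blinfun_apply (P (A n)) x) sums blinfun_apply (P (\<Union>n. A n)) x"
begin

lemma P_cblinops: "E \<in> sets borel \<Longrightarrow> P E \<in> cblinops"
  and P_idem: "E \<in> sets borel \<Longrightarrow> P E o\<^sub>L P E = P E"
  and P_selfadjoint: "E \<in> sets borel \<Longrightarrow> selfadjoint (P E)"
  using P_projection by (auto simp: projections_cblinops)

lemma P_apply_apply: "E \<in> sets borel \<Longrightarrow> F \<in> sets borel \<Longrightarrow> P E (P F x) = P (E \<inter> F) x"
  by (simp add: P_Int)

lemma P_norm_le: "E \<in> sets borel \<Longrightarrow> norm (P E x) \<le> norm x"
  by (rule projection_norm_le[OF P_idem P_selfadjoint])

lemma P_empty: "P {} = 0"
proof (rule blinfun_eqI)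
  fix x
  have "(\<lambda>n::nat. P {} x) sums P {} x" using P_sums[of "\<lambda>_. {}" x] by (simp add: disjoint_family_on_def)
  then have "(\<lambda>n::nat. P {} x) \<longlonglongrightarrow> 0" using sums_summable summable_LIMSEQ_zero by blast
  then show "P {} x = blinfun_apply 0 x" by (simp add: LIMSEQ_const_iff)
qed

lemma P_union:
  assumes "E \<in> sets borel" "F \<in> sets borel" "E \<inter> F = {}"
  shows "P (E \<union> F) = P E + P F"
proof (rule blinfun_eqI)
  fix x
  define A where "A n = (if n = 0 then E else if n = 1 then F else {})" for n :: nat
  have "(\<lambda>n. P (A n) x) sums P (\<Union>n. A n) x"
    by (rule P_sums) (use assms in \<open>auto simp: A_def disjoint_family_on_def\<close>)
  moreover have "(\<Union>n. A n) = E \<union> F" by (auto simp: A_def split: if_splits)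
  moreover have "(\<lambda>n. P (A n) x) sums (\<Sum>n\<in>{0, 1}. P (A n) x)"
    by (rule sums_finite) (auto simp: A_def P_empty)
  ultimately show "P (E \<union> F) x = (P E + P F) x"
    using sums_unique2 by (fastforce simp: A_def blinfun.add_left)
qed

lemma P_form: "E \<in> sets borel \<Longrightarrow> cinner (P E x) x = of_real ((norm (P E x))\<^sup>2)"
  by (rule projection_form[OF P_idem P_selfadjoint])

lemma sets_vector_measure [simp, measurable_cong]: "sets (vector_measure P x) = sets borel"
  unfolding vector_measure_def by (simp add: sets.sigma_sets_eq[of borel, simplified])

lemma space_vector_measure [simp]: "space (vector_measure P x) = UNIV"
  unfolding vector_measure_def by simp

lemma emeasure_vector_measure:
  assumes "E \<in> sets borel"
  shows "emeasure (vector_measure P x) E = ennreal ((norm (P E x))\<^sup>2)"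
  unfolding vector_measure_def
proof (rule emeasure_borel_measure_of)
  fix A :: "nat \<Rightarrow> real set" assume A: "range A \<subseteq> sets borel" "disjoint_family A"
  then have Ab: "A n \<in> sets borel" "(\<Union>n. A n) \<in> sets borel" for n by auto
  have "(\<lambda>n. Re (cinner (P (A n) x) x)) sums Re (cinner (P (\<Union>n. A n) x) x)"
    by (intro sums_Re bounded_linear.sums[OF cinner.bounded_linear_left] P_sums A)
  then show "(\<lambda>n. (norm (P (A n) x))\<^sup>2) sums (norm (P (\<Union>n. A n) x))\<^sup>2"
    using P_form[OF Ab(1)] P_form[OF Ab(2)] by simp
qed (use assms P_empty in auto)

lemma finite_vector_measure: "finite_measure (vector_measure P x)"
  by (rule finite_measureI) (simp add: emeasure_vector_measure)

lemma measure_vector_measure: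
  "E \<in> sets borel \<Longrightarrow> measure (vector_measure P x) E = (norm (P E x))\<^sup>2"
  by (simp add: measure_def emeasure_vector_measure)

lemma AE_vector_measure:
  assumes "E \<in> sets borel" "P E x = x" shows "AE t in vector_measure P x. t \<in> E"
proof (rule AE_I')
  have "P (- E) x = 0"
    using P_apply_apply[of "-E" E x] assms by (simp add: P_empty)
  then show "- E \<in> null_sets (vector_measure P x)"
    using assms(1) by (auto simp: null_sets_def emeasure_vector_measure)
qed auto

end

text \<open>A projection is determined by its quadratic form, so additivity of the measures \<open>N x\<close> passes to \<open>P\<close>. Multiplicativity
  follows by splitting \<open>E\<close> and \<open>F\<close> along \<open>E \<inter> F\<close>, since disjoint sets have orthogonal projections.\<close>

lemma spectral_measure_exists_unit:
  fixes T :: "'h::complex_hilbert op"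
  assumes T: "T \<in> cblinops" "selfadjoint T"
    and T0: "\<And>x. 0 \<le> Re (cinner (T x) x)" and T1: "\<And>x. Re (cinner (T x) x) \<le> (norm x)\<^sup>2"
  shows "\<exists>P. is_spectral_measure T P"
proof -
  have "\<exists>N. \<forall>x. finite_measure (N x) \<and> sets (N x) = sets borel \<and> (AE t in N x. 0 \<le> t \<and> t \<le> 1) \<and>
     (\<forall>p. (\<integral>t. poly p t \<partial>N x) = Re (cinner (poly_op p T x) x))"
    by (rule choice) (rule allI, rule scalar_spectral_measure[OF T(2) T0 T1])
  then obtain N where fin: "\<And>x. finite_measure (N x)" and sN: "\<And>x. sets (N x) = sets borel"
    and AEN: "\<And>x. AE t in N x. 0 \<le> t \<and> t \<le> 1"
    and mom: "\<And>x p. (\<integral>t. poly p t \<partial>(N x)) = Re (cinner (poly_op p T x) x)" by auto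
  note sp = space_N[OF T fin sN AEN mom]
  note mass = N_mass[OF T fin sN AEN mom]
  note le = N_le[OF T fin sN AEN mom]
  have "\<exists>P. \<forall>E\<in>sets borel. P E \<in> projections cblinops \<and> (\<forall>x. (norm (P E x))\<^sup>2 = measure (N x) E)"
    using borel_projection[OF T fin sN AEN mom] by (intro bchoice) auto
  then obtain P where P: "\<And>E. E \<in> sets borel \<Longrightarrow> P E \<in> projections cblinops"
    and Pn: "\<And>E x. E \<in> sets borel \<Longrightarrow> (norm (P E x))\<^sup>2 = measure (N x) E" by blast
  have P': "P E \<in> cblinops" "P E o\<^sub>L P E = P E" "selfadjoint (P E)" if "E \<in> sets borel" for E
    using P[OF that] by (auto simp: projections_cblinops)
  have Peq: "P E = Q" if "E \<in> sets borel" "Q \<in> projections cblinops" "\<And>x. (norm (Q x))\<^sup>2 = measure (N x) E" for E Q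
  proof (rule selfadjoint_eqI)
    show Q: "Q \<in> cblinops" "selfadjoint Q" using that by (auto simp: projections_cblinops)
    show "Re (cinner (P E x) x) = Re (cinner (Q x) x)" for x
      using projection_form[OF P'(2,3)[OF that(1)], of x] projection_form[of Q x] that Pn[OF that(1), of x]
      by (simp add: projections_cblinops)
  qed (use P' that in auto)
  have meas_add: "measure (N x) (E \<union> F) = measure (N x) E + measure (N x) F"
    if "E \<in> sets borel" "F \<in> sets borel" "E \<inter> F = {}" for E F x
  proof -
    interpret finite_measure "N x" by (rule fin)
    show ?thesis using that sN[of x] by (intro finite_measure_Union) auto
  qed
  have Padd: "P (E \<union> F) = P E + P F" and Porth: "P E o\<^sub>L P F = 0"
    if EF: "E \<in> sets borel" "F \<in> sets borel" "E \<inter> F = {}" for E F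
  proof -
    have l: "(norm (P E x))\<^sup>2 + (norm (P F x))\<^sup>2 \<le> (norm x)\<^sup>2" for x
      using meas_add[OF EF, of x] Pn EF le by metis
    show "P E o\<^sub>L P F = 0" by (rule projections_orthogonal[OF P'(2,3)[OF EF(1)] P'(2,3)[OF EF(2)] l])
    show "P (E \<union> F) = P E + P F"
      by (rule Peq)
        (use EF projections_add[OF P[OF EF(1)] P[OF EF(2)] l] Pn meas_add in auto)
  qed
  have Pint: "P (E \<inter> F) = P E o\<^sub>L P F" if EF: "E \<in> sets borel" "F \<in> sets borel" for E F
  proof -
    have b: "E \<inter> F \<in> sets borel" "E - F \<in> sets borel" "F - E \<in> sets borel" using EF by auto
    have d: "E \<inter> F \<inter> (E - F) = {}" "E \<inter> F \<inter> (F - E) = {}" "(E - F) \<inter> (E \<inter> F) = {}" "(E - F) \<inter> (F - E) = {}"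
      and u: "E \<inter> F \<union> (E - F) = E" "E \<inter> F \<union> (F - E) = F" by auto
    have "P E = P (E \<inter> F) + P (E - F)" using Padd[OF b(1,2) d(1)] unfolding u .
    moreover have "P F = P (E \<inter> F) + P (F - E)" using Padd[OF b(1,3) d(2)] unfolding u .
    moreover note Porth[OF b(1,3) d(2)] Porth[OF b(2,1) d(3)] Porth[OF b(2,3) d(4)]
    ultimately show ?thesis using P'(2)[OF b(1)]
      by (simp add: blinfun_compose.add_left blinfun_compose.add_right)
  qed
  have PU: "P UNIV = id_blinfun"
    by (rule Peq) (auto simp: projections_cblinops cblinops_id selfadjoint_id mass blinfun_eqI)
  have vm: "measure_of UNIV (sets borel) (\<lambda>E. ennreal ((norm (blinfun_apply (P E) x))\<^sup>2)) = N x" for x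
  proof (rule measure_of_borel_eq[OF sN])
    interpret finite_measure "N x" by (rule fin)
    show "ennreal ((norm (P E x))\<^sup>2) = emeasure (N x) E" if "E \<in> sets borel" for E
      using Pn[OF that, of x] by (simp add: emeasure_eq_measure)
  qed
  have P01: "P {0..1} = id_blinfun"
  proof (rule Peq)
    fix x
    interpret finite_measure "N x" by (rule fin)
    have "measure (N x) {0..1} = measure (N x) (space (N x))"
      by (rule finite_measure_eq_AE) (use AEN[of x] sN[of x] in \<open>auto elim!: eventually_mono simp: sp\<close>)
    then show "(norm (id_blinfun x))\<^sup>2 = measure (N x) {0..1}" using mass[of x] by (simp add: sp)
  qed (auto simp: projections_cblinops cblinops_id selfadjoint_id intro: blinfun_eqI)
  have sums: "(\<lambda>n. P (E n) x) sums P (\<Union>n. E n) x" if E: "range E \<subseteq> sets borel" and d: "disjoint_family E"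
    for E :: "nat \<Rightarrow> real set" and x
  proof -
    have Eb: "E i \<in> sets borel" for i using E by auto
    have Ub: "(\<Union>i<n. E i) \<in> sets borel" "(\<Union>i. E i) - (\<Union>i<n. E i) \<in> sets borel" "(\<Union>i. E i) \<in> sets borel" for n :: nat
      using Eb by auto
    have "P {} = 0" using Padd[of "{}" "{}"] by simp
    then have fin_add: "P (\<Union>i<n. E i) = (\<Sum>i<n. P (E i))" for n :: nat
      by (rule finite_additive_UN_lessThan[OF _ d E Padd])
    interpret finite_measure "N x" by (rule fin)
    have diff: "(norm ((\<Sum>i<n. P (E i) x) - P (\<Union>n. E n) x))\<^sup>2 = measure (N x) (\<Union>i. E i) - measure (N x) (\<Union>i<n. E i)" for n
    proof -
      have u: "(\<Union>i<n. E i) \<union> ((\<Union>i. E i) - (\<Union>i<n. E i)) = (\<Union>i. E i)" by blast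
      have "P (\<Union>i. E i) = P (\<Union>i<n. E i) + P ((\<Union>i. E i) - (\<Union>i<n. E i))"
        using Padd[OF Ub(1,2)[of n]] unfolding u by simp
      then have "(\<Sum>i<n. P (E i) x) - P (\<Union>n. E n) x = - P ((\<Union>i. E i) - (\<Union>i<n. E i)) x"
        unfolding fin_add by (simp add: blinfun.add_left blinfun.sum_left)
      then have "(norm ((\<Sum>i<n. P (E i) x) - P (\<Union>n. E n) x))\<^sup>2 = measure (N x) ((\<Union>i. E i) - (\<Union>i<n. E i))"
        using Pn[OF Ub(2)[of n], of x] by simp
      also have "\<dots> = measure (N x) (\<Union>i. E i) - measure (N x) (\<Union>i<n. E i)"
        using meas_add[OF Ub(1,2)[of n], of x] unfolding u by simp
      finally show ?thesis .
    qed
    have "(\<lambda>n. measure (N x) (\<Union>i<n. E i)) \<longlonglongrightarrow> measure (N x) (\<Union>i. E i)"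
      by (rule measure_UN_lessThan_tendsto) (use E sN[of x] in simp)
    then have "(\<lambda>n. (norm ((\<Sum>i<n. P (E i) x) - P (\<Union>n. E n) x))\<^sup>2) \<longlonglongrightarrow> 0"
      unfolding diff by (auto intro: tendsto_eq_intros)
    from tendsto_real_sqrt[OF this] have "(\<lambda>n. norm ((\<Sum>i<n. P (E i) x) - P (\<Union>n. E n) x)) \<longlonglongrightarrow> 0" by simp
    then show ?thesis unfolding sums_def by (simp add: LIM_zero_cancel tendsto_norm_zero_iff)
  qed
  have "cinner (T x) x = complex_of_real (\<integral>t. t \<partial>N x)" for x
    using mom[of x XX] selfadjoint_form_real[OF T(2), of x] by (simp only: poly_op_X) simp
  then have "is_spectral_measure T P"
    unfolding is_spectral_measure_def vm using P PU Pint sums P01 by (intro conjI exI[of _ "{0..1}"]) auto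
  then show ?thesis by blast
qed

locale spectral_measure = projection_valued_measure P for P :: "real set \<Rightarrow> 'h::complex_hilbert op" +
  fixes a :: "'h op"
  assumes bounded_support: "\<exists>C. compact C \<and> P C = id_blinfun"
    and form_eq: "cinner (a x) x = complex_of_real (\<integral>t. t \<partial>vector_measure P x)"

lemma is_spectral_measure_iff: "is_spectral_measure a P \<longleftrightarrow> spectral_measure P a"
  unfolding is_spectral_measure_def spectral_measure_def projection_valued_measure_def
    spectral_measure_axioms_def vector_measure_def by auto

context spectral_measure
begin

text \<open>Chosen so that the support lies in a symmetric interval, which makes \<open>|t| \<le> radius\<close> the only support condition in the sequel.\<close>

definition radius where "radius = (SOME R. 0 < R \<and> P {-R..R} = id_blinfun)"

lemma radius: "0 < radius \<and> P {-radius..radius} = id_blinfun"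
  unfolding radius_def
proof (rule someI_ex)
  obtain C where C: "compact C" "P C = id_blinfun" using bounded_support by blast
  then obtain B where B: "0 < B" "\<And>t. t \<in> C \<Longrightarrow> norm t \<le> B" using compact_imp_bounded bounded_pos by metis
  have "{-B..B} \<inter> C = C" using B(2) by fastforce
  moreover have "C \<in> sets borel" using C(1) by (simp add: borel_compact)
  ultimately have "P {-B..B} o\<^sub>L P C = P C" using P_Int[of "{-B..B}" C] by simp
  then have "P {-B..B} = id_blinfun" by (simp add: C(2))
  then show "\<exists>R. 0 < R \<and> P {-R..R} = id_blinfun" using B(1) by blast
qed

lemma AE_radius: "AE t in vector_measure P x. \<bar>t\<bar> \<le> radius"
  using AE_vector_measure[of "{-radius..radius}" x] radius by (auto elim: eventually_mono)

lemma integrable_bounded_on_support: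
  fixes g :: "real \<Rightarrow> real"
  assumes [measurable]: "g \<in> borel_measurable borel" and "\<And>t. \<bar>t\<bar> \<le> radius \<Longrightarrow> \<bar>g t\<bar> \<le> B"
  shows "integrable (vector_measure P x) g"
proof -
  interpret finite_measure "vector_measure P x" by (rule finite_vector_measure)
  show ?thesis using AE_radius[of x] assms(2) by (intro integrable_const_bound[of _ B]) (auto elim: eventually_mono)
qed

end

text \<open>The affine map \<open>\<phi>\<close> takes the unit interval to \<open>[-K,K]\<close>, where \<open>K > \<parallel>a\<parallel>\<close>; the spectral measure of the rescaled operator is
  transported along it.\<close>

theorem spectral_measure_exists:
  fixes a :: "'h::complex_hilbert op"
  assumes a: "a \<in> cblinops" "selfadjoint a"
  shows "\<exists>P. is_spectral_measure a P"
proof -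
  define K where "K = norm a + 1"
  have K: "0 < K" by (simp add: K_def add_nonneg_pos)
  define T where "T = (1 / (2 * K)) *\<^sub>R (a + K *\<^sub>R id_blinfun)"
  define \<phi> where "\<phi> s = 2 * K * s - K" for s :: real
  have [measurable]: "\<phi> \<in> borel_measurable borel" unfolding \<phi>_def[abs_def] by simp
  have T: "T \<in> cblinops" "selfadjoint T"
    unfolding T_def using a by (auto intro!: cblinops_scaleR cblinops_add cblinops_id selfadjoint_scaleR selfadjoint_add selfadjoint_id)
  have form: "Re (cinner (T x) x) = (Re (cinner (a x) x) + K * (norm x)\<^sup>2) / (2 * K)" for x
    by (simp add: T_def blinfun.bilinear_simps cinner_scaleR_left cinner_add_left Re_cinner_self)
  have bd: "\<bar>Re (cinner (a x) x)\<bar> \<le> K * (norm x)\<^sup>2" for x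
  proof -
    have "\<bar>Re (cinner (a x) x)\<bar> \<le> norm (a x) * norm x"
      using abs_Re_le_cmod cinner_cauchy_schwarz by (rule order_trans)
    also have "\<dots> \<le> (K * norm x) * norm x"
      using norm_blinfun[of a x] by (intro mult_right_mono) (auto simp: K_def algebra_simps intro: order_trans)
    finally show ?thesis by (simp add: power2_eq_square mult.assoc)
  qed
  have T0: "0 \<le> Re (cinner (T x) x)" for x using bd[of x] K by (simp add: form)
  have T1: "Re (cinner (T x) x) \<le> (norm x)\<^sup>2" for x using bd[of x] K by (simp add: form divide_le_eq)
  obtain P where "is_spectral_measure T P" using spectral_measure_exists_unit[OF T T0 T1] by blast
  then interpret P: spectral_measure P T by (simp add: is_spectral_measure_iff)
  define P' where "P' E = P (\<phi> -` E)" for E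
  have pre: "\<phi> -` E \<in> sets borel" if "E \<in> sets borel" for E
    using measurable_sets[of \<phi> borel borel E] that by simp
  interpret P': projection_valued_measure P'
  proof
    show "P' E \<in> projections cblinops" if "E \<in> sets borel" for E
      unfolding P'_def by (rule P.P_projection[OF pre[OF that]])
    show "P' UNIV = id_blinfun" by (simp add: P'_def P.P_UNIV)
    show "P' (E \<inter> F) = P' E o\<^sub>L P' F" if "E \<in> sets borel" "F \<in> sets borel" for E F
      unfolding P'_def vimage_Int by (rule P.P_Int[OF pre[OF that(1)] pre[OF that(2)]])
    show "(\<lambda>n. P' (E n) x) sums P' (\<Union>n. E n) x" if "range E \<subseteq> sets borel" "disjoint_family E"
      for E :: "nat \<Rightarrow> real set" and x
      unfolding P'_def vimage_UN
      by (rule P.P_sums) (use that pre in \<open>auto simp: disjoint_family_on_def\<close>)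
  qed
  have "spectral_measure P' a"
  proof
    obtain C where C: "compact C" "P C = id_blinfun" using P.bounded_support by blast
    have "inj \<phi>" using K by (auto simp: inj_def \<phi>_def)
    then have "P' (\<phi> ` C) = id_blinfun" by (simp add: P'_def inj_vimage_image_eq C)
    moreover have "compact (\<phi> ` C)"
      by (rule compact_continuous_image[OF _ C(1)]) (auto simp: \<phi>_def intro!: continuous_intros)
    ultimately show "\<exists>C. compact C \<and> P' C = id_blinfun" by blast
    fix x
    interpret finite_measure "vector_measure P x" by (rule P.finite_vector_measure)
    have vm: "vector_measure P' x = distr (vector_measure P x) borel \<phi>"
      unfolding vector_measure_def[of P']
      by (rule measure_of_borel_eq)
        (auto simp: emeasure_distr P.emeasure_vector_measure pre P'_def)
    have i: "integrable (vector_measure P x) (\<lambda>t. t)"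
      by (rule P.integrable_bounded_on_support[of _ P.radius]) auto
    have mass: "measure (vector_measure P x) UNIV = (norm x)\<^sup>2"
      by (simp add: P.measure_vector_measure P.P_UNIV)
    have "(\<integral>t. t \<partial>vector_measure P' x) = (\<integral>t. \<phi> t \<partial>vector_measure P x)"
      unfolding vm by (rule integral_distr) auto
    also have "\<dots> = (\<integral>t. 2 * K * t \<partial>vector_measure P x) - (\<integral>t. K \<partial>vector_measure P x)"
      unfolding \<phi>_def by (rule Bochner_Integration.integral_diff) (use i in auto)
    also have "\<dots> = 2 * K * (\<integral>t. t \<partial>vector_measure P x) - K * (norm x)\<^sup>2"
      using mass by simp
    also have "(\<integral>t. t \<partial>vector_measure P x) = Re (cinner (T x) x)" using P.form_eq[of x] by simp
    also have "2 * K * Re (cinner (T x) x) - K * (norm x)\<^sup>2 = Re (cinner (a x) x)"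
      using K by (simp add: form)
    finally show "cinner (a x) x = complex_of_real (\<integral>t. t \<partial>vector_measure P' x)"
      using selfadjoint_form_real[OF a(2), of x] by metis
  qed
  then show ?thesis using is_spectral_measure_iff by blast
qed

section \<open>Consequences of the spectral theorem\<close>

lemma (in projection_valued_measure) P_incseq:
  assumes A: "\<And>n. A n \<in> sets borel" "incseq A"
  shows "(\<lambda>n. P (A n) x) \<longlonglongrightarrow> P (\<Union>n. A n) x"
proof -
  have U: "(\<Union>n. A n) \<in> sets borel" using A by auto
  interpret finite_measure "vector_measure P x" by (rule finite_vector_measure)
  have le: "norm (P (A n) y) \<le> norm (P (\<Union>n. A n) y)" for n y
  proof -
    have "A n \<inter> (\<Union>n. A n) = A n" by auto
    then have "P (A n) y = P (A n) (P (\<Union>n. A n) y)" using P_apply_apply[OF A(1) U, of n y] by simp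
    then show ?thesis using P_norm_le[OF A(1), of n "P (\<Union>n. A n) y"] by simp
  qed
  have d: "(norm (P (\<Union>n. A n) x - P (A n) x))\<^sup>2 =
     measure (vector_measure P x) (\<Union>n. A n) - measure (vector_measure P x) (A n)" for n
    using projection_difference_norm[OF P_idem[OF U] P_selfadjoint[OF U] P_idem[OF A(1)] P_selfadjoint[OF A(1)] le]
    by (simp add: measure_vector_measure U A)
  have "(\<lambda>n. measure (vector_measure P x) (A n)) \<longlonglongrightarrow> measure (vector_measure P x) (\<Union>n. A n)"
    by (rule finite_Lim_measure_incseq) (use A in auto)
  then have "(\<lambda>n. (norm (P (\<Union>n. A n) x - P (A n) x))\<^sup>2) \<longlonglongrightarrow> 0"
    unfolding d by (auto intro: tendsto_eq_intros)
  from tendsto_real_sqrt[OF this] have "(\<lambda>n. norm (P (\<Union>n. A n) x - P (A n) x)) \<longlonglongrightarrow> 0" by simp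
  then have "(\<lambda>n. P (\<Union>n. A n) x - P (A n) x) \<longlonglongrightarrow> 0" by (simp add: tendsto_norm_zero_iff)
  from tendsto_diff[OF tendsto_const[of "P (\<Union>n. A n) x"] this] show ?thesis by simp
qed

lemma (in projection_valued_measure) P_compl:
  assumes "E \<in> sets borel" shows "P (- E) = id_blinfun - P E"
proof -
  have "id_blinfun = P E + P (- E)" using P_union[of E "- E"] assms by (simp add: P_UNIV)
  then show ?thesis by (metis add_diff_cancel_left')
qed

text \<open>This localises the integral formula for \<open>\<langle>ax,x\<rangle>\<close> to Borel sets.\<close>

lemma (in projection_valued_measure) vector_measure_restrict:
  assumes E: "E \<in> sets borel"
  shows "vector_measure P (P E x) = density (vector_measure P x) (indicator E)"
proof (rule measure_eqI)
  fix F assume "F \<in> sets (vector_measure P (P E x))"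
  then have F: "F \<in> sets borel" by simp
  have "emeasure (density (vector_measure P x) (indicator E)) F = (\<integral>\<^sup>+t. indicator E t * indicator F t \<partial>vector_measure P x)"
    by (rule emeasure_density) (use E F in auto)
  also have "\<dots> = (\<integral>\<^sup>+t. indicator (F \<inter> E) t \<partial>vector_measure P x)"
    by (rule nn_integral_cong) (auto simp: indicator_def)
  also have "\<dots> = emeasure (vector_measure P x) (F \<inter> E)" using E F by simp
  finally show "emeasure (vector_measure P (P E x)) F = emeasure (density (vector_measure P x) (indicator E)) F"
    using E F by (simp add: emeasure_vector_measure P_apply_apply del: P_Int)
qed simp

text \<open>If \<open>b\<close> is bounded above by \<open>\<beta>\<close> on the range of \<open>p\<close> and below by \<open>\<gamma>\<close> on the range of \<open>X\<close>, comparing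
  \<open>\<parallel>b X y\<parallel> = \<parallel>X b p y\<parallel>\<close> gives \<open>\<parallel>X\<parallel> \<le> (\<beta>/\<gamma>) \<parallel>X\<parallel>\<close>.\<close>

lemma intertwiner_eq_zero:
  fixes X b p :: "'h::complex_hilbert op"
  assumes comm: "X o\<^sub>L b = b o\<^sub>L X" and Xp: "X o\<^sub>L p = X" and pb: "p o\<^sub>L b = b o\<^sub>L p"
    and p1: "\<And>y. norm (p y) \<le> norm y"
    and up: "\<And>y. norm (b (p y)) \<le> \<beta> * norm (p y)" and low: "\<And>y. \<gamma> * norm (X y) \<le> norm (b (X y))"
    and \<beta>\<gamma>: "0 \<le> \<beta>" "\<beta> < \<gamma>"
  shows "X = 0"
proof -
  have "norm (X y) \<le> (\<beta> / \<gamma> * norm X) * norm y" for y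
  proof -
    have "b (X y) = X (b y)" using compose_eq_apply[OF comm, of y] by simp
    also have "\<dots> = X (p (b y))" using compose_eq_apply[OF Xp, of "b y"] by simp
    also have "p (b y) = b (p y)" using compose_eq_apply[OF pb, of y] by simp
    finally have "\<gamma> * norm (X y) \<le> norm (X (b (p y)))" using low[of y] by simp
    also have "\<dots> \<le> norm X * norm (b (p y))" by (rule norm_blinfun)
    also have "\<dots> \<le> norm X * (\<beta> * norm y)"
      using up[of y] p1[of y] \<beta>\<gamma> by (intro mult_left_mono) (auto intro: order_trans mult_left_mono)
    finally show ?thesis using \<beta>\<gamma> by (simp add: field_simps)
  qed
  then have "norm X \<le> \<beta> / \<gamma> * norm X" by (intro norm_blinfun_bound) (use \<beta>\<gamma> in auto)
  moreover have "\<beta> / \<gamma> < 1" using \<beta>\<gamma> by simp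
  ultimately have "norm X \<le> 0"
    by (metis less_eq_real_def mult_le_cancel_right1 not_less norm_ge_zero)
  then show ?thesis by simp
qed

lemma norm_lower_bound:
  assumes "\<gamma> * (norm z)\<^sup>2 \<le> Re (cinner (blinfun_apply b z) z)"
  shows "\<gamma> * norm z \<le> norm (b (z::'h::complex_hilbert))"
proof (cases "z = 0")
  case False
  have "\<gamma> * norm z * norm z \<le> norm (b z) * norm z"
    using assms Re_cinner_le[of "b z" z] by (simp add: power2_eq_square mult.assoc)
  then show ?thesis using False by simp
qed simp

lemma selfadjoint_sandwich: "selfadjoint p \<Longrightarrow> selfadjoint b \<Longrightarrow> selfadjoint (p o\<^sub>L (b o\<^sub>L p))"
  by (simp add: selfadjoint_def is_adjoint_def)

locale spectral_resolution = spectral_measure P a for P :: "real set \<Rightarrow> 'h::complex_hilbert op" and a +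
  assumes a_cblinops: "a \<in> cblinops" and a_selfadjoint: "selfadjoint a"
begin

lemma form_restrict:
  assumes E: "E \<in> sets borel"
  shows "Re (cinner (a (P E x)) (P E x)) = (\<integral>t. indicator E t * t \<partial>vector_measure P x)"
proof -
  have "Re (cinner (a (P E x)) (P E x)) = (\<integral>t. t \<partial>density (vector_measure P x) (indicator E))"
    using form_eq[of "P E x"] by (simp add: vector_measure_restrict[OF E])
  also have "density (vector_measure P x) (indicator E) = density (vector_measure P x) (\<lambda>t. ennreal (indicator E t))"
    by (simp add: ennreal_indicator)
  also have "(\<integral>t. t \<partial>\<dots>) = (\<integral>t. indicator E t * t \<partial>vector_measure P x)"
    by (subst integral_density) (use E in auto)
  finally show ?thesis .
qed

lemma integrable_id: "integrable (vector_measure P x) (\<lambda>t. t)"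
  by (rule integrable_bounded_on_support[of _ radius]) auto

lemma integrable_indicator_id: "E \<in> sets borel \<Longrightarrow> integrable (vector_measure P x) (\<lambda>t. indicator E t * t)"
  by (rule integrable_bounded_on_support[of _ radius]) (auto simp: indicator_def intro: less_imp_le radius[THEN conjunct1])

text \<open>With \<open>p = P(E)\<close>, splitting the integral over \<open>E\<close> and its complement shows that \<open>a\<close> and
  \<open>pap + (1-p)a(1-p)\<close> have the same quadratic form.\<close>

lemma P_commute:
  assumes E: "E \<in> sets borel" shows "a o\<^sub>L P E = P E o\<^sub>L a"
proof -
  define p where "p = P E"
  define p' where "p' = P (- E)"
  have E': "- E \<in> sets borel" using E by auto
  have pp: "p' o\<^sub>L p = 0" "p o\<^sub>L p' = 0"
    using P_Int[OF E' E] P_Int[OF E E'] by (simp_all add: p_def p'_def P_empty)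
  have "a = (p o\<^sub>L (a o\<^sub>L p)) + (p' o\<^sub>L (a o\<^sub>L p'))"
  proof (rule selfadjoint_eqI)
    have cb: "p \<in> cblinops" "p' \<in> cblinops" and sa: "selfadjoint p" "selfadjoint p'"
      using P_cblinops P_selfadjoint E E' by (auto simp: p_def p'_def)
    show "(p o\<^sub>L (a o\<^sub>L p)) + (p' o\<^sub>L (a o\<^sub>L p')) \<in> cblinops"
      by (intro cblinops_add cblinops_compose cb a_cblinops)
    show "selfadjoint ((p o\<^sub>L (a o\<^sub>L p)) + (p' o\<^sub>L (a o\<^sub>L p')))"
      by (intro selfadjoint_add selfadjoint_sandwich sa a_selfadjoint)
    fix x
    have "Re (cinner (((p o\<^sub>L (a o\<^sub>L p)) + (p' o\<^sub>L (a o\<^sub>L p'))) x) x) =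
       Re (cinner (a (p x)) (p x)) + Re (cinner (a (p' x)) (p' x))"
      using selfadjointD[OF sa(1), of "a (p x)" x] selfadjointD[OF sa(2), of "a (p' x)" x]
      by (simp add: blinfun.add_left cinner_add_left)
    also have "\<dots> = (\<integral>t. indicator E t * t \<partial>vector_measure P x) + (\<integral>t. indicator (- E) t * t \<partial>vector_measure P x)"
      unfolding p_def p'_def by (simp only: form_restrict[OF E] form_restrict[OF E'])
    also have "\<dots> = (\<integral>t. indicator E t * t + indicator (- E) t * t \<partial>vector_measure P x)"
      by (rule Bochner_Integration.integral_add[symmetric]) (use integrable_indicator_id E E' in auto)
    also have "(\<lambda>t::real. indicator E t * t + indicator (- E) t * t) = (\<lambda>t. t)" by (auto simp: indicator_def)
    also have "(\<integral>t. t \<partial>vector_measure P x) = Re (cinner (a x) x)" using form_eq[of x] by simp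
    finally show "Re (cinner (a x) x) = Re (cinner (((p o\<^sub>L (a o\<^sub>L p)) + (p' o\<^sub>L (a o\<^sub>L p'))) x) x)" by simp
  qed (use a_cblinops a_selfadjoint in auto)
  then have ax: "a x = p (a (p x)) + p' (a (p' x))" for x
    by (metis blinfun.add_left blinfun_apply_blinfun_compose)
  have pi: "p (p x) = p x" "p (p' x) = 0" "p' (p x) = 0" for x
    using compose_eq_apply[OF P_idem[OF E]] compose_eq_apply[OF pp(1)] compose_eq_apply[OF pp(2)]
    by (auto simp: p_def)
  have "a (p x) = p (a x)" for x
    using ax[of "p x"] arg_cong[OF ax[of x], of "blinfun_apply p"] by (simp add: pi blinfun.add_right)
  then show ?thesis by (auto intro: blinfun_eqI simp: p_def)
qed

lemma P_commute_apply: "E \<in> sets borel \<Longrightarrow> a (P E x) = P E (a x)"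
  using compose_eq_apply[OF P_commute[of E]] by simp

lemma form_bounds:
  assumes E: "E \<in> sets borel" and x: "P E x = x"
  shows "E \<subseteq> {c..} \<Longrightarrow> c * (norm x)\<^sup>2 \<le> Re (cinner (a x) x)"
    and "E \<subseteq> {..c} \<Longrightarrow> Re (cinner (a x) x) \<le> c * (norm x)\<^sup>2"
proof -
  interpret finite_measure "vector_measure P x" by (rule finite_vector_measure)
  have f: "Re (cinner (a x) x) = (\<integral>t. t \<partial>vector_measure P x)" using form_eq[of x] by simp
  have c: "c * (norm x)\<^sup>2 = (\<integral>t. c \<partial>vector_measure P x)" by (simp add: measure_vector_measure P_UNIV)
  have AE: "AE t in vector_measure P x. t \<in> E" by (rule AE_vector_measure[OF E x])
  show "c * (norm x)\<^sup>2 \<le> Re (cinner (a x) x)" if "E \<subseteq> {c..}"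
    unfolding f c by (rule integral_mono_AE) (use AE that integrable_id in \<open>auto elim: eventually_mono\<close>)
  show "Re (cinner (a x) x) \<le> c * (norm x)\<^sup>2" if "E \<subseteq> {..c}"
    unfolding f c by (rule integral_mono_AE) (use AE that integrable_id in \<open>auto elim: eventually_mono\<close>)
qed

lemma form_radius: "\<bar>Re (cinner (a x) x)\<bar> \<le> radius * (norm x)\<^sup>2"
  using form_bounds(1)[of "{-radius..radius}" x "-radius"] form_bounds(2)[of "{-radius..radius}" x radius] radius by auto

text \<open>An operator commuting with \<open>a\<close> does not mix spectral subspaces over separated sets: with \<open>b = a + R\<close> for the first
  claim and \<open>b = R - a\<close> for the second, \<open>R\<close> being large enough for \<open>b\<close> to be positive, the upper bound of \<open>b\<close> on the
  subspace mapped is below its lower bound on the target.\<close>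

lemma separated_vanish:
  fixes S :: "'h op"
  assumes S: "S o\<^sub>L a = a o\<^sub>L S" and E: "E \<in> sets borel" "E \<subseteq> {..l}" and F: "F \<in> sets borel" "F \<subseteq> {m..}" and lm: "l < m"
  shows "P F o\<^sub>L (S o\<^sub>L P E) = 0" and "P E o\<^sub>L (S o\<^sub>L P F) = 0"
proof -
  define R where "R = radius + \<bar>l\<bar> + \<bar>m\<bar> + 1"
  have R: "0 < R + l" "0 < R - m" "radius \<le> R" using radius by (auto simp: R_def)
  have Sa: "S (a y) = a (S y)" for y using compose_eq_apply[OF S, of y] by simp
  have main: "P B o\<^sub>L (S o\<^sub>L P A) = 0"
    if b: "selfadjoint b" "\<And>x. 0 \<le> Re (cinner (b x) x)" "\<And>D x. D \<in> sets borel \<Longrightarrow> b (P D x) = P D (b x)" "\<And>x. S (b x) = b (S x)"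
      and A: "A \<in> sets borel" "\<And>x. P A x = x \<Longrightarrow> Re (cinner (b x) x) \<le> \<beta> * (norm x)\<^sup>2"
      and B: "B \<in> sets borel" "\<And>x. P B x = x \<Longrightarrow> \<gamma> * (norm x)\<^sup>2 \<le> Re (cinner (b x) x)"
      and \<beta>: "0 < \<beta>" "\<beta> < \<gamma>"
    for b :: "'h op" and A B \<beta> \<gamma>
  proof (rule intertwiner_eq_zero)
    show "(P B o\<^sub>L (S o\<^sub>L P A)) o\<^sub>L b = b o\<^sub>L (P B o\<^sub>L (S o\<^sub>L P A))"
      using b(3,4) A(1) B(1) by (auto intro!: blinfun_eqI) metis
    show "(P B o\<^sub>L (S o\<^sub>L P A)) o\<^sub>L P A = P B o\<^sub>L (S o\<^sub>L P A)"
      by (auto intro!: blinfun_eqI simp: P_apply_apply A)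
    show "P A o\<^sub>L b = b o\<^sub>L P A" using b(3)[OF A(1)] by (auto intro: blinfun_eqI)
    show "norm (P A y) \<le> norm y" for y by (rule P_norm_le[OF A(1)])
    show "norm (b (P A y)) \<le> \<beta> * norm (P A y)" for y
      by (rule norm_apply_le[where V = "{x. P A x = x}" and b = b])
        (use b(1,2) b(3)[OF A(1), symmetric] A \<beta> in \<open>auto simp: P_apply_apply blinfun.diff_right blinfun.scaleR_right\<close>)
    show "\<gamma> * norm ((P B o\<^sub>L (S o\<^sub>L P A)) y) \<le> norm (b ((P B o\<^sub>L (S o\<^sub>L P A)) y))" for y
      by (rule norm_lower_bound, rule B(2)) (simp add: P_apply_apply B(1))
  qed (use \<beta> in auto)
  show "P F o\<^sub>L (S o\<^sub>L P E) = 0"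
  proof (rule main[where b = "a + R *\<^sub>R id_blinfun" and \<beta> = "l + R" and \<gamma> = "m + R"])
    show "selfadjoint (a + R *\<^sub>R id_blinfun)"
      by (intro selfadjoint_add selfadjoint_scaleR selfadjoint_id a_selfadjoint)
    have f: "Re (cinner ((a + R *\<^sub>R id_blinfun) x) x) = Re (cinner (a x) x) + R * (norm x)\<^sup>2" for x
      by (simp add: blinfun.bilinear_simps cinner_add_left cinner_scaleR_left Re_cinner_self)
    show "0 \<le> Re (cinner ((a + R *\<^sub>R id_blinfun) x) x)" for x
      unfolding f using form_radius[of x] mult_right_mono[OF R(3), of "(norm x)\<^sup>2"] by simp
    show "Re (cinner ((a + R *\<^sub>R id_blinfun) x) x) \<le> (l + R) * (norm x)\<^sup>2" if "P E x = x" for x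
      unfolding f using form_bounds(2)[OF E(1) that E(2)] by (simp add: distrib_right)
    show "(m + R) * (norm x)\<^sup>2 \<le> Re (cinner ((a + R *\<^sub>R id_blinfun) x) x)" if "P F x = x" for x
      unfolding f using form_bounds(1)[OF F(1) that F(2)] by (simp add: distrib_right)
  qed (use E F R lm Sa P_commute_apply in \<open>auto simp: blinfun.bilinear_simps add.commute\<close>)
  show "P E o\<^sub>L (S o\<^sub>L P F) = 0"
  proof (rule main[where b = "R *\<^sub>R id_blinfun - a" and \<beta> = "R - m" and \<gamma> = "R - l"])
    show "selfadjoint (R *\<^sub>R id_blinfun - a)"
      by (intro selfadjoint_diff selfadjoint_scaleR selfadjoint_id a_selfadjoint)
    have f: "Re (cinner ((R *\<^sub>R id_blinfun - a) x) x) = R * (norm x)\<^sup>2 - Re (cinner (a x) x)" for x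
      by (simp add: blinfun.bilinear_simps cinner.diff_left cinner_scaleR_left Re_cinner_self)
    show "0 \<le> Re (cinner ((R *\<^sub>R id_blinfun - a) x) x)" for x
      unfolding f using form_radius[of x] mult_right_mono[OF R(3), of "(norm x)\<^sup>2"] by simp
    show "Re (cinner ((R *\<^sub>R id_blinfun - a) x) x) \<le> (R - m) * (norm x)\<^sup>2" if "P F x = x" for x
      unfolding f using form_bounds(1)[OF F(1) that F(2)] by (simp add: left_diff_distrib)
    show "(R - l) * (norm x)\<^sup>2 \<le> Re (cinner ((R *\<^sub>R id_blinfun - a) x) x)" if "P E x = x" for x
      unfolding f using form_bounds(2)[OF E(1) that E(2)] by (simp add: left_diff_distrib)
  qed (use E F R lm Sa P_commute_apply in \<open>auto simp: blinfun.bilinear_simps\<close>)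
qed

text \<open>The closed half-lines \<open>[l + 1/(n+1), \<infinity>)\<close> are separated from \<open>(-\<infinity>, l]\<close> and exhaust its complement, so \<open>S\<close> maps the range of
  \<open>P(-\<infinity>, l]\<close> and its orthogonal complement to themselves.\<close>

lemma P_halfline_bicommutant:
  fixes S :: "'h op"
  assumes S: "S o\<^sub>L a = a o\<^sub>L S"
  shows "S o\<^sub>L P {..l} = P {..l} o\<^sub>L S"
proof -
  define A where "A n = {l + 1 / real (Suc n)..}" for n
  have Ab: "A n \<in> sets borel" for n by (simp add: A_def)
  have inc: "incseq A"
  proof (rule incseq_SucI)
    fix n
    have "1 / real (Suc (Suc n)) \<le> 1 / real (Suc n)" by (simp add: field_simps)
    then show "A n \<subseteq> A (Suc n)" by (auto simp: A_def)
  qed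
  have un: "(\<Union>n. A n) = {l<..}"
  proof
    show "(\<Union>n. A n) \<subseteq> {l<..}"
    proof
      fix t assume "t \<in> (\<Union>n. A n)"
      then obtain n where "l + 1 / real (Suc n) \<le> t" by (auto simp: A_def)
      moreover have "0 < 1 / real (Suc n)" by simp
      ultimately show "t \<in> {l<..}" unfolding greaterThan_iff by linarith
    qed
    show "{l<..} \<subseteq> (\<Union>n. A n)"
    proof
      fix t assume "t \<in> {l<..}"
      then have "0 < t - l" by simp
      then obtain n where "1 / real (Suc n) < t - l" using nat_approx_posE by blast
      then show "t \<in> (\<Union>n. A n)" by (auto simp: A_def intro!: exI[of _ n])
    qed
  qed
  have lim: "(\<lambda>n. P (A n) z) \<longlonglongrightarrow> P {l<..} z" for z
    using P_incseq[OF Ab inc, of z] by (simp add: un)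
  have sep: "P (A n) o\<^sub>L (S o\<^sub>L P {..l}) = 0" "P {..l} o\<^sub>L (S o\<^sub>L P (A n)) = 0" for n
    by (rule separated_vanish[OF S, where l = l and m = "l + 1 / real (Suc n)"]; simp add: A_def)+
  have 1: "P {l<..} (S (P {..l} z)) = 0" for z
    using lim[of "S (P {..l} z)"] compose_eq_apply[OF sep(1), of _ z] by (simp add: LIMSEQ_const_iff)
  have 2: "P {..l} (S (P {l<..} z)) = 0" for z
  proof -
    have "(\<lambda>n. P {..l} (S (P (A n) z))) \<longlonglongrightarrow> P {..l} (S (P {l<..} z))"
      by (intro blinfun.tendsto tendsto_const lim)
    then show ?thesis using compose_eq_apply[OF sep(2), of _ z] by (simp add: LIMSEQ_const_iff)
  qed
  have "- {..l} = {l<..}" by auto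
  then have c: "P {l<..} = id_blinfun - P {..l}" using P_compl[of "{..l}"] by simp
  show ?thesis
  proof (rule blinfun_eqI)
    fix z
    show "(S o\<^sub>L P {..l}) z = (P {..l} o\<^sub>L S) z"
      using 1[of z] 2[of z] by (simp add: c blinfun.bilinear_simps)
  qed
qed

theorem P_bicommutant:
  fixes S :: "'h op"
  assumes S: "S o\<^sub>L a = a o\<^sub>L S" and E: "E \<in> sets borel"
  shows "S o\<^sub>L P E = P E o\<^sub>L S"
  using E
proof (induction rule: borel_real_induct_disjoint)
  case (atMost l) show ?case by (rule P_halfline_bicommutant[OF S])
next
  case empty show ?case by (simp add: P_empty)
next
  case (compl A)
  show ?case using compl(2) unfolding P_compl[OF compl(1)]
    by (simp add: blinfun_compose.diff_left blinfun_compose.diff_right)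
next
  case (union A)
  note A = union(2)
  show ?case
  proof (rule blinfun_eqI)
    fix x
    have "(\<lambda>n. S (P (A n) x)) sums S (P (\<Union>n. A n) x)"
      by (intro bounded_linear.sums[OF blinfun.bounded_linear_right] P_sums A union)
    moreover have "S (P (A n) x) = P (A n) (S x)" for n using compose_eq_apply[OF union(3), of n x] by simp
    moreover have "(\<lambda>n. P (A n) (S x)) sums P (\<Union>n. A n) (S x)" by (rule P_sums[OF A union(1)])
    ultimately show "(S o\<^sub>L P (\<Union>n. A n)) x = (P (\<Union>n. A n) o\<^sub>L S) x" using sums_unique2 by auto
  qed
qed

text \<open>Rounding down to multiples of \<open>1/(n+1)\<close> gives simple functions of \<open>a\<close> that converge to \<open>a\<close> in norm. They reduce the trace
  of \<open>a\<close> against spectral projections to the traces of these projections. The index set is enlarged by one on each side so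
  that every point of the support lies in one of the cells.\<close>

definition steps :: "nat \<Rightarrow> int set" where
  "steps n = {- \<lceil>radius * real (Suc n)\<rceil> - 1..\<lceil>radius * real (Suc n)\<rceil> + 1}"

definition cell :: "nat \<Rightarrow> int \<Rightarrow> real set" where
  "cell n i = {t. \<lfloor>real (Suc n) * t\<rfloor> = i}"

definition round_fun :: "nat \<Rightarrow> real \<Rightarrow> real" where
  "round_fun n t = (\<Sum>i\<in>steps n. (real_of_int i / real (Suc n)) * indicator (cell n i) t)"

definition round_op :: "nat \<Rightarrow> 'h op" where
  "round_op n = (\<Sum>i\<in>steps n. (real_of_int i / real (Suc n)) *\<^sub>R P (cell n i))"

lemma cell_borel [measurable]: "cell n i \<in> sets borel"
proof -
  have "cell n i = {t \<in> space borel. \<lfloor>real (Suc n) * t\<rfloor> = i}" by (simp add: cell_def)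
  also have "\<dots> \<in> sets borel" by measurable
  finally show ?thesis .
qed

lemma finite_steps: "finite (steps n)"
  by (simp add: steps_def)

lemma round_fun_measurable [measurable]: "round_fun n \<in> borel_measurable borel"
  unfolding round_fun_def[abs_def] by measurable

lemma round_fun_bounds:
  assumes "\<bar>t\<bar> \<le> radius"
  shows "0 \<le> t - round_fun n t" "t - round_fun n t \<le> 1 / real (Suc n)"
proof -
  define i where "i = \<lfloor>real (Suc n) * t\<rfloor>"
  have b: "\<bar>real (Suc n) * t\<bar> \<le> radius * real (Suc n)" using assms by (simp add: abs_mult mult.commute)
  have i: "real_of_int i \<le> real (Suc n) * t" "real (Suc n) * t < real_of_int i + 1" unfolding i_def by linarith+
  have "i \<in> steps n" unfolding steps_def i_def using b by (auto, linarith+)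
  have "round_fun n t = (\<Sum>j\<in>steps n. if j = i then real_of_int i / real (Suc n) else 0)"
    unfolding round_fun_def by (rule sum.cong) (auto simp: cell_def i_def indicator_def)
  also have "\<dots> = real_of_int i / real (Suc n)" using \<open>i \<in> steps n\<close> finite_steps by simp
  finally have r: "round_fun n t = real_of_int i / real (Suc n)" .
  have "real_of_int i / real (Suc n) \<le> t" using i(1) by (simp add: divide_le_eq mult.commute)
  then show "0 \<le> t - round_fun n t" unfolding r by simp
  have "t \<le> (real_of_int i + 1) / real (Suc n)" using i(2) by (simp add: le_divide_eq mult.commute)
  then show "t - round_fun n t \<le> 1 / real (Suc n)" unfolding r by (simp add: add_divide_distrib)
qed

text \<open>The form of \<open>a - round_op n\<close> is the integral of a function with values between \<open>0\<close> and \<open>1/(n+1)\<close> on the support.\<close>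

lemma round_op_norm: "norm (a x - round_op n x) \<le> 1 / real (Suc n) * norm x"
proof -
  have "norm ((a - round_op n) x) \<le> 1 / real (Suc n) * norm x"
  proof (rule norm_apply_le[where V = UNIV])
    have "selfadjoint (round_op n)"
      unfolding round_op_def using finite_steps
      by (induction rule: finite_induct)
        (auto simp: selfadjoint_def is_adjoint_def cinner.zero_left cinner.zero_right
          intro!: selfadjoint_add[unfolded selfadjoint_def is_adjoint_def, rule_format]
            selfadjoint_scaleR[unfolded selfadjoint_def is_adjoint_def, rule_format]
            P_selfadjoint[unfolded selfadjoint_def is_adjoint_def, rule_format] cell_borel)
    then show "selfadjoint (a - round_op n)" by (rule selfadjoint_diff[OF a_selfadjoint])
    fix y :: 'h
    interpret finite_measure "vector_measure P y" by (rule finite_vector_measure)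
    have ir: "integrable (vector_measure P y) (round_fun n)"
    proof (rule integrable_bounded_on_support)
      fix t assume t: "\<bar>t\<bar> \<le> radius"
      have "1 / real (Suc n) \<le> 1" by simp
      then show "\<bar>round_fun n t\<bar> \<le> radius + 1" using round_fun_bounds[OF t, of n] t by linarith
    qed simp
    have "Re (cinner (round_op n y) y) = (\<Sum>i\<in>steps n. (real_of_int i / real (Suc n)) * measure (vector_measure P y) (cell n i))"
      unfolding round_op_def
      by (simp add: blinfun.sum_left cinner.sum_left blinfun.scaleR_left cinner_scaleR_left P_form measure_vector_measure flip: of_real_power)
    also have "\<dots> = (\<integral>t. round_fun n t \<partial>vector_measure P y)"
    proof -
      have "integrable (vector_measure P y) (\<lambda>t. real_of_int i / real (Suc n) * indicator (cell n i) t)" for i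
        by (intro integrable_mult_right integrable_real_indicator) (auto simp: emeasure_vector_measure less_top)
      then show ?thesis unfolding round_fun_def by (subst Bochner_Integration.integral_sum) auto
    qed
    finally have "Re (cinner ((a - round_op n) y) y) = (\<integral>t. t - round_fun n t \<partial>vector_measure P y)"
      using form_eq[of y] integrable_id ir by (simp add: blinfun.diff_left cinner.diff_left)
    moreover have "0 \<le> (\<integral>t. t - round_fun n t \<partial>vector_measure P y)"
      by (rule integral_nonneg_AE) (use AE_radius[of y] round_fun_bounds in \<open>auto elim: eventually_mono\<close>)
    moreover have "(\<integral>t. t - round_fun n t \<partial>vector_measure P y) \<le> (\<integral>t. 1 / real (Suc n) \<partial>vector_measure P y)"
      by (rule integral_mono_AE) (use AE_radius[of y] round_fun_bounds integrable_id ir in \<open>auto elim: eventually_mono\<close>)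
    moreover have "(\<integral>t. 1 / real (Suc n) \<partial>vector_measure P y) = 1 / real (Suc n) * (norm y)\<^sup>2"
      by (simp add: measure_vector_measure P_UNIV)
    ultimately show "0 \<le> Re (cinner ((a - round_op n) y) y) \<and>
       Re (cinner ((a - round_op n) y) y) \<le> 1 / real (Suc n) * (norm y)\<^sup>2" by linarith
  qed auto
  then show ?thesis by (simp add: blinfun.diff_left)
qed

end

section \<open>Normal traces\<close>

lemma blinfun_compose_assoc: "(x o\<^sub>L y) o\<^sub>L z = x o\<^sub>L (y o\<^sub>L z)"
  by (rule blinfun_eqI) simp

text \<open>Dominated convergence for series: the terms are bounded by \<open>|C| (\<parallel>\<xi>\<^sub>k\<parallel>\<^sup>2 + \<parallel>\<eta>\<^sub>k\<parallel>\<^sup>2)\<close>.\<close>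

lemma ultraweak_series_tendsto:
  fixes T :: "nat \<Rightarrow> 'h::complex_hilbert op"
  assumes lim: "\<And>x. (\<lambda>n. T n x) \<longlonglongrightarrow> blinfun_apply Q x" and bd: "\<And>n x. norm (T n x) \<le> C * norm x"
    and \<xi>: "summable (\<lambda>k. (norm (\<xi> k))\<^sup>2)" and \<eta>: "summable (\<lambda>k. (norm (\<eta> k))\<^sup>2)"
  shows "(\<lambda>n. \<Sum>k. cinner (T n (\<xi> k)) (\<eta> k)) \<longlonglongrightarrow> (\<Sum>k. cinner (Q (\<xi> k)) (\<eta> k))"
proof -
  define M where "M k = \<bar>C\<bar> * ((norm (\<xi> k))\<^sup>2 + (norm (\<eta> k))\<^sup>2)" for k
  have "cmod (cinner (T n (\<xi> k)) (\<eta> k)) \<le> M k" for n k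
  proof -
    have "cmod (cinner (T n (\<xi> k)) (\<eta> k)) \<le> norm (T n (\<xi> k)) * norm (\<eta> k)" by (rule cinner_cauchy_schwarz)
    also have "\<dots> \<le> (\<bar>C\<bar> * norm (\<xi> k)) * norm (\<eta> k)"
      using order_trans[OF bd[of n "\<xi> k"] mult_right_mono[OF abs_ge_self[of C] norm_ge_zero]]
      by (intro mult_right_mono) auto
    also have "\<dots> \<le> M k"
    proof -
      have "norm (\<xi> k) * norm (\<eta> k) \<le> (norm (\<xi> k))\<^sup>2 + (norm (\<eta> k))\<^sup>2"
      proof -
        have "2 * (norm (\<xi> k) * norm (\<eta> k)) \<le> (norm (\<xi> k))\<^sup>2 + (norm (\<eta> k))\<^sup>2"
          using sum_squares_bound[of "norm (\<xi> k)" "norm (\<eta> k)"] by (simp only: mult.assoc)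
        moreover have "0 \<le> norm (\<xi> k) * norm (\<eta> k)" by simp
        ultimately show ?thesis by linarith
      qed
      then show ?thesis unfolding M_def mult.assoc by (intro mult_left_mono) auto
    qed
    finally show ?thesis .
  qed
  then have "eventually (\<lambda>(k, n). norm (cinner (T n (\<xi> k)) (\<eta> k)) \<le> M k) (at_top \<times>\<^sub>F sequentially)"
    by (intro always_eventually) auto
  moreover have "summable M" unfolding M_def by (intro summable_mult summable_add \<xi> \<eta>)
  moreover have "(\<lambda>n. cinner (T n (\<xi> k)) (\<eta> k)) \<longlonglongrightarrow> cinner (Q (\<xi> k)) (\<eta> k)" for k
    by (intro cinner.tendsto lim tendsto_const)
  ultimately show ?thesis
    using tannerys_theorem[of "\<lambda>k n. cinner (T n (\<xi> k)) (\<eta> k)" "\<lambda>k. cinner (Q (\<xi> k)) (\<eta> k)" sequentially M] by simp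
qed

text \<open>Convergence in a generated topology has to be tested on the generating sets only.\<close>

lemma limitin_ultraweak:
  fixes T :: "nat \<Rightarrow> 'h::complex_hilbert op"
  assumes lim: "\<And>x. (\<lambda>n. T n x) \<longlonglongrightarrow> blinfun_apply Q x" and bd: "\<And>n x. norm (T n x) \<le> C * norm x"
    and cb: "\<And>n. T n \<in> cblinops" "Q \<in> cblinops"
  shows "limitin ultraweak_topology T Q sequentially"
proof -
  define B :: "'h op set set" where "B = {{T \<in> cblinops. (\<Sum>n. cinner (blinfun_apply T (\<xi> n)) (\<eta> n)) \<in> U} | \<xi> \<eta> U.
        summable (\<lambda>n. (norm (\<xi> n))\<^sup>2) \<and> summable (\<lambda>n. (norm (\<eta> n))\<^sup>2) \<and> open U}"
  have uw: "ultraweak_topology = topology_generated_by B" unfolding B_def ultraweak_topology_def ..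
  have basis: "\<forall>\<^sub>F n in sequentially. T n \<in> W" if WB: "W \<in> B" and QW: "Q \<in> W" for W
  proof -
    obtain \<xi> \<eta> U where W: "W = {T \<in> cblinops. (\<Sum>n. cinner (blinfun_apply T (\<xi> n)) (\<eta> n)) \<in> U}"
      and s: "summable (\<lambda>n. (norm (\<xi> n))\<^sup>2)" "summable (\<lambda>n. (norm (\<eta> n))\<^sup>2)" and U: "open U"
      using WB unfolding B_def by blast
    have "\<forall>\<^sub>F n in sequentially. (\<Sum>k. cinner (T n (\<xi> k)) (\<eta> k)) \<in> U"
      using topological_tendstoD[OF ultraweak_series_tendsto[OF lim bd s] U] QW by (simp add: W)
    then show ?thesis by (simp add: W cb)
  qed
  have "{T \<in> cblinops. (\<Sum>n. cinner (blinfun_apply T ((\<lambda>_. 0) n)) ((\<lambda>_. 0) n)) \<in> UNIV} \<in> B"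
    unfolding B_def by (intro CollectI exI[of _ "\<lambda>_. 0"] exI[of _ UNIV]) (auto intro!: exI[of _ "\<lambda>_. 0"])
  then have "Q \<in> topspace ultraweak_topology" unfolding uw topology_generated_by_topspace using cb(2) by blast
  moreover have "\<forall>\<^sub>F n in sequentially. T n \<in> W" if "openin ultraweak_topology W" "Q \<in> W" for W
  proof -
    have "generate_topology_on B W" using that(1) unfolding uw openin_topology_generated_by_iff .
    then show ?thesis using that(2)
    proof (induction rule: generate_topology_on.induct)
      case (Int a b) then show ?case by (auto elim: eventually_elim2)
    next
      case (UN K)
      then obtain k where k: "k \<in> K" "Q \<in> k" by blast
      show ?case using UN(2)[OF k] k(1) by (auto elim!: eventually_mono)
    qed (use basis in auto)
  qed
  ultimately show ?thesis by (auto simp: limitin_def)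
qed

locale tracial_algebra =
  fixes M :: "'h::complex_hilbert op set" and \<tau> :: "'h op \<Rightarrow> complex"
  assumes vna: "von_neumann_algebra M" and trace: "faithful_normal_tracial_state M \<tau>"
begin

lemma M_bicommutant: "commutant (commutant M) = M"
  using vna by (simp add: von_neumann_algebra_def)

lemma M_iff: "x \<in> M \<longleftrightarrow> x \<in> cblinops \<and> (\<forall>S\<in>commutant M. x o\<^sub>L S = S o\<^sub>L x)"
proof -
  have "x \<in> M \<longleftrightarrow> x \<in> commutant (commutant M)" by (simp only: M_bicommutant)
  also have "\<dots> \<longleftrightarrow> x \<in> cblinops \<and> (\<forall>S\<in>commutant M. x o\<^sub>L S = S o\<^sub>L x)" unfolding commutant_def[of "commutant M"] by auto
  finally show ?thesis .
qed

lemma M_cblinops: "x \<in> M \<Longrightarrow> x \<in> cblinops"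
  by (simp add: M_iff)

lemma M_id: "id_blinfun \<in> M"
  by (simp add: M_iff cblinops_id)

lemma M_zero: "0 \<in> M"
  by (simp add: M_iff cblinops_zero)

lemma M_add: "x \<in> M \<Longrightarrow> y \<in> M \<Longrightarrow> x + y \<in> M"
  by (simp add: M_iff cblinops_add blinfun_compose.add_left blinfun_compose.add_right)

lemma M_scaleR: "x \<in> M \<Longrightarrow> r *\<^sub>R x \<in> M"
  by (simp add: M_iff cblinops_scaleR blinfun_compose.scaleR_left blinfun_compose.scaleR_right)

lemma M_diff: "x \<in> M \<Longrightarrow> y \<in> M \<Longrightarrow> x - y \<in> M"
  using M_add[of x "(-1) *\<^sub>R y"] M_scaleR[of y "-1"] by simp

lemma M_compose: assumes "x \<in> M" "y \<in> M" shows "x o\<^sub>L y \<in> M"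
  unfolding M_iff
proof (intro conjI ballI)
  show "x o\<^sub>L y \<in> cblinops" using assms by (intro cblinops_compose M_cblinops)
  fix S assume S: "S \<in> commutant M"
  have "x o\<^sub>L S = S o\<^sub>L x" "y o\<^sub>L S = S o\<^sub>L y" using assms S by (auto simp: M_iff)
  then show "(x o\<^sub>L y) o\<^sub>L S = S o\<^sub>L (x o\<^sub>L y)" by (metis blinfun_compose_assoc)
qed

lemma M_sum: "finite I \<Longrightarrow> (\<And>i. i \<in> I \<Longrightarrow> f i \<in> M) \<Longrightarrow> sum f I \<in> M"
  by (induction I rule: finite_induct) (auto simp: M_zero M_add)

lemma M_limit:
  assumes T: "\<And>n. T n \<in> M" and Q: "Q \<in> cblinops" and lim: "\<And>x. (\<lambda>n. blinfun_apply (T n) x) \<longlonglongrightarrow> blinfun_apply Q x"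
  shows "Q \<in> M"
  unfolding M_iff
proof (intro conjI ballI blinfun_eqI Q)
  fix S x assume S: "S \<in> commutant M"
  have "T n (S x) = S (T n x)" for n
    using compose_eq_apply[of "T n" S "S o\<^sub>L T n" x] T[of n] S by (auto simp: M_iff)
  moreover have "(\<lambda>n. S (T n x)) \<longlonglongrightarrow> S (Q x)" by (intro blinfun.tendsto tendsto_const lim)
  ultimately show "(Q o\<^sub>L S) x = (S o\<^sub>L Q) x" using lim[of "S x"] LIMSEQ_unique by auto
qed

lemma trace_predual: "\<tau> \<in> predual M" and trace_id: "\<tau> id_blinfun = 1"
  and trace_pos: "x \<in> M \<Longrightarrow> y \<in> M \<Longrightarrow> is_adjoint y x \<Longrightarrow> \<tau> (y o\<^sub>L x) \<in> \<real> \<and> 0 \<le> Re (\<tau> (y o\<^sub>L x))"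
  and trace_commute: "x \<in> M \<Longrightarrow> y \<in> M \<Longrightarrow> \<tau> (x o\<^sub>L y) = \<tau> (y o\<^sub>L x)"
  using trace by (auto simp: faithful_normal_tracial_state_def)

lemma trace_add: "x \<in> M \<Longrightarrow> y \<in> M \<Longrightarrow> \<tau> (x + y) = \<tau> x + \<tau> y"
  using trace_predual by (simp add: predual_def)

lemma trace_scaleR: "x \<in> M \<Longrightarrow> \<tau> (r *\<^sub>R x) = of_real r * \<tau> x"
  using trace_predual scalar_op_compose_of_real[of r x] unfolding predual_def by (metis (mono_tags, lifting) mem_Collect_eq)

lemma trace_zero: "\<tau> 0 = 0"
  using trace_scaleR[OF M_zero, of 0] by simp

lemma trace_diff: "x \<in> M \<Longrightarrow> y \<in> M \<Longrightarrow> \<tau> (x - y) = \<tau> x - \<tau> y"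
  using trace_add[of "x - y" y] M_diff[of x y] by simp

lemma trace_sum: "finite I \<Longrightarrow> (\<And>i. i \<in> I \<Longrightarrow> f i \<in> M) \<Longrightarrow> \<tau> (sum f I) = (\<Sum>i\<in>I. \<tau> (f i))"
  by (induction I rule: finite_induct) (auto simp: trace_zero trace_add M_sum)

text \<open>The form in which normality of the trace is used.\<close>

lemma trace_limit:
  assumes T: "\<And>n. T n \<in> M" and Q: "Q \<in> M" and lim: "\<And>x. (\<lambda>n. blinfun_apply (T n) x) \<longlonglongrightarrow> blinfun_apply Q x"
    and bd: "\<And>n x. norm (blinfun_apply (T n) x) \<le> C * norm x"
  shows "(\<lambda>n. \<tau> (T n)) \<longlonglongrightarrow> \<tau> Q"
proof -
  have "limitin (subtopology ultraweak_topology M) T Q sequentially"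
    unfolding limitin_subtopology using T Q limitin_ultraweak[OF lim bd M_cblinops[OF T] M_cblinops[OF Q]] by simp
  moreover have "continuous_map (subtopology ultraweak_topology M) euclidean \<tau>"
    using trace_predual by (simp add: predual_def)
  ultimately have "limitin euclidean (\<tau> \<circ> T) (\<tau> Q) sequentially" by (rule continuous_map_limit[rotated])
  then show ?thesis by (simp add: o_def)
qed

subsection \<open>Projections of the algebra\<close>

lemma projections_M: "p \<in> projections M \<longleftrightarrow> p \<in> M \<and> p o\<^sub>L p = p \<and> selfadjoint p"
  by (simp add: projections_def)

lemma projection_id: "id_blinfun \<in> projections M"
  by (simp add: projections_M M_id selfadjoint_id)

lemma projection_zero: "0 \<in> projections M"
  by (simp add: projections_M M_zero selfadjoint_def is_adjoint_def cinner.zero_left cinner.zero_right)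

lemma projection_diff:
  assumes p: "p \<in> projections M" and q: "q \<in> projections M" and le: "p o\<^sub>L q = q"
  shows "p - q \<in> projections M" "p o\<^sub>L (p - q) = p - q" "q o\<^sub>L (p - q) = 0" "(p - q) o\<^sub>L q = 0"
proof -
  have p': "p \<in> M" "p o\<^sub>L p = p" "selfadjoint p" and q': "q \<in> M" "q o\<^sub>L q = q" "selfadjoint q"
    using p q by (auto simp: projections_M)
  have qp: "q o\<^sub>L p = q" by (rule projection_compose_commute[OF p'(3) q'(3) le])
  note bil = blinfun_compose.diff_left blinfun_compose.diff_right
  show "p - q \<in> projections M"
    unfolding projections_M using p' q' qp le by (auto simp: bil M_diff selfadjoint_diff)
  show "p o\<^sub>L (p - q) = p - q" "q o\<^sub>L (p - q) = 0" "(p - q) o\<^sub>L q = 0" using p' q' qp le by (auto simp: bil)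
qed

lemma projection_compl: "q \<in> projections M \<Longrightarrow> id_blinfun - q \<in> projections M"
  by (rule projection_diff(1)[OF projection_id]) auto

lemma op_le_iff: "p \<in> projections M \<Longrightarrow> q \<in> projections M \<Longrightarrow> op_le q p \<longleftrightarrow> p o\<^sub>L q = q"
  by (rule op_le_projections) (auto simp: projections_M)

text \<open>By the trace property \<open>\<tau>(pq) = \<tau>(pqqp)\<close>, which is the trace of \<open>x\<^sup>*x\<close> for \<open>x = qp\<close>.\<close>

lemma trace_compose_projections:
  assumes p: "p \<in> projections M" and q: "q \<in> projections M"
  shows "\<tau> (p o\<^sub>L q) \<in> \<real>" "0 \<le> Re (\<tau> (p o\<^sub>L q))"
proof -
  have p': "p \<in> M" "p o\<^sub>L p = p" "selfadjoint p" and q': "q \<in> M" "q o\<^sub>L q = q" "selfadjoint q"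
    using p q by (auto simp: projections_M)
  have "is_adjoint (p o\<^sub>L q) (q o\<^sub>L p)"
    using is_adjoint_compose[of q q p p] p' q' by (simp add: selfadjoint_def)
  then have *: "\<tau> ((p o\<^sub>L q) o\<^sub>L (q o\<^sub>L p)) \<in> \<real> \<and> 0 \<le> Re (\<tau> ((p o\<^sub>L q) o\<^sub>L (q o\<^sub>L p)))"
    using p' q' by (intro trace_pos M_compose)
  have "(p o\<^sub>L q) o\<^sub>L (q o\<^sub>L p) = p o\<^sub>L (q o\<^sub>L p)"
    using q'(2) by (metis blinfun_compose_assoc)
  also have "\<tau> \<dots> = \<tau> ((q o\<^sub>L p) o\<^sub>L p)" by (rule trace_commute) (use p' q' M_compose in auto)
  also have "(q o\<^sub>L p) o\<^sub>L p = q o\<^sub>L p" using p'(2) by (metis blinfun_compose_assoc)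
  also have "\<tau> (q o\<^sub>L p) = \<tau> (p o\<^sub>L q)" by (rule trace_commute) (use p' q' in auto)
  finally show "\<tau> (p o\<^sub>L q) \<in> \<real>" "0 \<le> Re (\<tau> (p o\<^sub>L q))" using * by auto
qed

lemma trace_projection_nonneg: "q \<in> projections M \<Longrightarrow> 0 \<le> Re (\<tau> q)"
  using trace_compose_projections(2)[OF projection_id, of q] by simp

lemma trace_projection_mono:
  assumes "p \<in> projections M" "q \<in> projections M" "p o\<^sub>L q = q" shows "Re (\<tau> q) \<le> Re (\<tau> p)"
  using trace_projection_nonneg[OF projection_diff(1)[OF assms]] assms trace_diff[of p q] by (simp add: projections_M)

text \<open>Here \<open>d - d\<^sup>3 = rsr - srs\<close>. As \<open>z\<close> commutes with both projections, cyclicity of the trace gives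
  \<open>\<tau>(zrsr) = \<tau>(zrs) = \<tau>(zsrs)\<close>.\<close>

lemma trace_odd_power_step:
  assumes r: "r \<in> projections M" and s: "s \<in> projections M" and z: "z \<in> M" "z o\<^sub>L r = r o\<^sub>L z" "z o\<^sub>L s = s o\<^sub>L z"
  defines "d \<equiv> r - s"
  shows "\<tau> (z o\<^sub>L (d o\<^sub>L (d o\<^sub>L d))) = \<tau> (z o\<^sub>L d)"
proof -
  have r': "r \<in> M" "r o\<^sub>L r = r" and s': "s \<in> M" "s o\<^sub>L s = s"
    using r s by (auto simp: projections_M)
  note [simp] = compose_eq_apply[OF r'(2)] compose_eq_apply[OF s'(2)]
  have ddd: "d o\<^sub>L (d o\<^sub>L d) = d - (r o\<^sub>L (s o\<^sub>L r)) + (s o\<^sub>L (r o\<^sub>L s))"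
    by (rule blinfun_eqI) (simp add: d_def blinfun.bilinear_simps algebra_simps)
  have dM: "d \<in> M" using r' s' by (simp add: d_def M_diff)
  have rs: "r o\<^sub>L (s o\<^sub>L r) \<in> M" "s o\<^sub>L (r o\<^sub>L s) \<in> M" using r' s' by (auto intro: M_compose)
  have "z o\<^sub>L (d o\<^sub>L (d o\<^sub>L d)) = ((z o\<^sub>L d) - (z o\<^sub>L (r o\<^sub>L (s o\<^sub>L r)))) + (z o\<^sub>L (s o\<^sub>L (r o\<^sub>L s)))"
    unfolding ddd by (rule blinfun_eqI) (simp add: blinfun.bilinear_simps)
  then have "\<tau> (z o\<^sub>L (d o\<^sub>L (d o\<^sub>L d))) = \<tau> (z o\<^sub>L d) - \<tau> (z o\<^sub>L (r o\<^sub>L (s o\<^sub>L r))) + \<tau> (z o\<^sub>L (s o\<^sub>L (r o\<^sub>L s)))"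
    using z dM rs by (simp add: trace_add trace_diff M_compose M_diff)
  moreover have "\<tau> (z o\<^sub>L (r o\<^sub>L (s o\<^sub>L r))) = \<tau> (z o\<^sub>L (r o\<^sub>L s))"
  proof -
    have "\<tau> (z o\<^sub>L (r o\<^sub>L (s o\<^sub>L r))) = \<tau> ((z o\<^sub>L (r o\<^sub>L s)) o\<^sub>L r)" by (simp add: blinfun_compose_assoc)
    also have "\<dots> = \<tau> (r o\<^sub>L (z o\<^sub>L (r o\<^sub>L s)))" by (rule trace_commute) (use z r' s' M_compose in auto)
    also have "r o\<^sub>L (z o\<^sub>L (r o\<^sub>L s)) = z o\<^sub>L (r o\<^sub>L s)"
      using z(2) r'(2) by (metis blinfun_compose_assoc)
    finally show ?thesis .
  qed
  moreover have "\<tau> (z o\<^sub>L (s o\<^sub>L (r o\<^sub>L s))) = \<tau> (z o\<^sub>L (r o\<^sub>L s))"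
  proof -
    have "\<tau> (z o\<^sub>L (s o\<^sub>L (r o\<^sub>L s))) = \<tau> ((z o\<^sub>L (s o\<^sub>L r)) o\<^sub>L s)" by (simp add: blinfun_compose_assoc)
    also have "\<dots> = \<tau> (s o\<^sub>L (z o\<^sub>L (s o\<^sub>L r)))" by (rule trace_commute) (use z r' s' M_compose in auto)
    also have "s o\<^sub>L (z o\<^sub>L (s o\<^sub>L r)) = (z o\<^sub>L s) o\<^sub>L r"
      using z(3) s'(2) by (metis blinfun_compose_assoc)
    also have "\<tau> \<dots> = \<tau> (r o\<^sub>L (z o\<^sub>L s))" by (rule trace_commute) (use z r' s' M_compose in auto)
    also have "r o\<^sub>L (z o\<^sub>L s) = z o\<^sub>L (r o\<^sub>L s)" using z(2) by (metis blinfun_compose_assoc)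
    finally show ?thesis .
  qed
  ultimately show ?thesis by simp
qed

end

text \<open>The sequence \<open>s\<^sub>n = \<parallel>d\<^sup>n x\<parallel>\<^sup>2 = \<langle>d\<^bsup>2n\<^esup>x, x\<rangle>\<close> decreases, hence converges, and
  \<open>\<parallel>d\<^bsup>2n\<^esup>x - d\<^bsup>2m\<^esup>x\<parallel>\<^sup>2 = s\<^bsub>2n\<^esub> - 2 s\<^bsub>n+m\<^esub> + s\<^bsub>2m\<^esub>\<close> tends to \<open>0\<close>. The limit \<open>e\<close> satisfies
  \<open>\<parallel>ex\<parallel>\<^sup>2 = lim s\<^sub>n = \<langle>ex,x\<rangle>\<close>.\<close>

lemma contraction_even_powers:
  fixes d :: "'h::complex_hilbert op"
  assumes cb: "d \<in> cblinops" and sa: "selfadjoint d" and contr: "\<And>x. norm (d x) \<le> norm x"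
  obtains e where "e \<in> projections cblinops" "\<And>x. (\<lambda>n. (blinfun_apply d ^^ (2 * n)) x) \<longlonglongrightarrow> blinfun_apply e x"
proof -
  define D where "D n x = (blinfun_apply d ^^ n) x" for n x
  have D0: "D 0 x = x" and DSuc: "D (Suc n) x = d (D n x)" for n x by (auto simp: D_def)
  have Dadd: "D (m + n) x = D m (D n x)" for m n x by (simp add: D_def funpow_add)
  have Dsa: "cinner (D n x) y = cinner x (D n y)" for n x y
  proof (induction n arbitrary: x y)
    case (Suc n)
    have "D (Suc n) x = D n (d x)" using Dadd[of n 1 x] by (simp add: D_def)
    then show ?case using Suc[of "d x" y] selfadjointD[OF sa, of x "D n y"] by (simp add: DSuc)
  qed (simp add: D0)
  define s where "s x n = (norm (D n x))\<^sup>2" for x n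
  have form: "Re (cinner (D (m + n) x) x) = Re (cinner (D m x) (D n x))" for m n x
    using Dsa[of n "D m x" x] Dadd[of n m x] by (simp add: add.commute)
  have s_form: "Re (cinner (D (2 * n) x) x) = s x n" for n x
    using form[of n n x] by (simp add: s_def Re_cinner_self mult_2)
  have dec: "decseq (s x)" for x
    unfolding s_def by (rule decseq_SucI) (simp add: DSuc contr power_mono)
  have "convergent (s x)" for x
    using decseq_convergent[OF dec, of 0 x] by (auto simp: s_def convergent_def)
  then obtain L where L: "\<And>x. s x \<longlonglongrightarrow> L x" unfolding convergent_def by metis
  have sq: "(norm (D (2 * n) x - D (2 * m) x))\<^sup>2 = s x (2 * n) - 2 * s x (n + m) + s x (2 * m)" for n m x
  proof -
    have "Re (cinner (D (2 * n) x) (D (2 * m) x)) = s x (n + m)"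
      using form[of "2 * n" "2 * m" x] s_form[of "n + m" x] by (simp add: algebra_simps)
    then show ?thesis using norm_add_square[of "D (2 * n) x" "- D (2 * m) x"] by (simp add: s_def cinner.minus_right)
  qed
  have cau: "Cauchy (\<lambda>n. D (2 * n) x)" for x
  proof (rule metric_CauchyI)
    fix \<epsilon> :: real assume \<epsilon>: "0 < \<epsilon>"
    have "\<forall>\<^sub>F n in sequentially. \<bar>s x n - L x\<bar> < \<epsilon>\<^sup>2 / 4"
      using tendstoD[OF L[of x], of "\<epsilon>\<^sup>2 / 4"] \<epsilon> by (simp add: dist_real_def)
    then obtain N where N: "\<And>n. n \<ge> N \<Longrightarrow> \<bar>s x n - L x\<bar> < \<epsilon>\<^sup>2 / 4" unfolding eventually_sequentially by blast
    have "norm (D (2 * n) x - D (2 * m) x) < \<epsilon>" if "n \<ge> N" "m \<ge> N" for n m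
    proof -
      have "\<bar>s x (2 * n) - L x\<bar> < \<epsilon>\<^sup>2 / 4" "\<bar>s x (n + m) - L x\<bar> < \<epsilon>\<^sup>2 / 4" "\<bar>s x (2 * m) - L x\<bar> < \<epsilon>\<^sup>2 / 4"
        using that by (intro N; simp)+
      then have "(norm (D (2 * n) x - D (2 * m) x))\<^sup>2 < \<epsilon>\<^sup>2" unfolding sq by linarith
      then show ?thesis using \<epsilon> by (simp add: power2_less_imp_less)
    qed
    then show "\<exists>N. \<forall>n\<ge>N. \<forall>m\<ge>N. dist (D (2 * n) x) (D (2 * m) x) < \<epsilon>" by (auto simp: dist_norm)
  qed
  define T where "T n = (((o\<^sub>L) (d o\<^sub>L d)) ^^ n) id_blinfun" for n
  have T: "blinfun_apply (T n) x = D (2 * n) x" for n x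
    by (induction n) (auto simp: T_def D0 DSuc)
  have Tcb: "T n \<in> cblinops" for n
    by (induction n) (auto simp: T_def cblinops_id intro!: cblinops_compose cb)
  have Tsa: "selfadjoint (T n)" for n
    by (simp add: selfadjoint_def is_adjoint_def T Dsa)
  have bd: "norm (D n x) \<le> norm x" for n x
    by (induction n) (auto simp: D0 DSuc intro: order_trans contr)
  obtain e where e: "e \<in> cblinops" "\<And>x. (\<lambda>n. T n x) \<longlonglongrightarrow> blinfun_apply e x"
    by (rule strong_limit_exists[of T 1]) (use cau Cauchy_convergent bd Tcb in \<open>auto simp: T\<close>)
  have esa: "selfadjoint e" by (rule selfadjoint_limit[OF Tsa e(2)])
  have "(norm (e x))\<^sup>2 = Re (cinner (e x) x)" for x
  proof -
    have "(\<lambda>n. (norm (T n x))\<^sup>2) \<longlonglongrightarrow> (norm (e x))\<^sup>2" by (intro tendsto_power tendsto_norm e)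
    moreover have "(\<lambda>n. (norm (T n x))\<^sup>2) \<longlonglongrightarrow> L x"
      using LIMSEQ_subseq_LIMSEQ[OF L[of x], of "\<lambda>n. 2 * n"] by (simp add: strict_mono_def o_def T s_def)
    moreover have "(\<lambda>n. Re (cinner (T n x) x)) \<longlonglongrightarrow> Re (cinner (e x) x)"
      by (intro tendsto_Re cinner.tendsto e tendsto_const)
    moreover have "(\<lambda>n. Re (cinner (T n x) x)) \<longlonglongrightarrow> L x" using L[of x] by (simp add: T s_form)
    ultimately show ?thesis using LIMSEQ_unique by metis
  qed
  then have "e o\<^sub>L e = e" by (rule projectionI_form[OF e(1) esa])
  then show ?thesis using that[of e] e esa by (simp add: projections_cblinops T D_def)
qed

text \<open>Put \<open>d = r + p - 1\<close>. Its even powers converge strongly to a projection \<open>e\<close>, and \<open>m = (e + de)/2\<close>, \<open>m' = (e - de)/2\<close> are the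
  projections onto the eigenspaces of \<open>d\<close> for \<open>1\<close> and \<open>-1\<close>. All odd powers of \<open>d\<close> have the same trace, so in the limit
  \<open>\<tau>(m) - \<tau>(m') = \<tau>(de) = \<tau>(d) = \<tau>(r) + \<tau>(p) - 1\<close>. A vector fixed by \<open>d\<close> satisfies \<open>rx + px = 2x\<close> and therefore lies
  in both ranges.\<close>

lemma (in tracial_algebra) meet_trace:
  assumes r: "r \<in> projections M" and p: "p \<in> projections M"
  shows "\<exists>m\<in>projections M. r o\<^sub>L m = m \<and> p o\<^sub>L m = m \<and> Re (\<tau> r) + Re (\<tau> p) - 1 \<le> Re (\<tau> m)"
proof -
  define s where "s = id_blinfun - p"
  define d where "d = r - s"
  have r': "r \<in> M" "r o\<^sub>L r = r" "selfadjoint r" and p': "p \<in> M" "p o\<^sub>L p = p" "selfadjoint p"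
    using r p by (auto simp: projections_M)
  have s: "s \<in> projections M" unfolding s_def by (rule projection_compl[OF p])
  then have s': "s \<in> M" "s o\<^sub>L s = s" "selfadjoint s" by (auto simp: projections_M)
  have dM: "d \<in> M" unfolding d_def by (rule M_diff[OF r'(1) s'(1)])
  have dsa: "selfadjoint d" unfolding d_def by (rule selfadjoint_diff[OF r'(3) s'(3)])
  have d_apply: "d x = r x + p x - x" for x by (simp add: d_def s_def blinfun.bilinear_simps)
  have contr: "norm (d x) \<le> norm x" for x
  proof -
    have bsa: "selfadjoint (r + p)" by (rule selfadjoint_add[OF r'(3) p'(3)])
    have form: "Re (cinner ((r + p) y) y) = (norm (r y))\<^sup>2 + (norm (p y))\<^sup>2" for y
      using projection_form[OF r'(2,3), of y] projection_form[OF p'(2,3), of y]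
      by (simp add: blinfun.add_left cinner_add_left)
    have rp: "(norm (r y))\<^sup>2 \<le> (norm y)\<^sup>2" "(norm (p y))\<^sup>2 \<le> (norm y)\<^sup>2" for y
      using projection_norm_le[OF r'(2,3), of y] projection_norm_le[OF p'(2,3), of y] by (auto intro: power_mono)
    have "(norm (r y))\<^sup>2 + (norm (p y))\<^sup>2 \<le> 2 * (norm y)\<^sup>2" for y
      using rp[of y] by linarith
    then have "(norm ((r + p) x))\<^sup>2 \<le> 2 * Re (cinner ((r + p) x) x)"
      by (intro norm_apply_square_le[where V = UNIV and m = 2] bsa) (auto simp: form)
    moreover have "(norm (d x))\<^sup>2 = (norm ((r + p) x))\<^sup>2 - 2 * Re (cinner ((r + p) x) x) + (norm x)\<^sup>2"
      using norm_add_square[of "(r + p) x" "- x"] by (simp add: d_apply blinfun.add_left cinner.minus_right)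
    ultimately have "(norm (d x))\<^sup>2 \<le> (norm x)\<^sup>2" by linarith
    then show ?thesis by (rule power2_le_imp_le) simp
  qed
  obtain e where e: "e \<in> projections cblinops" and lim: "\<And>x. (\<lambda>n. (blinfun_apply d ^^ (2 * n)) x) \<longlonglongrightarrow> blinfun_apply e x"
    using contraction_even_powers[OF M_cblinops[OF dM] dsa contr] by blast
  have e': "e \<in> cblinops" "e o\<^sub>L e = e" "selfadjoint e" using e by (auto simp: projections_cblinops)
  define c where "c n = (((o\<^sub>L) (d o\<^sub>L d)) ^^ n) id_blinfun" for n
  have c_apply: "blinfun_apply (c n) x = (blinfun_apply d ^^ (2 * n)) x" for n x
    by (induction n) (auto simp: c_def)
  have cM: "c n \<in> M" for n by (induction n) (auto simp: c_def M_id intro!: M_compose dM)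
  have clim: "(\<lambda>n. c n x) \<longlonglongrightarrow> blinfun_apply e x" for x using lim by (simp add: c_apply)
  have eM: "e \<in> M" by (rule M_limit[OF cM e'(1) clim])
  have cd: "c n (d x) = d (c n x)" for n x by (simp add: c_apply funpow_swap1)
  have ed: "e (d x) = d (e x)" for x
  proof -
    have "(\<lambda>n. d (c n x)) \<longlonglongrightarrow> d (e x)" by (intro blinfun.tendsto tendsto_const clim)
    then show ?thesis using clim[of "d x"] LIMSEQ_unique by (auto simp: cd)
  qed
  have dde: "d (d (e x)) = e x" for x
  proof -
    have "(\<lambda>n. d (d (c n x))) \<longlonglongrightarrow> d (d (e x))" by (intro blinfun.tendsto tendsto_const clim)
    moreover have "(\<lambda>n. c (Suc n) x) \<longlonglongrightarrow> e x" by (rule LIMSEQ_Suc[OF clim])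
    ultimately show ?thesis using LIMSEQ_unique by (auto simp: c_apply)
  qed
  note ee = compose_eq_apply[OF e'(2)]
  have fM: "d o\<^sub>L e \<in> M" by (rule M_compose[OF dM eM])
  have fsa: "selfadjoint (d o\<^sub>L e)"
    unfolding selfadjoint_def is_adjoint_def
    using selfadjointD[OF dsa] selfadjointD[OF e'(3)] by (simp add: ed)
  \<comment> \<open>the signs \<open>\<sigma> = 1\<close> and \<open>\<sigma> = -1\<close> give \<open>m\<close> and \<open>m'\<close>\<close>
  have proj: "(1/2) *\<^sub>R (e + \<sigma> *\<^sub>R (d o\<^sub>L e)) \<in> projections M" if \<sigma>: "\<sigma> * \<sigma> = 1" for \<sigma> :: real
    unfolding projections_M
  proof (intro conjI)
    show "(1/2) *\<^sub>R (e + \<sigma> *\<^sub>R (d o\<^sub>L e)) \<in> M" by (intro M_scaleR M_add eM fM)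
    show "selfadjoint ((1/2) *\<^sub>R (e + \<sigma> *\<^sub>R (d o\<^sub>L e)))"
      by (intro selfadjoint_scaleR selfadjoint_add e' fsa)
    show "((1/2) *\<^sub>R (e + \<sigma> *\<^sub>R (d o\<^sub>L e))) o\<^sub>L ((1/2) *\<^sub>R (e + \<sigma> *\<^sub>R (d o\<^sub>L e))) = (1/2) *\<^sub>R (e + \<sigma> *\<^sub>R (d o\<^sub>L e))"
    proof (rule blinfun_eqI)
      fix x
      define y where "y = (1/2) *\<^sub>R (e x + \<sigma> *\<^sub>R d (e x))"
      have ey: "e y = y"
        by (simp add: y_def blinfun.add_right blinfun.scaleR_right ee ed)
      have "\<sigma> *\<^sub>R d y = (1/2) *\<^sub>R (\<sigma> *\<^sub>R d (e x) + (\<sigma> * \<sigma>) *\<^sub>R e x)"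
        by (simp add: y_def blinfun.add_right blinfun.scaleR_right dde scaleR_add_right)
      then have dy: "\<sigma> *\<^sub>R d y = y" unfolding \<sigma> by (simp add: y_def add.commute)
      have P: "((1/2) *\<^sub>R (e + \<sigma> *\<^sub>R (d o\<^sub>L e))) z = (1/2) *\<^sub>R (e z + \<sigma> *\<^sub>R d (e z))" for z
        by (simp add: blinfun.bilinear_simps)
      have "((1/2) *\<^sub>R (e + \<sigma> *\<^sub>R (d o\<^sub>L e))) y = y"
        unfolding P ey dy by (simp flip: scaleR_2)
      then show "(((1/2) *\<^sub>R (e + \<sigma> *\<^sub>R (d o\<^sub>L e))) o\<^sub>L ((1/2) *\<^sub>R (e + \<sigma> *\<^sub>R (d o\<^sub>L e)))) x
        = ((1/2) *\<^sub>R (e + \<sigma> *\<^sub>R (d o\<^sub>L e))) x"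
        unfolding blinfun_apply_blinfun_compose P[of x] y_def[symmetric] .
    qed
  qed
  define m where "m = (1/2) *\<^sub>R (e + 1 *\<^sub>R (d o\<^sub>L e))"
  define m' where "m' = (1/2) *\<^sub>R (e + (-1) *\<^sub>R (d o\<^sub>L e))"
  have m: "m \<in> projections M" "m' \<in> projections M" unfolding m_def m'_def by (rule proj, simp)+
  then have mM: "m \<in> M" "m' \<in> M" by (auto simp: projections_M)
  have "m - m' = d o\<^sub>L e"
  proof -
    have "m - m' = (1/2) *\<^sub>R ((d o\<^sub>L e) + (d o\<^sub>L e))" unfolding m_def m'_def by (simp flip: scaleR_diff_right)
    then show ?thesis by (simp flip: scaleR_2)
  qed
  then have "\<tau> m - \<tau> m' = \<tau> (d o\<^sub>L e)" using trace_diff[OF mM] by simp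
  moreover have "\<tau> (d o\<^sub>L e) = \<tau> d"
  proof (rule LIMSEQ_unique)
    show "(\<lambda>n. \<tau> (c n o\<^sub>L d)) \<longlonglongrightarrow> \<tau> (d o\<^sub>L e)"
    proof (rule trace_limit[where C = 1])
      show "c n o\<^sub>L d \<in> M" for n by (intro M_compose cM dM)
      show "(\<lambda>n. (c n o\<^sub>L d) x) \<longlonglongrightarrow> (d o\<^sub>L e) x" for x using clim[of "d x"] by (simp add: ed)
      have "norm ((blinfun_apply d ^^ k) x) \<le> norm x" for k x
        by (induction k) (auto intro: order_trans contr)
      then show "norm ((c n o\<^sub>L d) x) \<le> 1 * norm x" for n x
        using contr[of x] by (auto simp: c_apply intro: order_trans)
    qed (rule fM)
    have crs: "c n o\<^sub>L r = r o\<^sub>L c n \<and> c n o\<^sub>L s = s o\<^sub>L c n" for n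
    proof (induction n)
      case 0 then show ?case by (simp add: c_def)
    next
      case (Suc n)
      note [simp] = compose_eq_apply[OF r'(2)] compose_eq_apply[OF s'(2)]
      have "(d o\<^sub>L d) o\<^sub>L r = r o\<^sub>L (d o\<^sub>L d)" "(d o\<^sub>L d) o\<^sub>L s = s o\<^sub>L (d o\<^sub>L d)"
        by (auto intro!: blinfun_eqI simp: d_def blinfun.bilinear_simps)
      moreover have "c (Suc n) = (d o\<^sub>L d) o\<^sub>L c n" by (simp add: c_def)
      ultimately show ?case using Suc by (metis blinfun_compose_assoc)
    qed
    have "\<tau> (c n o\<^sub>L d) = \<tau> d" for n
    proof (induction n)
      case 0 then show ?case by (simp add: c_def)
    next
      case (Suc n)
      have "c (Suc n) o\<^sub>L d = c n o\<^sub>L (d o\<^sub>L (d o\<^sub>L d))"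
        by (rule blinfun_eqI) (simp add: cd c_apply funpow_swap1)
      then show ?case using trace_odd_power_step[OF r s cM[of n] crs[of n, THEN conjunct1] crs[of n, THEN conjunct2]] Suc
        by (simp add: d_def)
    qed
    then show "(\<lambda>n. \<tau> (c n o\<^sub>L d)) \<longlonglongrightarrow> \<tau> d" by simp
  qed
  moreover have "\<tau> d = \<tau> r + \<tau> p - 1"
    using r'(1) p'(1) s'(1) M_id trace_id by (simp add: d_def s_def trace_diff M_diff)
  ultimately have "\<tau> m - \<tau> m' = \<tau> r + \<tau> p - 1" by simp
  from arg_cong[OF this, of Re] have tr: "Re (\<tau> r) + Re (\<tau> p) - 1 \<le> Re (\<tau> m)"
    using trace_projection_nonneg[OF m(2)] by simp
  have dm: "d (m x) = m x" for x
    by (simp add: m_def blinfun.bilinear_simps dde add.commute)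
  have fix': "r (m x) = m x \<and> p (m x) = m x" for x
  proof -
    define y where "y = m x"
    have rp: "r y + p y = y + y" using dm[of x] unfolding d_apply y_def by (simp add: diff_eq_eq)
    have "Re (cinner (r y + p y) y) = 2 * (norm y)\<^sup>2" unfolding rp by (simp add: cinner_add_left Re_cinner_self)
    then have "(norm (r y))\<^sup>2 + (norm (p y))\<^sup>2 = 2 * (norm y)\<^sup>2"
      using projection_form[OF r'(2,3), of y] projection_form[OF p'(2,3), of y] by (simp add: cinner_add_left)
    moreover have "(norm (r y))\<^sup>2 \<le> (norm y)\<^sup>2" "(norm (p y))\<^sup>2 \<le> (norm y)\<^sup>2"
      using projection_norm_le[OF r'(2,3), of y] projection_norm_le[OF p'(2,3), of y] by (auto intro: power_mono)
    ultimately have "(norm (y - r y))\<^sup>2 = 0" "(norm (y - p y))\<^sup>2 = 0"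
      unfolding projection_complement_square[OF r'(2,3)] projection_complement_square[OF p'(2,3)] by linarith+
    then show ?thesis by (simp add: y_def)
  qed
  show ?thesis
    by (rule bexI[OF _ m(1)]) (use fix' tr in \<open>auto intro: blinfun_eqI\<close>)
qed

section \<open>Traces of projections in a finite type I factor\<close>

text \<open>For instance \<open>\<parallel>v(x - ex)\<parallel>\<^sup>2 = \<langle>e(x - ex), x - ex\<rangle> = 0\<close>.\<close>

lemma partial_isometry:
  fixes v w :: "'h::complex_hilbert op"
  assumes adj: "is_adjoint w v" and e: "w o\<^sub>L v = e" "e o\<^sub>L e = e" and f: "v o\<^sub>L w = f" "f o\<^sub>L f = f"
  shows "v o\<^sub>L e = v" "f o\<^sub>L v = v" "e o\<^sub>L w = w" "w o\<^sub>L f = w"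
proof -
  have vw: "cinner (v x) y = cinner x (w y)" for x y using adj by (simp add: is_adjoint_def)
  have wv: "cinner (w x) y = cinner x (v y)" for x y
  proof -
    have "cinner (w x) y = cnj (cinner y (w x))" by (rule cinner_commute)
    also have "\<dots> = cnj (cinner (v y) x)" by (simp only: vw)
    also have "\<dots> = cinner x (v y)" by (rule cinner_commute[symmetric])
    finally show ?thesis .
  qed
  note [simp] = compose_eq_apply[OF e(1)] compose_eq_apply[OF e(2)] compose_eq_apply[OF f(1)] compose_eq_apply[OF f(2)]
  show ve: "v o\<^sub>L e = v"
  proof (rule blinfun_eqI)
    fix x
    have "cinner (v (x - e x)) (v (x - e x)) = 0" unfolding vw by (simp add: blinfun.diff_right cinner.zero_right)
    then show "(v o\<^sub>L e) x = v x" by (simp add: cinner_self blinfun.diff_right)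
  qed
  show wf: "w o\<^sub>L f = w"
  proof (rule blinfun_eqI)
    fix x
    have "cinner (w (x - f x)) (w (x - f x)) = 0" unfolding wv by (simp add: blinfun.diff_right cinner.zero_right)
    then show "(w o\<^sub>L f) x = w x" by (simp add: cinner_self blinfun.diff_right)
  qed
  have "(v o\<^sub>L w) o\<^sub>L v = v o\<^sub>L (w o\<^sub>L v)" "(w o\<^sub>L v) o\<^sub>L w = w o\<^sub>L (v o\<^sub>L w)"
    by (rule blinfun_compose_assoc)+
  then show "f o\<^sub>L v = v" "e o\<^sub>L w = w" unfolding e(1) f(1) ve wf .
qed

context tracial_algebra
begin

text \<open>Conjugating an element \<open>y\<close> of the abelian corner \<open>e\<^sub>j M e\<^sub>j\<close> by the matrix units and summing gives a central element,
  hence a scalar \<open>c\<close>; compressing back to the corner gives \<open>y = c e\<^sub>j\<close>. The traces of the \<open>e\<^sub>i\<close> agree because the projections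
  are equivalent.\<close>

lemma type_I_corner_scalar:
  assumes M: "type_I_factor n M"
  obtains e where "\<And>i. i < n \<Longrightarrow> e i \<in> projections M" "(\<Sum>i<n. e i) = id_blinfun"
    "\<And>i. i < n \<Longrightarrow> Re (\<tau> (e i)) = 1 / real n"
    "\<And>i x. i < n \<Longrightarrow> x \<in> M \<Longrightarrow> \<exists>c. e i o\<^sub>L (x o\<^sub>L e i) = scalar_op c o\<^sub>L e i"
proof -
  obtain e where "\<forall>i<n. abelian_projection M (e i) \<and> e i \<noteq> 0"
    and "\<forall>i<n. \<forall>j<n. i \<noteq> j \<longrightarrow> e i o\<^sub>L e j = 0"
    and "\<forall>i<n. \<forall>j<n. murray_von_neumann_equiv M (e i) (e j)"
    and sum: "(\<Sum>i<n. e i) = id_blinfun"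
    using M[unfolded type_I_factor_def, THEN conjunct2] by (elim exE conjE) 
  then have ab: "\<And>i. i < n \<Longrightarrow> abelian_projection M (e i)"
    and orth: "\<And>i j. i < n \<Longrightarrow> j < n \<Longrightarrow> i \<noteq> j \<Longrightarrow> e i o\<^sub>L e j = 0"
    and mvn: "\<And>i j. i < n \<Longrightarrow> j < n \<Longrightarrow> murray_von_neumann_equiv M (e i) (e j)" by simp_all
  have centre: "M \<inter> commutant M = range scalar_op" using M by (simp add: type_I_factor_def factor_def)
  have e: "e i \<in> projections M" if "i < n" for i using ab[OF that] by (simp add: abelian_projection_def)
  have e': "e i \<in> M" "e i o\<^sub>L e i = e i" "selfadjoint (e i)" if "i < n" for i using e[OF that] by (auto simp: projections_M)
  have tr_eq: "\<tau> (e i) = \<tau> (e j)" if ij: "i < n" "j < n" for i j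
  proof -
    obtain v w where "v \<in> M" "w \<in> M" "w o\<^sub>L v = e i" "v o\<^sub>L w = e j"
      using mvn[OF ij] unfolding murray_von_neumann_equiv_def by blast
    then show ?thesis using trace_commute[of w v] by simp
  qed
  have tr: "Re (\<tau> (e i)) = 1 / real n" if "i < n" for i
  proof -
    have "1 = (\<Sum>k<n. \<tau> (e k))" using trace_sum[of "{..<n}" e] e'(1) sum trace_id by simp
    also have "\<dots> = (\<Sum>k<n. \<tau> (e i))" by (intro sum.cong refl tr_eq) (use that in auto)
    finally have "1 = of_nat n * \<tau> (e i)" by simp
    from arg_cong[OF this, of Re] show ?thesis using that by (simp add: field_simps)
  qed
  have corner: "\<exists>c. e j o\<^sub>L (x o\<^sub>L e j) = scalar_op c o\<^sub>L e j" if j: "j < n" and x: "x \<in> M" for j x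
  proof -
    define y where "y = e j o\<^sub>L (x o\<^sub>L e j)"
    have yM: "y \<in> M" unfolding y_def by (intro M_compose e'[OF j] x)
    have "\<exists>v w. v \<in> M \<and> w \<in> M \<and> is_adjoint w v \<and> w o\<^sub>L v = e j \<and> v o\<^sub>L w = e i" if "i < n" for i
      using mvn[OF j that] unfolding murray_von_neumann_equiv_def by blast
    then obtain v w where v: "\<And>i. i < n \<Longrightarrow> v i \<in> M" and w: "\<And>i. i < n \<Longrightarrow> w i \<in> M"
      and adj: "\<And>i. i < n \<Longrightarrow> is_adjoint (w i) (v i)"
      and wv: "\<And>i. i < n \<Longrightarrow> w i o\<^sub>L v i = e j" and vw: "\<And>i. i < n \<Longrightarrow> v i o\<^sub>L w i = e i" by metis
    have iso: "v i o\<^sub>L e j = v i" "e i o\<^sub>L v i = v i" "e j o\<^sub>L w i = w i" "w i o\<^sub>L e i = w i" if "i < n" for i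
      by (rule partial_isometry[OF adj[OF that] wv[OF that] e'(2)[OF j] vw[OF that] e'(2)[OF that]])+
    note iso_a = compose_eq_apply[OF iso(1)] compose_eq_apply[OF iso(2)] compose_eq_apply[OF iso(3)] compose_eq_apply[OF iso(4)]
    have orth_a: "e i (e k x) = 0" if "i < n" "k < n" "i \<noteq> k" for i k x
      using compose_eq_apply[OF orth[OF that]] by simp
    define z where "z = (\<Sum>i<n. v i o\<^sub>L (y o\<^sub>L w i))"
    have zM: "z \<in> M" unfolding z_def by (intro M_sum M_compose v w yM) auto
    have z_apply: "z u = (\<Sum>i<n. v i (y (w i u)))" for u by (simp add: z_def blinfun.sum_left)
    have ez: "e i (z u) = v i (y (w i u))" if "i < n" for i u
    proof -
      have "e i (z u) = (\<Sum>k<n. if k = i then v i (y (w i u)) else 0)"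
        unfolding z_apply blinfun.sum_right
      proof (rule sum.cong)
        fix k assume "k \<in> {..<n}"
        then have k: "k < n" by simp
        have "e i (v k q) = (if k = i then v i q else 0)" for q
          using iso_a(2)[OF k, of q] orth_a[OF that k, of "v k q"] iso_a(2)[OF that] by auto
        then show "e i (v k (y (w k u))) = (if k = i then v i (y (w i u)) else 0)" by simp
      qed simp
      then show ?thesis using that by simp
    qed
    have ze: "z (e k u) = v k (y (w k u))" if "k < n" for k u
    proof -
      have "z (e k u) = (\<Sum>i<n. if i = k then v k (y (w k u)) else 0)"
        unfolding z_apply
      proof (rule sum.cong)
        fix i assume "i \<in> {..<n}"
        then have i: "i < n" by simp
        have "w i (e k u) = (if i = k then w k u else 0)"
          using iso_a(4)[OF i, of "e k u"] orth_a[OF i that, of u] iso_a(4)[OF that, of u] by auto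
        then show "v i (y (w i (e k u))) = (if i = k then v k (y (w k u)) else 0)" by (auto simp: blinfun.zero_right)
      qed simp
      then show ?thesis using that by simp
    qed
    have id_sum: "u = (\<Sum>i<n. e i u)" for u
      using arg_cong[OF sum, of "\<lambda>t. blinfun_apply t u"] by (simp add: blinfun.sum_left)
    have comm: "z o\<^sub>L t = t o\<^sub>L z" if t: "t \<in> M" for t
    proof -
      have block: "e i (z (t (e k u))) = e i (t (z (e k u)))" if i: "i < n" and k: "k < n" for i k u
      proof -
        define g where "g = w i o\<^sub>L (t o\<^sub>L v k)"
        have gM: "g \<in> M" unfolding g_def by (intro M_compose w v t i k)
        have "(e j o\<^sub>L x o\<^sub>L e j) o\<^sub>L (e j o\<^sub>L g o\<^sub>L e j) = (e j o\<^sub>L g o\<^sub>L e j) o\<^sub>L (e j o\<^sub>L x o\<^sub>L e j)"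
          using ab[OF j] x gM unfolding abelian_projection_def by blast
        moreover have "e j o\<^sub>L g o\<^sub>L e j = g"
          by (rule blinfun_eqI) (simp add: g_def iso_a i k)
        moreover have "e j o\<^sub>L x o\<^sub>L e j = y" by (simp add: y_def blinfun_compose_assoc)
        ultimately have yg: "y (g q) = g (y q)" for q
          using blinfun_apply_blinfun_compose[of y g q] blinfun_apply_blinfun_compose[of g y q] by metis
        have "e i (z (t (e k u))) = v i (y (w i (t (e k u))))" by (rule ez[OF i])
        also have "e k u = v k (w k u)" using compose_eq_apply[OF vw[OF k]] by simp
        also have "y (w i (t (v k (w k u)))) = g (y (w k u))" using yg[of "w k u"] by (simp add: g_def)
        also have "v i \<dots> = e i (t (v k (y (w k u))))"
          using compose_eq_apply[OF vw[OF i]] by (simp add: g_def)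
        also have "v k (y (w k u)) = z (e k u)" by (rule ze[OF k, symmetric])
        finally show ?thesis using iso_a(2)[OF k] compose_eq_apply[OF vw[OF k]] by simp
      qed
      show ?thesis
      proof (rule blinfun_eqI)
        fix u
        have "z (t u) = (\<Sum>i<n. \<Sum>k<n. e i (z (t (e k u))))"
        proof -
          have "z (t u) = (\<Sum>k<n. z (t (e k u)))"
            by (subst id_sum[of u]) (simp add: blinfun.sum_right)
          then show ?thesis by (subst id_sum) (simp add: blinfun.sum_right)
        qed
        also have "\<dots> = (\<Sum>i<n. \<Sum>k<n. e i (t (z (e k u))))"
          by (intro sum.cong refl block) auto
        also have "\<dots> = t (z u)"
        proof -
          have "t (z u) = (\<Sum>k<n. t (z (e k u)))"
            by (subst id_sum[of u]) (simp add: blinfun.sum_right)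
          then show ?thesis by (subst (2) id_sum) (simp add: blinfun.sum_right)
        qed
        finally show "(z o\<^sub>L t) u = (t o\<^sub>L z) u" by simp
      qed
    qed
    have "z \<in> commutant M" using comm M_cblinops[OF zM] by (simp add: commutant_def)
    then obtain c where c: "z = scalar_op c" using zM centre by blast
    have "y u = (scalar_op c o\<^sub>L e j) u" for u
    proof -
      have yj: "e j (y q) = y q" "y (e j q) = y q" for q
        using compose_eq_apply[OF e'(2)[OF j]] by (simp_all add: y_def)
      have "w j (z (v j u)) = w j (e j (z (v j u)))" using iso_a(4)[OF j] by simp
      also have "\<dots> = w j (v j (y (w j (v j u))))" by (simp only: ez[OF j])
      also have "\<dots> = y u" using compose_eq_apply[OF wv[OF j]] by (simp add: yj)
      finally have "y u = w j (c *\<^sub>C v j u)" by (simp add: c scalar_op_apply)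
      also have "\<dots> = c *\<^sub>C e j u"
        using cblinops_scaleC[OF M_cblinops[OF w[OF j]]] compose_eq_apply[OF wv[OF j]] by simp
      finally show ?thesis by (simp add: scalar_op_apply)
    qed
    then have "y = scalar_op c o\<^sub>L e j" by (rule blinfun_eqI)
    then show ?thesis unfolding y_def by blast
  qed
  show ?thesis by (rule that[OF e sum tr corner])
qed

text \<open>Some \<open>p e\<^sub>j\<close> is nonzero, and \<open>e\<^sub>j p e\<^sub>j = r e\<^sub>j\<close> with \<open>r > 0\<close>. Then \<open>p e\<^sub>j p / r\<close> is a projection below \<open>p\<close> with the trace of
  \<open>e\<^sub>j\<close>.\<close>

lemma type_I_minimal_subprojection:
  assumes M: "type_I_factor n M" and p: "p \<in> projections M" "p \<noteq> 0"
  shows "\<exists>f\<in>projections M. p o\<^sub>L f = f \<and> Re (\<tau> f) = 1 / real n"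
proof -
  obtain e where e: "\<And>i. i < n \<Longrightarrow> e i \<in> projections M" and sum: "(\<Sum>i<n. e i) = id_blinfun"
    and tr: "\<And>i. i < n \<Longrightarrow> Re (\<tau> (e i)) = 1 / real n"
    and corner: "\<And>i x. i < n \<Longrightarrow> x \<in> M \<Longrightarrow> \<exists>c. e i o\<^sub>L (x o\<^sub>L e i) = scalar_op c o\<^sub>L e i"
    by (rule type_I_corner_scalar[OF M]) blast
  have p': "p \<in> M" "p o\<^sub>L p = p" "selfadjoint p" using p by (auto simp: projections_M)
  obtain u where u: "p u \<noteq> 0" using p(2) by (metis blinfun_eqI blinfun.zero_left)
  have "p u = (\<Sum>i<n. p (e i u))"
    using arg_cong[OF sum, of "\<lambda>t. p (blinfun_apply t u)"] by (simp add: blinfun.sum_left blinfun.sum_right)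
  then obtain j where j: "j < n" "p (e j u) \<noteq> 0" using u by (metis (no_types, lifting) lessThan_iff sum.neutral)
  have e': "e j \<in> M" "e j o\<^sub>L e j = e j" "selfadjoint (e j)" using e[OF j(1)] by (auto simp: projections_M)
  obtain c where c: "e j o\<^sub>L (p o\<^sub>L e j) = scalar_op c o\<^sub>L e j" using corner[OF j(1) p'(1)] by blast
  have ca: "e j (p (e j x)) = c *\<^sub>C e j x" for x
    using arg_cong[OF c, of "\<lambda>t. blinfun_apply t x"] by (simp add: scalar_op_apply)
  note [simp] = compose_eq_apply[OF p'(2)] compose_eq_apply[OF e'(2)]
  define r where "r = (norm (p (e j u)))\<^sup>2 / (norm (e j u))\<^sup>2"
  have eju: "e j u \<noteq> 0" using j(2) by (auto simp: blinfun.zero_right)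
  have r: "0 < r" using j(2) eju by (simp add: r_def)
  have "of_real ((norm (p (e j u)))\<^sup>2) = cinner (p (e j u)) (e j u)"
    by (rule projection_form[OF p'(2,3), symmetric])
  also have "\<dots> = cinner (e j (p (e j u))) (e j u)" using selfadjointD[OF e'(3), of "p (e j u)" "e j u"] by simp
  also have "\<dots> = c * of_real ((norm (e j u))\<^sup>2)" by (simp add: ca cinner_scaleC_left cinner_self)
  finally have cr: "c = of_real r" using eju by (simp add: r_def field_simps)
  have ea: "e j (p (e j x)) = r *\<^sub>R e j x" for x by (simp add: ca cr scaleR_scaleC)
  define f where "f = (1 / r) *\<^sub>R (p o\<^sub>L (e j o\<^sub>L p))"
  have fM: "f \<in> M" unfolding f_def by (intro M_scaleR M_compose p' e')
  have "f o\<^sub>L f = f" by (rule blinfun_eqI) (use r in \<open>simp add: f_def blinfun.bilinear_simps ea\<close>)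
  moreover have "selfadjoint f" unfolding f_def by (intro selfadjoint_scaleR selfadjoint_sandwich p' e')
  moreover have "p o\<^sub>L f = f" by (rule blinfun_eqI) (simp add: f_def blinfun.bilinear_simps)
  moreover have "Re (\<tau> f) = 1 / real n"
  proof -
    have pe: "p o\<^sub>L (e j o\<^sub>L p) \<in> M" "e j o\<^sub>L p \<in> M" "p o\<^sub>L e j \<in> M" by (intro M_compose p' e')+
    have "\<tau> (p o\<^sub>L (e j o\<^sub>L p)) = \<tau> ((e j o\<^sub>L p) o\<^sub>L p)" by (rule trace_commute[OF p'(1) pe(2)])
    also have "(e j o\<^sub>L p) o\<^sub>L p = e j o\<^sub>L (e j o\<^sub>L p)" by (rule blinfun_eqI) simp
    also have "\<tau> (e j o\<^sub>L (e j o\<^sub>L p)) = \<tau> ((e j o\<^sub>L p) o\<^sub>L e j)" by (rule trace_commute[OF e'(1) pe(2)])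
    also have "(e j o\<^sub>L p) o\<^sub>L e j = r *\<^sub>R e j" by (rule blinfun_eqI) (simp add: ea blinfun.scaleR_left)
    finally have "\<tau> f = \<tau> (e j)" unfolding f_def using pe(1) e'(1) r by (simp add: trace_scaleR)
    then show ?thesis using tr[OF j(1)] by simp
  qed
  ultimately show ?thesis using fM by (intro bexI[of _ f]) (auto simp: projections_M)
qed

text \<open>Minimal projections are split off one at a time; as long as the trace of \<open>p\<close> is not exhausted the remainder is nonzero.\<close>

lemma type_I_subprojection_multiple:
  assumes M: "type_I_factor n M" and p: "p \<in> projections M"
  shows "real k / real n \<le> Re (\<tau> p) \<Longrightarrow> \<exists>q\<in>projections M. p o\<^sub>L q = q \<and> Re (\<tau> q) = real k / real n"
proof (induction k)
  case 0
  show ?case by (rule bexI[OF _ projection_zero]) (simp add: trace_zero)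
next
  case (Suc k)
  have "n \<noteq> 0"
  proof
    assume "n = 0"
    then have "id_blinfun = (0 :: 'h op)" using M by (auto simp: type_I_factor_def)
    then show False using trace_id trace_zero by simp
  qed
  then have lt: "real k / real n < real (Suc k) / real n" by (simp add: divide_strict_right_mono)
  then obtain q where q: "q \<in> projections M" "p o\<^sub>L q = q" "Re (\<tau> q) = real k / real n" using Suc by force
  note d = projection_diff[OF p q(1,2)]
  have "p - q \<noteq> 0" using q(3) Suc(2) lt by auto
  then obtain f where f: "f \<in> projections M" "(p - q) o\<^sub>L f = f" "Re (\<tau> f) = 1 / real n"
    using type_I_minimal_subprojection[OF M d(1)] by blast
  have p': "p \<in> M" "p o\<^sub>L p = p" "selfadjoint p" and q': "q \<in> M" "q o\<^sub>L q = q" "selfadjoint q"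
    and f': "f \<in> M" "f o\<^sub>L f = f" "selfadjoint f" using p q(1) f(1) by (auto simp: projections_M)
  have qf: "q o\<^sub>L f = 0"
    using blinfun_compose_assoc[of q "p - q" f] unfolding d(3) f(2) by simp
  have "f o\<^sub>L (p - q) = f"
    by (rule projection_compose_commute[OF _ f'(3) f(2)]) (rule selfadjoint_diff[OF p'(3) q'(3)])
  then have fq: "f o\<^sub>L q = 0"
    using blinfun_compose_assoc[of f "p - q" q] unfolding d(4) by simp
  have pf: "p o\<^sub>L f = f"
    using blinfun_compose_assoc[of p "p - q" f] unfolding d(2) f(2) by simp
  note bil = blinfun_compose.add_left blinfun_compose.add_right
  have "q + f \<in> projections M" unfolding projections_M
    using q' f' qf fq by (auto simp: bil M_add selfadjoint_add)
  moreover have "p o\<^sub>L (q + f) = q + f" by (simp add: bil pf q(2))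
  moreover have "Re (\<tau> (q + f)) = real (Suc k) / real n"
    using q' f' q(3) f(3) by (simp add: trace_add add_divide_distrib)
  ultimately show ?case by blast
qed

text \<open>After splitting off as many minimal projections as the trace allows, a nonzero remainder would contain another one.\<close>

lemma type_I_trace_multiple:
  assumes M: "type_I_factor n M" and p: "p \<in> projections M"
  shows "\<exists>k. Re (\<tau> p) = real k / real n"
proof -
  have n: "0 < n"
  proof (rule ccontr)
    assume "\<not> 0 < n"
    then have "id_blinfun = (0 :: 'h op)" using M by (auto simp: type_I_factor_def)
    then show False using trace_id trace_zero by simp
  qed
  define k where "k = nat \<lfloor>real n * Re (\<tau> p)\<rfloor>"
  have fl: "0 \<le> real n * Re (\<tau> p)" using trace_projection_nonneg[OF p] by simp
  have k: "real k \<le> real n * Re (\<tau> p)" "real n * Re (\<tau> p) < real k + 1"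
    unfolding k_def using fl by (simp_all add: of_nat_nat)
  have "real k / real n \<le> Re (\<tau> p)" using k(1) n by (simp add: divide_le_eq mult.commute)
  from type_I_subprojection_multiple[OF M p this]
  obtain q where q: "q \<in> projections M" "p o\<^sub>L q = q" "Re (\<tau> q) = real k / real n" by blast
  have pq: "p - q \<in> projections M" by (rule projection_diff(1)[OF p q(1,2)])
  have "p - q = 0"
  proof (rule ccontr)
    assume "p - q \<noteq> 0"
    then obtain f where f: "f \<in> projections M" "(p - q) o\<^sub>L f = f" "Re (\<tau> f) = 1 / real n"
      using type_I_minimal_subprojection[OF M pq] by blast
    have "1 / real n \<le> Re (\<tau> (p - q))" using trace_projection_mono[OF pq f(1,2)] f(3) by simp
    also have "Re (\<tau> (p - q)) = Re (\<tau> p) - real k / real n"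
      using trace_diff[of p q] p q by (simp add: projections_M)
    finally have "(real k + 1) / real n \<le> Re (\<tau> p)" by (simp add: add_divide_distrib)
    then show False using k(2) n by (simp add: divide_le_eq mult.commute)
  qed
  then show ?thesis using q(3) by auto
qed

lemma type_I_subprojection:
  assumes "type_I_factor n M" "p \<in> projections M" "q \<in> projections M" "Re (\<tau> q) \<le> Re (\<tau> p)"
  shows "\<exists>q'\<in>projections M. p o\<^sub>L q' = q' \<and> Re (\<tau> q') = Re (\<tau> q)"
  using type_I_trace_multiple[OF assms(1,3)] type_I_subprojection_multiple[OF assms(1,2)] assms(4) by metis

end

section \<open>The distribution of a self-adjoint element\<close>

text \<open>\<open>P(E)\<close> commutes with everything that commutes with \<open>a\<close>, in particular with the commutant of \<open>N\<close>. This places the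
  spectral projections both in \<open>M\<close> and in the von Neumann algebra generated by \<open>a\<close>.\<close>

lemma (in spectral_resolution) P_in_vna:
  assumes N: "von_neumann_algebra N" and a: "a \<in> N" and E: "E \<in> sets borel"
  shows "P E \<in> N"
proof -
  have "P E \<in> commutant (commutant N)"
    unfolding commutant_def[of "commutant N"]
  proof (intro CollectI conjI ballI)
    show "P E \<in> cblinops" by (rule P_cblinops[OF E])
    fix S assume "S \<in> commutant N"
    then have "S o\<^sub>L a = a o\<^sub>L S" using a by (auto simp: commutant_def)
    from P_bicommutant[OF this E] show "P E o\<^sub>L S = S o\<^sub>L P E" by simp
  qed
  then show ?thesis using N by (simp add: von_neumann_algebra_def)
qed

locale trace_resolution = tracial_algebra M \<tau> + spectral_resolution P a
  for M :: "'h::complex_hilbert op set" and \<tau> :: "'h op \<Rightarrow> complex" and P :: "real set \<Rightarrow> 'h op" and a :: "'h op" +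
  assumes a_in: "a \<in> M"
begin

lemma P_in: "E \<in> sets borel \<Longrightarrow> P E \<in> M"
  by (rule P_in_vna[OF vna a_in])

lemma P_projections: "E \<in> sets borel \<Longrightarrow> P E \<in> projections M"
  by (simp add: projections_M P_in P_idem P_selfadjoint)

text \<open>For \<open>q = 1\<close> this is the distribution of \<open>a\<close>; for a projection \<open>q\<close> it records how much of \<open>q\<close> sits over each part of the
  spectrum, and \<open>\<tau>(aq)\<close> is its barycentre.\<close>

definition trace_measure :: "'h op \<Rightarrow> real measure" where
  "trace_measure q = measure_of UNIV (sets borel) (\<lambda>E. ennreal (Re (\<tau> (P E o\<^sub>L q))))"

lemma sets_trace_measure [simp, measurable_cong]: "sets (trace_measure q) = sets borel"
  unfolding trace_measure_def by (simp add: sets.sigma_sets_eq[of borel, simplified])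

lemma space_trace_measure [simp]: "space (trace_measure q) = UNIV"
  unfolding trace_measure_def by simp

lemma trace_P_sums:
  assumes q: "q \<in> M" and A: "range A \<subseteq> sets borel" "disjoint_family A"
  shows "(\<lambda>n::nat. \<tau> (P (A n) o\<^sub>L q)) sums \<tau> (P (\<Union>n. A n) o\<^sub>L q)"
  unfolding sums_def
proof -
  have Ab: "A n \<in> sets borel" for n using A by auto
  have fin_add: "P (\<Union>i<n. A i) = (\<Sum>i<n. P (A i))" for n :: nat
    by (rule finite_additive_UN_lessThan[OF P_empty A(2,1) P_union])
  have "(\<lambda>n. \<tau> (P (\<Union>i<n. A i) o\<^sub>L q)) \<longlonglongrightarrow> \<tau> (P (\<Union>n. A n) o\<^sub>L q)"
  proof (rule trace_limit[where C = "norm q"])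
    show "P (\<Union>i<n. A i) o\<^sub>L q \<in> M" for n by (intro M_compose P_in q) (use Ab in auto)
    show "P (\<Union>n. A n) o\<^sub>L q \<in> M" by (intro M_compose P_in q) (use Ab in auto)
    show "(\<lambda>n. (P (\<Union>i<n. A i) o\<^sub>L q) x) \<longlonglongrightarrow> (P (\<Union>n. A n) o\<^sub>L q) x" for x
      using P_sums[OF A, of "q x"] unfolding sums_def fin_add by (simp add: blinfun.sum_left)
    show "norm ((P (\<Union>i<n. A i) o\<^sub>L q) x) \<le> norm q * norm x" for n x
      using P_norm_le[of "\<Union>i<n. A i" "q x"] norm_blinfun[of q x] Ab by (auto intro: order_trans)
  qed
  moreover have "\<tau> (P (\<Union>i<n. A i) o\<^sub>L q) = (\<Sum>i<n. \<tau> (P (A i) o\<^sub>L q))" for n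
  proof -
    have "P (\<Union>i<n. A i) o\<^sub>L q = (\<Sum>i<n. P (A i) o\<^sub>L q)"
      unfolding fin_add by (rule blinfun_eqI) (simp add: blinfun.sum_left)
    then show ?thesis using trace_sum[of "{..<n}" "\<lambda>i. P (A i) o\<^sub>L q"] M_compose[OF P_in[OF Ab] q] by simp
  qed
  ultimately show "(\<lambda>n. \<Sum>i<n. \<tau> (P (A i) o\<^sub>L q)) \<longlonglongrightarrow> \<tau> (P (\<Union>n. A n) o\<^sub>L q)" by simp
qed

lemma emeasure_trace_measure:
  assumes q: "q \<in> projections M" and E: "E \<in> sets borel"
  shows "emeasure (trace_measure q) E = ennreal (Re (\<tau> (P E o\<^sub>L q)))"
  unfolding trace_measure_def
proof (rule emeasure_borel_measure_of[OF _ _ E])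
  show "0 \<le> Re (\<tau> (P B o\<^sub>L q))" if "B \<in> sets borel" for B
    by (rule trace_compose_projections(2)[OF P_projections[OF that] q])
  show "(\<lambda>n. Re (\<tau> (P (A n) o\<^sub>L q))) sums Re (\<tau> (P (\<Union>n. A n) o\<^sub>L q))"
    if "range A \<subseteq> sets borel" "disjoint_family A" for A :: "nat \<Rightarrow> real set"
    by (intro sums_Re trace_P_sums that) (use q in \<open>simp add: projections_M\<close>)
qed (simp add: P_empty trace_zero)

lemma measure_trace_measure:
  "q \<in> projections M \<Longrightarrow> E \<in> sets borel \<Longrightarrow> measure (trace_measure q) E = Re (\<tau> (P E o\<^sub>L q))"
  by (simp add: measure_def emeasure_trace_measure trace_compose_projections(2) P_projections)

lemma finite_trace_measure: "q \<in> projections M \<Longrightarrow> finite_measure (trace_measure q)"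
  by (rule finite_measureI) (simp add: emeasure_trace_measure)

lemma AE_trace_measure_radius:
  assumes q: "q \<in> projections M" shows "AE t in trace_measure q. \<bar>t\<bar> \<le> radius"
proof (rule AE_I')
  have "- {-radius..radius} \<in> sets borel" by auto
  moreover have "P (- {-radius..radius}) = 0" using P_compl[of "{-radius..radius}"] radius by simp
  ultimately show "- {-radius..radius} \<in> null_sets (trace_measure q)"
    by (auto simp: null_sets_def emeasure_trace_measure[OF q] trace_zero)
qed auto

lemma integrable_trace_measure:
  fixes g :: "real \<Rightarrow> real"
  assumes q: "q \<in> projections M" and g: "g \<in> borel_measurable borel" "\<And>t. \<bar>t\<bar> \<le> radius \<Longrightarrow> \<bar>g t\<bar> \<le> B"
  shows "integrable (trace_measure q) g"
proof -
  interpret finite_measure "trace_measure q" by (rule finite_trace_measure[OF q])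
  show ?thesis using AE_trace_measure_radius[OF q] g
    by (intro integrable_const_bound[of _ B]) (auto elim: eventually_mono)
qed

lemma integrable_slice:
  "q \<in> projections M \<Longrightarrow> E \<in> sets borel \<Longrightarrow> integrable (trace_measure q) (\<lambda>t. indicator E t * t)"
  by (rule integrable_trace_measure[of _ _ radius]) (auto simp: indicator_def intro: less_imp_le radius[THEN conjunct1])

lemma round_op_in: "round_op n \<in> M"
  unfolding round_op_def by (intro M_sum M_scaleR P_in finite_steps cell_borel)

lemma trace_round_op:
  assumes q: "q \<in> projections M" and E: "E \<in> sets borel"
  shows "Re (\<tau> (round_op n o\<^sub>L (P E o\<^sub>L q))) = (\<integral>t. indicator E t * round_fun n t \<partial>trace_measure q)"
proof -
  interpret finite_measure "trace_measure q" by (rule finite_trace_measure[OF q])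
  have qM: "q \<in> M" using q by (simp add: projections_M)
  let ?c = "\<lambda>i. real_of_int i / real (Suc n)"
  have b: "cell n i \<inter> E \<in> sets borel" for i using E by simp
  have "round_op n o\<^sub>L (P E o\<^sub>L q) = (\<Sum>i\<in>steps n. ?c i *\<^sub>R (P (cell n i \<inter> E) o\<^sub>L q))"
    by (rule blinfun_eqI) (simp add: round_op_def blinfun.sum_left blinfun.scaleR_left P_apply_apply E)
  then have "\<tau> (round_op n o\<^sub>L (P E o\<^sub>L q)) = (\<Sum>i\<in>steps n. ?c i * \<tau> (P (cell n i \<inter> E) o\<^sub>L q))"
    using trace_sum[OF finite_steps, of n "\<lambda>i. ?c i *\<^sub>R (P (cell n i \<inter> E) o\<^sub>L q)"]
    by (simp only: M_scaleR M_compose P_in[OF b] qM trace_scaleR)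
  then have "Re (\<tau> (round_op n o\<^sub>L (P E o\<^sub>L q))) = (\<Sum>i\<in>steps n. ?c i * measure (trace_measure q) (cell n i \<inter> E))"
    by (simp add: measure_trace_measure[OF q b])
  also have "\<dots> = (\<Sum>i\<in>steps n. \<integral>t. ?c i * indicator (cell n i \<inter> E) t \<partial>trace_measure q)"
    using b by (intro sum.cong refl) simp
  also have "\<dots> = (\<integral>t. (\<Sum>i\<in>steps n. ?c i * indicator (cell n i \<inter> E) t) \<partial>trace_measure q)"
  proof (rule Bochner_Integration.integral_sum[symmetric])
    show "integrable (trace_measure q) (\<lambda>t. ?c i * indicator (cell n i \<inter> E) t)" for i
      using b by (intro integrable_mult_right integrable_real_indicator) (auto simp: emeasure_trace_measure[OF q] less_top)
  qed
  also have "(\<lambda>t. \<Sum>i\<in>steps n. ?c i * indicator (cell n i \<inter> E) t) = (\<lambda>t. indicator E t * round_fun n t)"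
    by (auto simp: round_fun_def sum_distrib_left indicator_inter_arith intro!: ext sum.cong)
  finally show ?thesis .
qed

text \<open>Integrals of the rounding functions are traces of the rounded operators; both sides pass to the limit, the left one by
  normality of the trace.\<close>

lemma trace_slice:
  assumes q: "q \<in> projections M" and E: "E \<in> sets borel"
  shows "Re (\<tau> (a o\<^sub>L (P E o\<^sub>L q))) = (\<integral>t. indicator E t * t \<partial>trace_measure q)"
proof (rule LIMSEQ_unique)
  have qM: "q \<in> M" "q o\<^sub>L q = q" "selfadjoint q" using q by (auto simp: projections_M)
  have inv: "(\<lambda>n. 1 / real (Suc n)) \<longlonglongrightarrow> 0" by (rule LIMSEQ_Suc[OF lim_1_over_n])
  have "(\<lambda>n. \<tau> (round_op n o\<^sub>L (P E o\<^sub>L q))) \<longlonglongrightarrow> \<tau> (a o\<^sub>L (P E o\<^sub>L q))"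
  proof (rule trace_limit[where C = "norm a + 1"])
    show "round_op n o\<^sub>L (P E o\<^sub>L q) \<in> M" for n by (intro M_compose round_op_in P_in E qM)
    show "a o\<^sub>L (P E o\<^sub>L q) \<in> M" by (intro M_compose a_in P_in E qM)
    have "(\<lambda>n. round_op n x) \<longlonglongrightarrow> a x" for x
    proof (rule LIM_zero_cancel, rule Lim_null_comparison)
      show "\<forall>\<^sub>F n in sequentially. norm (round_op n x - a x) \<le> 1 / real (Suc n) * norm x"
        using round_op_norm[of x] by (intro always_eventually allI) (metis norm_minus_commute)
      show "(\<lambda>n. 1 / real (Suc n) * norm x) \<longlonglongrightarrow> 0" by (rule tendsto_mult_left_zero[OF inv])
    qed
    then show "(\<lambda>n. (round_op n o\<^sub>L (P E o\<^sub>L q)) x) \<longlonglongrightarrow> (a o\<^sub>L (P E o\<^sub>L q)) x" for x by simp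
    have rb: "norm (round_op n y) \<le> (norm a + 1) * norm y" for n y
    proof -
      have "norm (round_op n y) \<le> norm (a y) + norm (a y - round_op n y)"
        using norm_triangle_ineq4[of "a y" "a y - round_op n y"] by simp
      also have "\<dots> \<le> norm a * norm y + 1 * norm y"
      proof (rule add_mono[OF norm_blinfun order_trans[OF round_op_norm mult_right_mono]])
        show "1 / real (Suc n) \<le> 1" by simp
      qed simp
      finally show ?thesis by (simp add: distrib_right)
    qed
    show "norm ((round_op n o\<^sub>L (P E o\<^sub>L q)) x) \<le> (norm a + 1) * norm x" for n x
    proof -
      have "norm (P E (q x)) \<le> norm x" using P_norm_le[OF E, of "q x"] projection_norm_le[OF qM(2,3), of x] by simp
      then have "(norm a + 1) * norm (P E (q x)) \<le> (norm a + 1) * norm x" by (intro mult_left_mono) auto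
      then show ?thesis using rb[of n "P E (q x)"] by simp
    qed
  qed
  from tendsto_Re[OF this]
  show "(\<lambda>n. \<integral>t. indicator E t * round_fun n t \<partial>trace_measure q) \<longlonglongrightarrow> Re (\<tau> (a o\<^sub>L (P E o\<^sub>L q)))"
    by (simp only: trace_round_op[OF q E])
  interpret finite_measure "trace_measure q" by (rule finite_trace_measure[OF q])
  note [measurable] = E
  show "(\<lambda>n. \<integral>t. indicator E t * round_fun n t \<partial>trace_measure q) \<longlonglongrightarrow> (\<integral>t. indicator E t * t \<partial>trace_measure q)"
  proof (rule integral_dominated_convergence[where w = "\<lambda>_. radius + 1"])
    show "AE t in trace_measure q. (\<lambda>n. indicator E t * round_fun n t) \<longlonglongrightarrow> indicator E t * t"
      using AE_trace_measure_radius[OF q]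
    proof eventually_elim
      case (elim t)
      have "(\<lambda>n. round_fun n t) \<longlonglongrightarrow> t"
      proof (rule LIM_zero_cancel, rule Lim_null_comparison[OF _ inv])
        show "\<forall>\<^sub>F n in sequentially. norm (round_fun n t - t) \<le> 1 / real (Suc n)"
        proof (intro always_eventually allI)
          fix n
          show "norm (round_fun n t - t) \<le> 1 / real (Suc n)" using round_fun_bounds[OF elim, of n] by simp
        qed
      qed
      then show ?case by (intro tendsto_mult tendsto_const)
    qed
    show "AE t in trace_measure q. norm (indicator E t * round_fun n t) \<le> radius + 1" for n
      using AE_trace_measure_radius[OF q]
    proof eventually_elim
      case (elim t)
      have "1 / real (Suc n) \<le> 1" by simp
      then have "\<bar>round_fun n t\<bar> \<le> radius + 1" using round_fun_bounds[OF elim, of n] elim by linarith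
      then show ?case using radius by (auto simp: indicator_def)
    qed
  qed (use measurable_cong_sets in simp_all)
qed

lemma trace_slice_bounds:
  assumes q: "q \<in> projections M" and E: "E \<in> sets borel"
  shows "E \<subseteq> {c..} \<Longrightarrow> c * Re (\<tau> (P E o\<^sub>L q)) \<le> Re (\<tau> (a o\<^sub>L (P E o\<^sub>L q)))"
    and "E \<subseteq> {..c} \<Longrightarrow> Re (\<tau> (a o\<^sub>L (P E o\<^sub>L q))) \<le> c * Re (\<tau> (P E o\<^sub>L q))"
proof -
  interpret finite_measure "trace_measure q" by (rule finite_trace_measure[OF q])
  have c: "c * Re (\<tau> (P E o\<^sub>L q)) = (\<integral>t. c * indicator E t \<partial>trace_measure q)"
    using measure_trace_measure[OF q E] E by simp
  have i: "integrable (trace_measure q) (\<lambda>t. c * indicator E t)"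
    using E by (intro integrable_mult_right integrable_real_indicator) (auto simp: emeasure_trace_measure[OF q] less_top)
  show "c * Re (\<tau> (P E o\<^sub>L q)) \<le> Re (\<tau> (a o\<^sub>L (P E o\<^sub>L q)))" if "E \<subseteq> {c..}"
    unfolding c trace_slice[OF q E]
    by (rule integral_mono[OF i integrable_slice[OF q E]]) (use that in \<open>auto simp: indicator_def\<close>)
  show "Re (\<tau> (a o\<^sub>L (P E o\<^sub>L q))) \<le> c * Re (\<tau> (P E o\<^sub>L q))" if "E \<subseteq> {..c}"
    unfolding c trace_slice[OF q E]
    by (rule integral_mono[OF integrable_slice[OF q E] i]) (use that in \<open>auto simp: indicator_def\<close>)
qed

text \<open>Passing to \<open>1 - q\<close> turns a bound for \<open>q\<close> into one between \<open>q\<close> and the whole slice.\<close>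

lemma trace_slice_compl:
  assumes q: "q \<in> projections M" and E: "E \<in> sets borel"
  shows "Re (\<tau> (P E o\<^sub>L (id_blinfun - q))) = Re (\<tau> (P E)) - Re (\<tau> (P E o\<^sub>L q))"
    and "Re (\<tau> (a o\<^sub>L (P E o\<^sub>L (id_blinfun - q)))) = Re (\<tau> (a o\<^sub>L P E)) - Re (\<tau> (a o\<^sub>L (P E o\<^sub>L q)))"
proof -
  have qM: "q \<in> M" using q by (simp add: projections_M)
  have m: "P E o\<^sub>L q \<in> M" "P E \<in> M" "a o\<^sub>L P E \<in> M" "a o\<^sub>L (P E o\<^sub>L q) \<in> M"
    by (intro M_compose P_in E qM a_in)+
  have "P E o\<^sub>L (id_blinfun - q) = P E - (P E o\<^sub>L q)"
    by (rule blinfun_eqI) (simp add: blinfun.bilinear_simps)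
  then show "Re (\<tau> (P E o\<^sub>L (id_blinfun - q))) = Re (\<tau> (P E)) - Re (\<tau> (P E o\<^sub>L q))"
    using m by (simp add: trace_diff)
  have "a o\<^sub>L (P E o\<^sub>L (id_blinfun - q)) = (a o\<^sub>L P E) - (a o\<^sub>L (P E o\<^sub>L q))"
    by (rule blinfun_eqI) (simp add: blinfun.bilinear_simps)
  then show "Re (\<tau> (a o\<^sub>L (P E o\<^sub>L (id_blinfun - q)))) = Re (\<tau> (a o\<^sub>L P E)) - Re (\<tau> (a o\<^sub>L (P E o\<^sub>L q)))"
    using m by (simp add: trace_diff)
qed

text \<open>On a slice below \<open>c\<close> the operator \<open>c - a\<close> is positive, so its trace against \<open>1 - q\<close> is nonnegative.\<close>

lemma trace_slice_upper:
  assumes q: "q \<in> projections M" and E: "E \<in> sets borel" and c: "E \<subseteq> {..c}"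
  shows "Re (\<tau> (a o\<^sub>L P E)) - c * Re (\<tau> (P E)) \<le> Re (\<tau> (a o\<^sub>L (P E o\<^sub>L q))) - c * Re (\<tau> (P E o\<^sub>L q))"
  using trace_slice_bounds(2)[OF projection_compl[OF q] E c] trace_slice_compl[OF q E] by (simp add: right_diff_distrib)

lemma trace_slice_lower:
  assumes q: "q \<in> projections M" and E: "E \<in> sets borel" and c: "E \<subseteq> {c..}"
  shows "Re (\<tau> (a o\<^sub>L (P E o\<^sub>L q))) - c * Re (\<tau> (P E o\<^sub>L q)) \<le> Re (\<tau> (a o\<^sub>L P E)) - c * Re (\<tau> (P E))"
  using trace_slice_bounds(1)[OF projection_compl[OF q] E c] trace_slice_compl[OF q E] by (simp add: right_diff_distrib)

lemma P_three_slices: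
  assumes "t0 < t1"
  shows "id_blinfun = P {..<t0} + (P {t0..<t1} + P {t1..})"
proof -
  have "P ({t0..<t1} \<union> {t1..}) = P {t0..<t1} + P {t1..}" by (rule P_union) auto
  moreover have "P ({..<t0} \<union> ({t0..<t1} \<union> {t1..})) = P {..<t0} + P ({t0..<t1} \<union> {t1..})"
    by (rule P_union) (use assms in auto)
  moreover have "{..<t0} \<union> ({t0..<t1} \<union> {t1..}) = UNIV" using assms by auto
  ultimately show ?thesis by (simp add: P_UNIV)
qed

lemma trace_three_slices:
  assumes q: "q \<in> projections M" and t: "t0 < t1"
  shows "Re (\<tau> q) = Re (\<tau> (P {..<t0} o\<^sub>L q)) + Re (\<tau> (P {t0..<t1} o\<^sub>L q)) + Re (\<tau> (P {t1..} o\<^sub>L q))"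
    and "Re (\<tau> (a o\<^sub>L q)) = Re (\<tau> (a o\<^sub>L (P {..<t0} o\<^sub>L q))) + Re (\<tau> (a o\<^sub>L (P {t0..<t1} o\<^sub>L q)))
      + Re (\<tau> (a o\<^sub>L (P {t1..} o\<^sub>L q)))"
proof -
  have qM: "q \<in> M" using q by (simp add: projections_M)
  have m: "P E o\<^sub>L q \<in> M" "a o\<^sub>L (P E o\<^sub>L q) \<in> M" if "E \<in> sets borel" for E
    by (intro M_compose P_in that qM a_in)+
  have x: "x = P {..<t0} x + (P {t0..<t1} x + P {t1..} x)" for x
    using arg_cong[OF P_three_slices[OF t], of "\<lambda>s. blinfun_apply s x"] by (simp add: blinfun.add_left)
  have "q = (P {..<t0} o\<^sub>L q) + ((P {t0..<t1} o\<^sub>L q) + (P {t1..} o\<^sub>L q))"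
    by (rule blinfun_eqI) (use x in \<open>simp add: blinfun.add_left\<close>)
  from arg_cong[OF this, of \<tau>]
  show "Re (\<tau> q) = Re (\<tau> (P {..<t0} o\<^sub>L q)) + Re (\<tau> (P {t0..<t1} o\<^sub>L q)) + Re (\<tau> (P {t1..} o\<^sub>L q))"
    using m by (simp add: trace_add M_add)
  have "a o\<^sub>L q = (a o\<^sub>L (P {..<t0} o\<^sub>L q)) + ((a o\<^sub>L (P {t0..<t1} o\<^sub>L q)) + (a o\<^sub>L (P {t1..} o\<^sub>L q)))"
  proof (rule blinfun_eqI)
    fix u
    show "(a o\<^sub>L q) u = ((a o\<^sub>L (P {..<t0} o\<^sub>L q)) + ((a o\<^sub>L (P {t0..<t1} o\<^sub>L q)) + (a o\<^sub>L (P {t1..} o\<^sub>L q)))) u"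
      using arg_cong[OF x[of "q u"], of a] by (simp add: blinfun.add_left blinfun.add_right)
  qed
  from arg_cong[OF this, of \<tau>]
  show "Re (\<tau> (a o\<^sub>L q)) = Re (\<tau> (a o\<^sub>L (P {..<t0} o\<^sub>L q))) + Re (\<tau> (a o\<^sub>L (P {t0..<t1} o\<^sub>L q)))
      + Re (\<tau> (a o\<^sub>L (P {t1..} o\<^sub>L q)))"
    using m by (simp add: trace_add M_add)
qed

lemma P_disjoint_compose:
  assumes "E \<in> sets borel" "F \<in> sets borel" "E \<inter> F = {}" "P F o\<^sub>L q = q" shows "P E o\<^sub>L q = 0"
proof -
  have "P E o\<^sub>L (P F o\<^sub>L q) = P (E \<inter> F) o\<^sub>L q" by (rule blinfun_eqI) (simp add: P_apply_apply assms(1,2))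
  then show ?thesis by (simp only: assms(3,4) P_empty) simp
qed

text \<open>Compare \<open>\<tau>((a - t\<^sub>1)q)\<close> with \<open>\<tau>((a - t\<^sub>1)P[t\<^sub>0,t\<^sub>1))\<close> slice by slice: the slice below \<open>t\<^sub>0\<close> does not meet \<open>q\<close>, the one above
  \<open>t\<^sub>1\<close> contributes a nonnegative amount, and on the middle slice \<open>a - t\<^sub>1\<close> is negative, so that \<open>q\<close> cannot do better
  than the whole slice.\<close>

lemma slice_minimal:
  assumes q: "q \<in> projections M" "P {t0..} o\<^sub>L q = q" and t: "t0 < t1" and tr: "Re (\<tau> q) = Re (\<tau> (P {t0..<t1}))"
  shows "Re (\<tau> (a o\<^sub>L P {t0..<t1})) \<le> Re (\<tau> (a o\<^sub>L q))"
proof -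
  have z: "P {..<t0} o\<^sub>L q = 0" by (rule P_disjoint_compose[OF _ _ _ q(2)]) auto
  have "Re (\<tau> (a o\<^sub>L P {t0..<t1})) - t1 * Re (\<tau> (P {t0..<t1}))
      \<le> Re (\<tau> (a o\<^sub>L (P {t0..<t1} o\<^sub>L q))) - t1 * Re (\<tau> (P {t0..<t1} o\<^sub>L q))"
    by (rule trace_slice_upper[OF q(1)]) auto
  moreover have "t1 * Re (\<tau> (P {t1..} o\<^sub>L q)) \<le> Re (\<tau> (a o\<^sub>L (P {t1..} o\<^sub>L q)))"
    by (rule trace_slice_bounds(1)[OF q(1)]) auto
  ultimately show ?thesis
    using trace_three_slices[OF q(1) t] tr by (simp add: z trace_zero algebra_simps)
qed

text \<open>The mirror image of the preceding lemma, with \<open>a - t\<^sub>0\<close> in place of \<open>a - t\<^sub>1\<close>.\<close>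

lemma slice_maximal:
  assumes q: "q \<in> projections M" "P {..<t1} o\<^sub>L q = q" and t: "t0 < t1" and tr: "Re (\<tau> q) = Re (\<tau> (P {t0..<t1}))"
  shows "Re (\<tau> (a o\<^sub>L q)) \<le> Re (\<tau> (a o\<^sub>L P {t0..<t1}))"
proof -
  have z: "P {t1..} o\<^sub>L q = 0" by (rule P_disjoint_compose[OF _ _ _ q(2)]) auto
  have "Re (\<tau> (a o\<^sub>L (P {t0..<t1} o\<^sub>L q))) - t0 * Re (\<tau> (P {t0..<t1} o\<^sub>L q))
      \<le> Re (\<tau> (a o\<^sub>L P {t0..<t1})) - t0 * Re (\<tau> (P {t0..<t1}))"
    by (rule trace_slice_lower[OF q(1)]) auto
  moreover have "Re (\<tau> (a o\<^sub>L (P {..<t0} o\<^sub>L q))) \<le> t0 * Re (\<tau> (P {..<t0} o\<^sub>L q))"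
    by (rule trace_slice_bounds(2)[OF q(1)]) auto
  ultimately show ?thesis
    using trace_three_slices[OF q(1) t] tr by (simp add: z trace_zero algebra_simps)
qed

end

section \<open>Integrals of the quantile function\<close>

text \<open>Left to right the monotonicity of the distribution function is enough; the converse is its left continuity. The support
  condition makes the infimum that of a nonempty set bounded below.\<close>

lemma quantile_less_iff:
  fixes N :: "real measure"
  assumes N: "prob_space N" "sets N = sets borel" and supp: "AE t in N. \<bar>t\<bar> \<le> R" and s: "0 < s" "s < 1"
  shows "Inf {u. s < measure N {..<u}} < t \<longleftrightarrow> s < measure N {..<t}"
proof -
  interpret real_distribution N using N by (simp add: real_distribution_def real_distribution_axioms_def)
  have sp: "space N = UNIV" by simp
  have mono: "measure N {..<u} \<le> measure N {..<v}" if "u \<le> v" for u v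
    by (rule finite_measure_mono) (use that in auto)
  let ?S = "{u. s < measure N {..<u}}"
  have "measure N {..<R + 1} = measure N (space N)"
    by (rule finite_measure_eq_AE) (use supp in \<open>auto elim!: eventually_mono simp: sp\<close>)
  then have ne: "?S \<noteq> {}" using s prob_space by (auto intro!: exI[of _ "R + 1"])
  have "measure N {..<-R} = measure N {}"
    by (rule finite_measure_eq_AE) (use supp in \<open>auto elim!: eventually_mono\<close>)
  then have low: "measure N {..<u} \<le> 0" if "u \<le> -R" for u using mono[OF that] by simp
  have bdd: "bdd_below ?S"
  proof (rule bdd_belowI)
    fix u assume "u \<in> ?S"
    then show "- R \<le> u" using low[of u] s by (cases "u \<le> - R") auto
  qed
  have "Inf ?S < t \<longleftrightarrow> (\<exists>u\<in>?S. u < t)" by (rule cInf_less_iff[OF ne bdd])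
  also have "\<dots> \<longleftrightarrow> s < measure N {..<t}"
  proof
    assume "\<exists>u\<in>?S. u < t"
    then show "s < measure N {..<t}" using mono[OF less_imp_le] by force
  next
    assume lt: "s < measure N {..<t}"
    have "\<forall>\<^sub>F u in at_left t. s < cdf N u" by (rule order_tendstoD(1)[OF cdf_at_left lt])
    then obtain b where b: "b < t" "\<forall>u>b. u < t \<longrightarrow> s < cdf N u"
      by (auto simp: eventually_at_left_field)
    obtain u where u: "b < u" "u < t" using dense[OF b(1)] by blast
    obtain v where v: "u < v" "v < t" using dense[OF u(2)] by blast
    have "cdf N u \<le> measure N {..<v}"
      unfolding cdf_def by (rule finite_measure_mono) (use v in auto)
    moreover have "s < cdf N u" using b(2) u by simp
    ultimately have "v \<in> ?S" by simp
    then show "\<exists>u\<in>?S. u < t" using v(2) by blast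
  qed
  finally show ?thesis .
qed

text \<open>By the preceding lemma \<open>X\<close> carries Lebesgue measure on the unit interval to \<open>N\<close>, and it takes values in \<open>[t\<^sub>0,t\<^sub>1)\<close> exactly on
  \<open>[F(t\<^sub>0),F(t\<^sub>1))\<close>.\<close>

lemma quantile_integral:
  fixes N :: "real measure"
  assumes N: "prob_space N" "sets N = sets borel" and supp: "AE t in N. \<bar>t\<bar> \<le> R"
  defines "F \<equiv> \<lambda>t. measure N {..<t}"
  defines "X \<equiv> \<lambda>s. Inf {u. s < F u}"
  assumes lt: "F t0 < F t1"
  shows "(LBINT s=F t0..F t1. X s) = (\<integral>t. indicator {t0..<t1} t * t \<partial>N)"
proof -
  interpret prob_space N by (rule N)
  have sp: "space N = UNIV" using sets_eq_imp_space_eq[OF N(2)] by simp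
  have F01: "0 \<le> F t" "F t \<le> 1" for t by (simp_all add: F_def)
  have Xless: "X s < t \<longleftrightarrow> s < F t" if "0 < s" "s < 1" for s t
    unfolding X_def F_def by (rule quantile_less_iff[OF N supp that])
  define I where "I = restrict_space lborel {0<..<1::real}"
  have spI: "space I = {0<..<1}" by (simp add: I_def space_restrict_space)
  have Xm: "X \<in> borel_measurable I"
    unfolding borel_measurable_iff_less
  proof
    fix t
    have "{s \<in> space I. X s < t} = {..<F t} \<inter> {0<..<1}" by (auto simp: spI Xless)
    also have "\<dots> \<in> sets I" by (auto simp: I_def sets_restrict_space)
    finally show "{s \<in> space I. X s < t} \<in> sets I" .
  qed
  have law: "distr I borel X = N"
  proof (rule measure_eqI_generator_eq[where E = "range lessThan" and \<Omega> = UNIV and A = "\<lambda>i. {..<real i}"])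
    show "Int_stable (range (lessThan :: real \<Rightarrow> _))"
    proof (rule Int_stableI_image)
      fix u v :: real
      have "{..<u} \<inter> {..<v} = {..<min u v}" by auto
      then show "\<exists>w\<in>UNIV. {..<u} \<inter> {..<v} = {..<w}" by blast
    qed
    show "sets (distr I borel X) = sigma_sets UNIV (range lessThan)" "sets N = sigma_sets UNIV (range lessThan)"
      by (simp_all add: N(2) borel_Iio)
    show "(\<Union>i. {..<real i}) = (UNIV :: real set)" using reals_Archimedean2 by auto
    have em: "emeasure (distr I borel X) {..<t} = ennreal (F t)" for t
    proof -
      have "emeasure (distr I borel X) {..<t} = emeasure I (X -` {..<t} \<inter> space I)"
        by (rule emeasure_distr[OF Xm]) simp
      also have "X -` {..<t} \<inter> space I = {0<..<F t}" using F01[of t] by (auto simp: spI Xless)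
      also have "emeasure I {0<..<F t} = emeasure lborel {0<..<F t}"
        unfolding I_def by (rule emeasure_restrict_space) (use F01[of t] in auto)
      finally show ?thesis using F01[of t] by simp
    qed
    show "emeasure (distr I borel X) A = emeasure N A" if "A \<in> range lessThan" for A
      using that em by (auto simp: F_def emeasure_eq_measure)
    show "emeasure (distr I borel X) {..<real i} \<noteq> \<infinity>" for i by (simp add: em)
  qed auto
  \<comment> \<open>\<open>Y\<close> agrees with \<open>X\<close> on the unit interval and is Borel on the whole line\<close>
  define Y where "Y s = indicator {0<..<1} s *\<^sub>R X s" for s :: real
  have Ym [measurable]: "Y \<in> borel_measurable borel"
    using Xm borel_measurable_restrict_space_iff[of "{0<..<1::real}" lborel X] unfolding I_def Y_def[abs_def] by simp
  have "(\<integral>t. indicator {t0..<t1} t * t \<partial>N) = (\<integral>s. indicator {t0..<t1} (X s) * X s \<partial>I)"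
    unfolding law[symmetric] by (rule integral_distr[OF Xm]) simp
  also have "\<dots> = (\<integral>s. indicator {0<..<1} s *\<^sub>R (indicator {t0..<t1} (X s) * X s) \<partial>lborel)"
    unfolding I_def by (rule integral_restrict_space) simp
  also have "\<dots> = (\<integral>s. indicator {0<..<1} s * (indicator {t0..<t1} (Y s) * Y s) \<partial>lborel)"
    by (rule Bochner_Integration.integral_cong) (auto simp: Y_def indicator_def)
  also have "\<dots> = (\<integral>s. indicator {F t0<..<F t1} s * Y s \<partial>lborel)"
  proof (rule integral_cong_AE)
    show "AE s in lborel. indicator {0<..<1} s * (indicator {t0..<t1} (Y s) * Y s) = indicator {F t0<..<F t1} s * Y s"
      \<comment> \<open>the interval integral omits the left end point \<open>F(t\<^sub>0)\<close>\<close>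
      using AE_lborel_singleton[of "F t0"]
    proof eventually_elim
      case (elim s)
      show ?case
      proof (cases "0 < s \<and> s < 1")
        case True
        then have "X s \<in> {t0..<t1} \<longleftrightarrow> s \<in> {F t0<..<F t1}"
          using Xless[of s t0] Xless[of s t1] elim by (auto simp: not_less[symmetric])
        then show ?thesis using True by (simp add: Y_def indicator_def)
      next
        case False
        then have "s \<notin> {F t0<..<F t1}" using F01[of t0] F01[of t1] by auto
        then show ?thesis using False by (auto simp: indicator_def)
      qed
    qed
  qed simp_all
  also have "\<dots> = (\<integral>s. indicator {F t0<..<F t1} s *\<^sub>R X s \<partial>lborel)"
    by (rule Bochner_Integration.integral_cong) (use F01[of t0] F01[of t1] in \<open>auto simp: Y_def indicator_def\<close>)
  also have "\<dots> = (LBINT s=F t0..F t1. X s)"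
    using lt by (simp add: interval_lebesgue_integral_def set_lebesgue_integral_def)
  finally show ?thesis by simp
qed

section \<open>The variational formula\<close>

theorem theorem3p4:
  fixes M A :: "'h::complex_hilbert op set"
    and \<tau> :: "'h op \<Rightarrow> complex"
    and a :: "'h op"
    and t0 t1 \<delta> :: real
  assumes "von_neumann_algebra M"
    and "separable_predual M"
    and "faithful_normal_tracial_state M \<tau>"
    and "a \<in> M" and "selfadjoint a"
    and A: "A = generated_vna M a"
    and "t0 < t1"
    and \<delta>: "\<delta> = dist_fun \<tau> a t1 - dist_fun \<tau> a t0"
    and "\<delta> > 0"
    and cases: "(\<forall>B\<in>{M, A}. continuous_traces \<tau> B) \<or>
      (\<exists>n (ev :: nat \<Rightarrow> real). type_I_factor n M \<and> strict_mono_on {1..n} ev \<and>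
         spectrum M a = complex_of_real ` ev ` {1..n})"
  shows "ereal (LBINT s=dist_fun \<tau> a t0..dist_fun \<tau> a t1. quantile_fun \<tau> a s) =
      (SUP r \<in> {r \<in> projections M. Re (\<tau> r) \<ge> 1 - dist_fun \<tau> a t0}.
         INF q \<in> {q \<in> projections M. op_le q r \<and> Re (\<tau> q) = \<delta>}. ereal (Re (\<tau> (a o\<^sub>L q))))
    \<and> (\<exists>r0 \<in> projections A. r0 \<in> projections M \<and> Re (\<tau> r0) \<ge> 1 - dist_fun \<tau> a t0 \<and>
         (\<exists>q0 \<in> projections M. op_le q0 r0 \<and> Re (\<tau> q0) = \<delta> \<and>
            (LBINT s=dist_fun \<tau> a t0..dist_fun \<tau> a t1. quantile_fun \<tau> a s) = Re (\<tau> (a o\<^sub>L q0))) \<and>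
         (\<forall>q \<in> projections M. op_le q r0 \<and> Re (\<tau> q) = \<delta> \<longrightarrow>
            (LBINT s=dist_fun \<tau> a t0..dist_fun \<tau> a t1. quantile_fun \<tau> a s) \<le> Re (\<tau> (a o\<^sub>L q))))"
proof -
  define P where "P = spectral_projection a"
  have M: "M \<subseteq> cblinops" using \<open>von_neumann_algebra M\<close> by (auto simp: von_neumann_algebra_def commutant_def)
  have "is_spectral_measure a P"
    unfolding P_def spectral_projection_def
    by (rule someI_ex[of "is_spectral_measure a"], rule spectral_measure_exists) (use M \<open>a \<in> M\<close> \<open>selfadjoint a\<close> in auto)
  then have sm: "spectral_measure P a" by (simp add: is_spectral_measure_iff)
  interpret spectral_measure P a by (rule sm)
  interpret trace_resolution M \<tau> P a
    by unfold_locales (use M assms(1,3,4,5) in auto)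
  define N where "N = trace_measure id_blinfun"
  have N: "distribution \<tau> a = N" by (simp add: N_def distribution_def trace_measure_def flip: P_def)
  have P_id: "Re (\<tau> (P E)) = measure N E" if "E \<in> sets borel" for E
    using measure_trace_measure[OF projection_id that] by (simp add: N_def)
  have prob: "prob_space N"
    by (rule prob_spaceI) (simp add: N_def emeasure_trace_measure[OF projection_id] P_UNIV trace_id)
  interpret N: prob_space N by (rule prob)
  have F: "dist_fun \<tau> a t = measure N {..<t}" for t by (simp add: dist_fun_def N)
  have \<delta>_eq: "\<delta> = Re (\<tau> (P {t0..<t1}))"
  proof -
    have "measure N ({..<t0} \<union> {t0..<t1}) = measure N {..<t0} + measure N {t0..<t1}"
      by (rule N.finite_measure_Union) (auto simp: N_def)
    moreover have "{..<t0} \<union> {t0..<t1} = {..<t1}" using \<open>t0 < t1\<close> by auto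
    ultimately show ?thesis using P_id[of "{t0..<t1}"] by (simp add: \<delta> F)
  qed
  define q0 where "q0 = P {t0..<t1}"
  have q0: "q0 \<in> projections M" unfolding q0_def by (rule P_projections) simp
  define r0 where "r0 = P {t0..}"
  have r0: "r0 \<in> projections M" unfolding r0_def by (rule P_projections) simp
  have "r0 \<in> A"
    unfolding A generated_vna_def
  proof (rule InterI)
    fix B assume "B \<in> {N. von_neumann_algebra N \<and> N \<subseteq> M \<and> a \<in> N}"
    then have B: "von_neumann_algebra B" "a \<in> B" by simp_all
    show "r0 \<in> B" unfolding r0_def by (rule P_in_vna[OF B]) simp
  qed
  then have r0A: "r0 \<in> projections A" using r0 by (simp add: projections_def)
  have tr_r0: "Re (\<tau> r0) = 1 - dist_fun \<tau> a t0"
  proof -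
    have "measure N (space N - {..<t0}) = 1 - measure N {..<t0}"
      by (rule N.prob_compl) (simp add: N_def)
    moreover have "space N - {..<t0} = {t0..}" by (auto simp: N_def)
    ultimately show ?thesis using P_id[of "{t0..}"] by (simp add: r0_def F)
  qed
  have "{t0..} \<inter> {t0..<t1} = {t0..<t1}" by auto
  then have "r0 o\<^sub>L q0 = q0" using P_Int[of "{t0..}" "{t0..<t1}"] by (simp add: r0_def q0_def)
  then have r0q0: "op_le q0 r0" by (simp add: op_le_iff[OF r0 q0])
  define J where "J = (LBINT s=dist_fun \<tau> a t0..dist_fun \<tau> a t1. quantile_fun \<tau> a s)"
  have J: "J = Re (\<tau> (a o\<^sub>L q0))"
  proof -
    have sN: "sets N = sets borel" by (simp add: N_def)
    have supp: "AE t in N. \<bar>t\<bar> \<le> radius" unfolding N_def by (rule AE_trace_measure_radius[OF projection_id])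
    have "J = (\<integral>t. indicator {t0..<t1} t * t \<partial>N)"
      unfolding J_def quantile_fun_def F
      by (rule quantile_integral[OF prob sN supp]) (use \<delta> \<open>\<delta> > 0\<close> in \<open>simp add: F\<close>)
    also have "\<dots> = Re (\<tau> (a o\<^sub>L q0))"
      using trace_slice[OF projection_id, of "{t0..<t1}"] by (simp add: N_def q0_def)
    finally show ?thesis .
  qed
  have lower: "J \<le> Re (\<tau> (a o\<^sub>L q))" if "q \<in> projections M" "op_le q r0" "Re (\<tau> q) = \<delta>" for q
    unfolding J q0_def
    by (rule slice_minimal) (use that op_le_iff[OF r0 that(1)] \<delta>_eq \<open>t0 < t1\<close> in \<open>auto simp: r0_def\<close>)
  have sub: "\<exists>q\<in>projections M. m o\<^sub>L q = q \<and> Re (\<tau> q) = \<delta>" if m: "m \<in> projections M" "\<delta> \<le> Re (\<tau> m)" for m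
    using cases
  proof
    assume "\<forall>B\<in>{M, A}. continuous_traces \<tau> B"
    then have "{Re (\<tau> r) | r. r \<in> projections M \<and> op_le r m} = {0..Re (\<tau> m)}"
      using m(1) by (simp add: continuous_traces_def)
    moreover have "\<delta> \<in> {0..Re (\<tau> m)}" using m(2) \<open>\<delta> > 0\<close> by simp
    ultimately have "\<delta> \<in> {Re (\<tau> r) | r. r \<in> projections M \<and> op_le r m}" by blast
    then obtain q where "q \<in> projections M" "op_le q m" "Re (\<tau> q) = \<delta>" by auto
    then show ?thesis using op_le_iff[OF m(1)] by auto
  next
    assume "\<exists>n (ev :: nat \<Rightarrow> real). type_I_factor n M \<and> strict_mono_on {1..n} ev \<and>
         spectrum M a = complex_of_real ` ev ` {1..n}"
    then obtain n where "type_I_factor n M" by blast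
    from type_I_subprojection[OF this m(1) q0] show ?thesis using m(2) \<delta>_eq by (simp add: q0_def)
  qed
  have upper: "\<exists>q\<in>projections M. op_le q r \<and> Re (\<tau> q) = \<delta> \<and> Re (\<tau> (a o\<^sub>L q)) \<le> J"
    if r: "r \<in> projections M" "1 - dist_fun \<tau> a t0 \<le> Re (\<tau> r)" for r
  proof -
    have p: "P {..<t1} \<in> projections M" by (rule P_projections) simp
    obtain m where m: "m \<in> projections M" "r o\<^sub>L m = m" "P {..<t1} o\<^sub>L m = m"
      "Re (\<tau> r) + Re (\<tau> (P {..<t1})) - 1 \<le> Re (\<tau> m)"
      using meet_trace[OF r(1) p] by blast
    have "\<delta> \<le> Re (\<tau> m)" using m(4) r(2) P_id[of "{..<t1}"] by (simp add: \<delta> F)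
    then obtain q where q: "q \<in> projections M" "m o\<^sub>L q = q" "Re (\<tau> q) = \<delta>" using sub[OF m(1)] by blast
    have rq: "r o\<^sub>L q = q" "P {..<t1} o\<^sub>L q = q"
      using blinfun_compose_assoc[of r m q] blinfun_compose_assoc[of "P {..<t1}" m q] unfolding m(2,3) q(2) by simp_all
    have "Re (\<tau> (a o\<^sub>L q)) \<le> J"
      unfolding J q0_def by (rule slice_maximal[OF q(1) rq(2) \<open>t0 < t1\<close>]) (use q(3) \<delta>_eq in simp)
    then show ?thesis using q rq(1) op_le_iff[OF r(1) q(1)] by blast
  qed
  let ?G = "\<lambda>r. INF q \<in> {q \<in> projections M. op_le q r \<and> Re (\<tau> q) = \<delta>}. ereal (Re (\<tau> (a o\<^sub>L q)))"
  have "ereal J = (SUP r \<in> {r \<in> projections M. Re (\<tau> r) \<ge> 1 - dist_fun \<tau> a t0}. ?G r)"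
  proof (rule antisym)
    have "ereal J \<le> ?G r0" by (rule INF_greatest) (use lower in auto)
    also have "\<dots> \<le> (SUP r \<in> {r \<in> projections M. Re (\<tau> r) \<ge> 1 - dist_fun \<tau> a t0}. ?G r)"
      by (rule SUP_upper) (use r0 tr_r0 in auto)
    finally show "ereal J \<le> (SUP r \<in> {r \<in> projections M. Re (\<tau> r) \<ge> 1 - dist_fun \<tau> a t0}. ?G r)" .
    show "(SUP r \<in> {r \<in> projections M. Re (\<tau> r) \<ge> 1 - dist_fun \<tau> a t0}. ?G r) \<le> ereal J"
    proof (rule SUP_least)
      fix r assume "r \<in> {r \<in> projections M. Re (\<tau> r) \<ge> 1 - dist_fun \<tau> a t0}"
      then obtain q where q: "q \<in> projections M" "op_le q r" "Re (\<tau> q) = \<delta>" "Re (\<tau> (a o\<^sub>L q)) \<le> J"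
        using upper by blast
      show "?G r \<le> ereal J" by (rule INF_lower2[of q]) (use q in auto)
    qed
  qed
  moreover have "\<exists>q0 \<in> projections M. op_le q0 r0 \<and> Re (\<tau> q0) = \<delta> \<and> J = Re (\<tau> (a o\<^sub>L q0))"
    by (rule bexI[OF _ q0]) (use r0q0 J \<delta>_eq in \<open>auto simp: q0_def\<close>)
  ultimately show ?thesis
    unfolding J_def[symmetric] using r0A r0 tr_r0 lower by (intro conjI bexI[OF _ r0A]) auto
qed

end
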